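(* Let $(x,v)\in\mathcal{U}_T\times\mathcal{S}_T$, where $x$ has finite quadratic variation along the sequence of subdivisions $\pi_n=(0=t^n_0\le t^n_1\le\dots\le t^n_{k(n)}=T)$ and $$\sup_{t\in[0,T]\setminus\pi_n}\left(|x(t)-x(t-)|+|v(t)-v(t-)|\right)\to0\quad(n\to\infty).$$ Denote $$x^n(t)=\sum_{i=0}^{k(n)-1}x(t^n_{i+1}-)1_{[t^n_i,t^n_{i+1})}(t)+x(T)1_{\{T\}}(t),\qquad v^n(t)=\sum_{i=0}^{k(n)-1}v(t^n_i)1_{[t^n_i,t^n_{i+1})}(t)+v(T)1_{\{T\}}(t).$$ Then for any non-anticipative functional $F\in\mathbb{C}^{1,2}$ satisfying 1. $F$ is predictable in the second variable: $F_t(x_t,v_t)=F_t(x_t,v_{t-})$ for all $t\le T$ and all $(x,v)\in\mathcal{U}_t\times\mathcal{S}_t$; 2. $\nabla_x^2F$ and $\mathcal{D}F$ have the local boundedness property; 3. $F,\nabla_xF,\nabla_x^2F\in\mathbb{F}^\infty_l$; 4. $\nabla_xF$ has the horizontal local Lipschitz property; the limit $$\int_{]0,T]}\nabla_xF_t(x_{t-},v_{t-})\,d^\pi x:=\lim_{n\to\infty}\sum_{i=0}^{k(n)-1}\nabla_xF_{t^n_i}\left(x^{n,\Delta x(t^n_i)}_{t^n_i-},v^n_{t^n_i-}\right)(x(t^n_{i+1})-x(t^n_i))$$ exists, and $$F_T(x_T,v_T)-F_0(x_0,v_0)=\int_{]0,T]}\mathcal{D}_uF(x_{u-},v_{u-})\,du+\int_{]0,T]}\frac12\mathrm{tr}\left({}^t\nabla_x^2F_u(x_{u-},v_{u-})\,d[x]^c(u)\right)$$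 $$+\int_{]0,T]}\nabla_xF_t(x_{t-},v_{t-})\,d^\pi x+\sum_{u\in]0,T]}\left[F_u(x_u,v_u)-F_u(x_{u-},v_{u-})-\nabla_xF_u(x_{u-},v_{u-})\cdot\Delta x(u)\right].$$
   Context: Spaces. $T>0$, $U\subset\mathbb{R}^d$ is open, $S\subset\mathbb{R}^m$ is Borel. $\mathcal{U}_t=D([0,t],U)$ is the set of right-continuous functions $[0,t]\to U$ with left limits, all left limits lying in $U$; $\mathcal{S}_t=D([0,t],S)$ is defined likewise with $S$. Path notation. For a path $x$, $x(t)$ is its value at $t$, $\Delta x(t)=x(t)-x(t-)$ (with $\Delta x(0)=0$), and $x_t=x|_{[0,t]}$ its restriction. $x_{t-}$ is the path on $[0,t]$ with $x_{t-}(u)=x(u)$ for $u<t$ and $x_{t-}(t)=x(t-)$. For $h\ge0$ the horizontal extension $x_{t,h}$ of $x_t$ to $[0,t+h]$ is $x_{t,h}(u)=x(u)$ for $u\le t$, $x_{t,h}(u)=x(t)$ for $u\in(t,t+h]$. For $e\in\mathbb{R}^d$ the vertical perturbation $x_t^e$ is $x_t^e(u)=x_t(u)+e\,1_{u=t}$ on $[0,t]$ (when it stays $U$-valued); thus $x^{n,\Delta x(t^n_i)}_{t^n_i-}$ is the path $x^n_{t^n_i-}$ with its endpoint shifted by $\Delta x(t^n_i)$. At time $0$ conventions: $v^n_{0-}=v(0)$ and $x^n_{0-}=x(0)$. Distance. For $(x,v)\in\mathcal{U}_t\times\mathcal{S}_t$ and $(x',v')\in\mathcal{U}_{t+h}\times\mathcal{S}_{t+h}$,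 $h\ge0$: $d_\infty((x,v),(x',v'))=\sup_{u\in[0,t+h]}|x_{t,h}(u)-x'(u)|+\sup_{u\in[0,t+h]}|v_{t,h}(u)-v'(u)|+h$, and $d_\infty$ is symmetric. Functionals. A non-anticipative functional is a family $F=(F_t)_{t\in[0,T]}$ of maps $F_t:\mathcal{U}_t\times\mathcal{S}_t\to\mathbb{R}$ (vector- or matrix-valued, or indexed by $[0,T)$, similarly; conditions are then imposed for $t$ in the index set). It is continuous at fixed times if each $F_t$ is continuous for the supremum norm. $F\in\mathbb{F}^\infty_l$ if for all $t\in[0,T]$, $\epsilon>0$, $(x,v)\in\mathcal{U}_t\times\mathcal{S}_t$ there is $\eta>0$ such that for all $h\in[0,t]$ and $(x',v')\in\mathcal{U}_{t-h}\times\mathcal{S}_{t-h}$: $d_\infty((x,v),(x',v'))<\eta\Rightarrow|F_t(x,v)-F_{t-h}(x',v')|<\epsilon$. Local boundedness property: for every $(x,v)\in\mathcal{U}_T\times\mathcal{S}_T$ there exist $C>0,\eta>0$ such that for all $t$ and all $(x',v')\in\mathcal{U}_t\times\mathcal{S}_t$: $d_\infty((x_t,v_t),(x',v'))<\eta\Rightarrow|F_t(x',v')|\le C$. Horizontal local Lipschitz property: for every $(x,v)\in\mathcal{U}_T\times\mathcal{S}_T$ there exist $C>0,\eta>0$ such that for all $t_1<t_2\le T$ and all $(x',v')\in\mathcal{U}_{t_1}\times\mathcal{S}_{t_1}$: $d_\infty((x_{t_1},v_{t_1}),(x',v'))<\eta\Rightarrow|F_{t_2}(x'_{t_1,t_2-t_1},v'_{t_1,t_2-t_1})-F_{t_1}(x',v')|<C(t_2-t_1)$.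 Derivatives. Horizontal derivative at $(x,v)\in\mathcal{U}_t\times\mathcal{S}_t$, $t<T$: $\mathcal{D}_tF(x,v)=\lim_{h\to0^+}\frac{F_{t+h}(x_{t,h},v_{t,h})-F_t(x,v)}{h}$; $\mathcal{D}F=(\mathcal{D}_tF)_{t\in[0,T)}$. Vertical derivative: $\nabla_xF_t(x,v)$ is the gradient at $e=0$ of $e\mapsto F_t(x_t^e,v_t)$ (assumed differentiable at $0$); $\nabla_xF=(\nabla_xF_t)_t$; $\nabla_x^2F$ is obtained by iterating. (The condition $\nabla_xF,\nabla_x^2F\in\mathbb{F}^\infty_l$ includes that these derivatives exist for $t\in[0,T]$.) $\mathbb{C}^{j,k}$ is the set of functionals $F$ that are continuous at fixed times, admit $j$ horizontal and $k$ vertical derivatives at all $(x,v)\in\mathcal{U}_t\times\mathcal{S}_t$, $t\in[0,T)$, and such that $\mathcal{D}^mF$ ($m\le j$) and $\nabla_x^nF$ ($n\le k$) are continuous at fixed times. Quadratic variation. $(\pi_n)$ is a sequence of subdivisions of $[0,T]$ with step size tending to $0$. A cadlag $f:[0,T]\to\mathbb{R}$ has finite quadratic variation along $(\pi_n)$ if the measures $\xi^n=\sum_{i=0}^{k(n)-1}(f(t^n_{i+1})-f(t^n_i))^2\delta_{t^n_i}$ converge vaguely to a Radon measure $\xi$ on $[0,T]$ such that $[f](t):=\xi([0,t])=[f]^c(t)+\sum_{0<s\le t}(\Delta f(s))^2$, where $[f]^c$ is the continuous part of $[f]$. $x\in\mathcal{U}_T$ has finite quadratic variation along $(\pi_n)$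 if all $x_i$ ($1\le i\le d$) and $x_i+x_j$ ($1\le i<j\le d$) do; then $[x]$ is the function with values in positive symmetric $d\times d$ matrices given by $[x]_{ii}=[x_i]$, $[x]_{ij}=\frac12([x_i+x_j]-[x_i]-[x_j])$ for $i\ne j$, and $[x]^c$ is its continuous part (same formulas with $[\cdot]^c$). *)

theory Defs
  imports "HOL-Analysis.Analysis"
begin

text \<open>
  A path on \<open>[0,t]\<close> is an \<^emph>\<open>extensional\<close> function on \<open>{0..t}\<close>, so that it carries no information
  from outside \<open>[0,t]\<close> and non-anticipativity of \<open>F t x v\<close> (with \<open>x\<close>, \<open>v\<close> paths on \<open>[0,t]\<close>) is built
  into the type of its arguments. The restriction of \<open>x\<close> to \<open>[0,t]\<close> is \<open>restrict x {0..t}\<close>.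
\<close>

type_synonym ('d, 'm, 'c) functional =
  "real \<Rightarrow> (real \<Rightarrow> real ^ 'd) \<Rightarrow> (real \<Rightarrow> real ^ 'm) \<Rightarrow> 'c"

subsection \<open>Paths\<close>

definition cadlag :: "real \<Rightarrow> 'a::t2_space set \<Rightarrow> (real \<Rightarrow> 'a) set" where
  "cadlag t A = {x \<in> {0..t} \<rightarrow>\<^sub>E A.
     (\<forall>s\<in>{0..<t}. continuous (at_right s) x) \<and>
     (\<forall>s\<in>{0<..t}. \<exists>l\<in>A. (x \<longlongrightarrow> l) (at_left s))}"

definition left_lim :: "(real \<Rightarrow> 'a::t2_space) \<Rightarrow> real \<Rightarrow> 'a" where
  "left_lim x t = (if t = 0 then x 0 else Lim (at_left t) x)"

definition jump :: "(real \<Rightarrow> 'a::real_normed_vector) \<Rightarrow> real \<Rightarrow> 'a" where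
  "jump x t = x t - left_lim x t"

text \<open>
  The path \<open>x\<^bsub>t-\<^esub>\<close> on \<open>[0,t]\<close>, where the value at time \<open>0-\<close> is prescribed to be \<open>a\<close>. For a genuine
  path this value is \<open>x 0\<close>; for the approximation \<open>x\<^sup>n\<close> below it is the initial value of the
  \<^emph>\<open>original\<close> path \<open>x\<close>, which differs from \<open>x\<^sup>n(0)\<close> in general.
\<close>

definition left_path_from :: "'a \<Rightarrow> (real \<Rightarrow> 'a::t2_space) \<Rightarrow> real \<Rightarrow> real \<Rightarrow> 'a" where
  "left_path_from a x t =
     (\<lambda>u\<in>{0..t}. if u < t then x u else if t = 0 then a else left_lim x t)"

abbreviation left_path :: "(real \<Rightarrow> 'a::t2_space) \<Rightarrow> real \<Rightarrow> real \<Rightarrow> 'a" where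
  "left_path x t \<equiv> left_path_from (x 0) x t"

definition hext :: "(real \<Rightarrow> 'a) \<Rightarrow> real \<Rightarrow> real \<Rightarrow> real \<Rightarrow> 'a" where
  "hext x t h = (\<lambda>u\<in>{0..t + h}. if u \<le> t then x u else x t)"

definition vert :: "(real \<Rightarrow> 'a::real_vector) \<Rightarrow> real \<Rightarrow> 'a \<Rightarrow> real \<Rightarrow> 'a" where
  "vert x t e = (\<lambda>u\<in>{0..t}. if u = t then x u + e else x u)"

text \<open>
  The distance is made symmetric by extending both paths horizontally to the later of the two
  times; on the longer path this extension is the identity.
\<close>

definition dinf ::
  "real \<Rightarrow> (real \<Rightarrow> 'a::real_normed_vector) \<Rightarrow> (real \<Rightarrow> 'b::real_normed_vector) \<Rightarrow>
   real \<Rightarrow> (real \<Rightarrow> 'a) \<Rightarrow> (real \<Rightarrow> 'b) \<Rightarrow> real" where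
  "dinf t x v t' x' v' =
     (let s = max t t' in
        (SUP u\<in>{0..s}. norm (hext x t (s - t) u - hext x' t' (s - t') u)) +
        (SUP u\<in>{0..s}. norm (hext v t (s - t) u - hext v' t' (s - t') u)) +
        \<bar>t - t'\<bar>)"

subsection \<open>Regularity of functionals\<close>

text \<open>
  In the following \<open>I\<close> is the index set of the functional: \<open>{0..T}\<close>, or \<open>{0..<T}\<close> for the
  horizontal derivative.
\<close>

definition continuous_fixed_times ::
  "real set \<Rightarrow> (real ^ 'd) set \<Rightarrow> (real ^ 'm) set \<Rightarrow>
   ('d, 'm, 'c::real_normed_vector) functional \<Rightarrow> bool" where
  "continuous_fixed_times I U S F \<longleftrightarrow>
     (\<forall>t\<in>I. \<forall>x\<in>cadlag t U. \<forall>v\<in>cadlag t S. \<forall>\<epsilon>>0. \<exists>\<eta>>0.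
        \<forall>x'\<in>cadlag t U. \<forall>v'\<in>cadlag t S.
          dinf t x v t x' v' < \<eta> \<longrightarrow> norm (F t x v - F t x' v') < \<epsilon>)"

definition left_continuous_functional ::
  "real set \<Rightarrow> (real ^ 'd) set \<Rightarrow> (real ^ 'm) set \<Rightarrow>
   ('d, 'm, 'c::real_normed_vector) functional \<Rightarrow> bool" where
  "left_continuous_functional I U S F \<longleftrightarrow>
     (\<forall>t\<in>I. \<forall>\<epsilon>>0. \<forall>x\<in>cadlag t U. \<forall>v\<in>cadlag t S. \<exists>\<eta>>0.
        \<forall>h\<in>{0..t}. \<forall>x'\<in>cadlag (t - h) U. \<forall>v'\<in>cadlag (t - h) S.
          dinf t x v (t - h) x' v' < \<eta> \<longrightarrow> norm (F t x v - F (t - h) x' v') < \<epsilon>)"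

definition locally_bounded_functional ::
  "real \<Rightarrow> real set \<Rightarrow> (real ^ 'd) set \<Rightarrow> (real ^ 'm) set \<Rightarrow>
   ('d, 'm, 'c::real_normed_vector) functional \<Rightarrow> bool" where
  "locally_bounded_functional T I U S F \<longleftrightarrow>
     (\<forall>x\<in>cadlag T U. \<forall>v\<in>cadlag T S. \<exists>C>0. \<exists>\<eta>>0.
        \<forall>t\<in>I. \<forall>x'\<in>cadlag t U. \<forall>v'\<in>cadlag t S.
          dinf t (restrict x {0..t}) (restrict v {0..t}) t x' v' < \<eta> \<longrightarrow> norm (F t x' v') \<le> C)"

definition horizontally_locally_lipschitz ::
  "real \<Rightarrow> (real ^ 'd) set \<Rightarrow> (real ^ 'm) set \<Rightarrow>
   ('d, 'm, 'c::real_normed_vector) functional \<Rightarrow> bool" where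
  "horizontally_locally_lipschitz T U S F \<longleftrightarrow>
     (\<forall>x\<in>cadlag T U. \<forall>v\<in>cadlag T S. \<exists>C>0. \<exists>\<eta>>0.
        \<forall>t1 t2. 0 \<le> t1 \<and> t1 < t2 \<and> t2 \<le> T \<longrightarrow>
          (\<forall>x'\<in>cadlag t1 U. \<forall>v'\<in>cadlag t1 S.
             dinf t1 (restrict x {0..t1}) (restrict v {0..t1}) t1 x' v' < \<eta> \<longrightarrow>
             norm (F t2 (hext x' t1 (t2 - t1)) (hext v' t1 (t2 - t1)) - F t1 x' v') < C * (t2 - t1)))"

definition predictable_second ::
  "real \<Rightarrow> (real ^ 'd) set \<Rightarrow> (real ^ 'm) set \<Rightarrow> ('d, 'm, 'c) functional \<Rightarrow> bool" where
  "predictable_second T U S F \<longleftrightarrow>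
     (\<forall>t\<in>{0..T}. \<forall>x\<in>cadlag t U. \<forall>v\<in>cadlag t S. F t x v = F t x (left_path v t))"

subsection \<open>Derivatives of functionals\<close>

definition has_hderiv ::
  "('d, 'm, real) functional \<Rightarrow> real \<Rightarrow> (real \<Rightarrow> real ^ 'd) \<Rightarrow> (real \<Rightarrow> real ^ 'm) \<Rightarrow> real \<Rightarrow> bool" where
  "has_hderiv F t x v D \<longleftrightarrow>
     ((\<lambda>h. (F (t + h) (hext x t h) (hext v t h) - F t x v) / h) \<longlongrightarrow> D) (at_right 0)"

definition hderiv :: "('d::finite, 'm::finite, real) functional \<Rightarrow> ('d, 'm, real) functional" where
  "hderiv F t x v = (THE D. has_hderiv F t x v D)"

definition vert_differentiable ::
  "('d, 'm, 'c::real_normed_vector) functional \<Rightarrow> real \<Rightarrow> (real \<Rightarrow> real ^ 'd) \<Rightarrow>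
   (real \<Rightarrow> real ^ 'm) \<Rightarrow> bool" where
  "vert_differentiable F t x v \<longleftrightarrow> (\<lambda>e. F t (vert x t e) v) differentiable (at 0)"

definition vgrad :: "('d::finite, 'm::finite, real) functional \<Rightarrow> ('d, 'm, real ^ 'd) functional" where
  "vgrad F t x v = (THE D. GDERIV (\<lambda>e. F t (vert x t e) v) 0 :> D)"

definition vhess :: "('d::finite, 'm::finite, real) functional \<Rightarrow> ('d, 'm, real ^ 'd ^ 'd) functional" where
  "vhess F t x v = jacobian (\<lambda>e. vgrad F t (vert x t e) v) (at 0)"

definition twice_vert_differentiable_on ::
  "real set \<Rightarrow> (real ^ 'd) set \<Rightarrow> (real ^ 'm) set \<Rightarrow> ('d, 'm, real) functional \<Rightarrow> bool" where
  "twice_vert_differentiable_on I U S F \<longleftrightarrow>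
     (\<forall>t\<in>I. \<forall>x\<in>cadlag t U. \<forall>v\<in>cadlag t S.
        vert_differentiable F t x v \<and> vert_differentiable (vgrad F) t x v)"

definition C12 ::
  "real \<Rightarrow> (real ^ 'd) set \<Rightarrow> (real ^ 'm) set \<Rightarrow> ('d, 'm, real) functional \<Rightarrow> bool" where
  "C12 T U S F \<longleftrightarrow>
     continuous_fixed_times {0..T} U S F \<and>
     (\<forall>t\<in>{0..<T}. \<forall>x\<in>cadlag t U. \<forall>v\<in>cadlag t S. \<exists>D. has_hderiv F t x v D) \<and>
     twice_vert_differentiable_on {0..<T} U S F \<and>
     continuous_fixed_times {0..<T} U S (hderiv F) \<and>
     continuous_fixed_times {0..<T} U S (vgrad F) \<and>
     continuous_fixed_times {0..<T} U S (vhess F)"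

subsection \<open>Subdivisions and quadratic variation\<close>

text \<open>
  The \<open>n\<close>-th subdivision consists of the points \<open>p n 0 \<le> \<dots> \<le> p n (k n)\<close>.
\<close>

definition subdivisions :: "real \<Rightarrow> (nat \<Rightarrow> nat \<Rightarrow> real) \<Rightarrow> (nat \<Rightarrow> nat) \<Rightarrow> bool" where
  "subdivisions T p k \<longleftrightarrow>
     (\<forall>n. p n 0 = 0 \<and> p n (k n) = T \<and> (\<forall>i<k n. p n i \<le> p n (Suc i))) \<and>
     (\<lambda>n. MAX i\<in>{..<k n}. p n (Suc i) - p n i) \<longlonglongrightarrow> 0"

text \<open>
  The discrete measure \<open>\<Sum>i. (f (p n (Suc i)) - f (p n i))\<^sup>2 \<delta>\<^bsub>p n i\<^esub>\<close> on \<open>[0,T]\<close>, as the image of a weighted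
  counting measure on the indices.
\<close>

definition discrete_qv ::
  "real \<Rightarrow> (nat \<Rightarrow> nat \<Rightarrow> real) \<Rightarrow> (nat \<Rightarrow> nat) \<Rightarrow> (real \<Rightarrow> real) \<Rightarrow> nat \<Rightarrow> real measure" where
  "discrete_qv T p k f n =
     distr (point_measure {..<k n} (\<lambda>i. ennreal ((f (p n (Suc i)) - f (p n i))\<^sup>2)))
       (restrict_space borel {0..T}) (p n)"

text \<open>
  The distribution function of the atomless part of \<open>M\<close>; in particular it vanishes at \<open>0\<close>.
\<close>

definition cont_part :: "real measure \<Rightarrow> real \<Rightarrow> real" where
  "cont_part M t = measure M {0..t} - (\<Sum>\<^sub>\<infinity>s\<in>{0..t}. measure M {s})"

text \<open>
  Radon measures on the compact interval \<open>[0,T]\<close> are the finite Borel measures, and the test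
  functions for vague convergence are all continuous functions on \<open>[0,T]\<close>. The last conjunct is
  \<open>[f](t) = [f]\<^sup>c(t) + (\<Sum>0 < s \<le> t. (\<Delta>f(s))\<^sup>2)\<close>, including convergence of the sum.
\<close>

definition qv_measure ::
  "real \<Rightarrow> (nat \<Rightarrow> nat \<Rightarrow> real) \<Rightarrow> (nat \<Rightarrow> nat) \<Rightarrow> (real \<Rightarrow> real) \<Rightarrow> real measure \<Rightarrow> bool" where
  "qv_measure T p k f M \<longleftrightarrow>
     sets M = sets (restrict_space borel {0..T}) \<and> finite_measure M \<and>
     (\<forall>\<phi> :: real \<Rightarrow> real. continuous_on {0..T} \<phi> \<longrightarrow>
        (\<lambda>n. integral\<^sup>L (discrete_qv T p k f n) \<phi>) \<longlonglongrightarrow> integral\<^sup>L M \<phi>) \<and>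
     (\<forall>t\<in>{0..T}.
        ((\<lambda>s. (jump f s)\<^sup>2) has_sum (measure M {0..t} - cont_part M t)) {0<..t})"

definition has_qv_real ::
  "real \<Rightarrow> (nat \<Rightarrow> nat \<Rightarrow> real) \<Rightarrow> (nat \<Rightarrow> nat) \<Rightarrow> (real \<Rightarrow> real) \<Rightarrow> bool" where
  "has_qv_real T p k f \<longleftrightarrow> (\<exists>M. qv_measure T p k f M)"

text \<open>
  The vague limit is unique, so the choice made by \<open>SOME\<close> is immaterial. This is \<open>[f]\<^sup>c\<close>.
\<close>

definition qv_cont ::
  "real \<Rightarrow> (nat \<Rightarrow> nat \<Rightarrow> real) \<Rightarrow> (nat \<Rightarrow> nat) \<Rightarrow> (real \<Rightarrow> real) \<Rightarrow> real \<Rightarrow> real" where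
  "qv_cont T p k f = cont_part (SOME M. qv_measure T p k f M)"

definition has_qv ::
  "real \<Rightarrow> (nat \<Rightarrow> nat \<Rightarrow> real) \<Rightarrow> (nat \<Rightarrow> nat) \<Rightarrow> (real \<Rightarrow> real ^ 'd) \<Rightarrow> bool" where
  "has_qv T p k x \<longleftrightarrow>
     (\<forall>i. has_qv_real T p k (\<lambda>t. x t $ i)) \<and>
     (\<forall>i j. i \<noteq> j \<longrightarrow> has_qv_real T p k (\<lambda>t. x t $ i + x t $ j))"

text \<open>
  Lebesgue--Stieltjes measure of \<open>[f]\<^sup>c\<close>, extended constantly outside \<open>[0,T]\<close>.
\<close>

definition dqv_cont ::
  "real \<Rightarrow> (nat \<Rightarrow> nat \<Rightarrow> real) \<Rightarrow> (nat \<Rightarrow> nat) \<Rightarrow> (real \<Rightarrow> real) \<Rightarrow> real measure" where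
  "dqv_cont T p k f = interval_measure (\<lambda>t. qv_cont T p k f (max 0 (min T t)))"

text \<open>
  Integration over \<open>]0,T]\<close> against the entry \<open>[x]\<^sup>c\<^sub>i\<^sub>j\<close>. Off the diagonal,
  \<open>[x]\<^sup>c\<^sub>i\<^sub>j = ([x\<^sub>i + x\<^sub>j]\<^sup>c - [x\<^sub>i]\<^sup>c - [x\<^sub>j]\<^sup>c) / 2\<close> is of finite variation only, and the
  Stieltjes integral is the corresponding combination of integrals against monotone functions.
\<close>

definition qv_cont_integrable ::
  "real \<Rightarrow> (nat \<Rightarrow> nat \<Rightarrow> real) \<Rightarrow> (nat \<Rightarrow> nat) \<Rightarrow> (real \<Rightarrow> real ^ 'd) \<Rightarrow> 'd \<Rightarrow> 'd \<Rightarrow>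
   (real \<Rightarrow> real) \<Rightarrow> bool" where
  "qv_cont_integrable T p k x i j g \<longleftrightarrow>
     set_integrable (dqv_cont T p k (\<lambda>t. x t $ i)) {0<..T} g \<and>
     set_integrable (dqv_cont T p k (\<lambda>t. x t $ j)) {0<..T} g \<and>
     (i \<noteq> j \<longrightarrow> set_integrable (dqv_cont T p k (\<lambda>t. x t $ i + x t $ j)) {0<..T} g)"

definition qv_cont_integral ::
  "real \<Rightarrow> (nat \<Rightarrow> nat \<Rightarrow> real) \<Rightarrow> (nat \<Rightarrow> nat) \<Rightarrow> (real \<Rightarrow> real ^ 'd) \<Rightarrow> 'd \<Rightarrow> 'd \<Rightarrow>
   (real \<Rightarrow> real) \<Rightarrow> real" where
  "qv_cont_integral T p k x i j g =
     (if i = j then set_lebesgue_integral (dqv_cont T p k (\<lambda>t. x t $ i)) {0<..T} g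
      else (set_lebesgue_integral (dqv_cont T p k (\<lambda>t. x t $ i + x t $ j)) {0<..T} g
            - set_lebesgue_integral (dqv_cont T p k (\<lambda>t. x t $ i)) {0<..T} g
            - set_lebesgue_integral (dqv_cont T p k (\<lambda>t. x t $ j)) {0<..T} g) / 2)"

text \<open>
  \<open>\<integral>\<^bsub>]0,T]\<^esub> tr (transpose (A u) d[x]\<^sup>c(u))\<close>, the trace being expanded into entries.
\<close>

definition trace_qv_cont_integral ::
  "real \<Rightarrow> (nat \<Rightarrow> nat \<Rightarrow> real) \<Rightarrow> (nat \<Rightarrow> nat) \<Rightarrow> (real \<Rightarrow> real ^ 'd) \<Rightarrow>
   (real \<Rightarrow> real ^ 'd ^ 'd) \<Rightarrow> real" where
  "trace_qv_cont_integral T p k x A =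
     (\<Sum>j\<in>UNIV. \<Sum>i\<in>UNIV. qv_cont_integral T p k x i j (\<lambda>u. A u $ i $ j))"

subsection \<open>Approximating paths and the pathwise integral\<close>

definition approx_left ::
  "real \<Rightarrow> (nat \<Rightarrow> nat \<Rightarrow> real) \<Rightarrow> (nat \<Rightarrow> nat) \<Rightarrow> (real \<Rightarrow> 'a::real_normed_vector) \<Rightarrow>
   nat \<Rightarrow> real \<Rightarrow> 'a" where
  "approx_left T p k x n = (\<lambda>t\<in>{0..T}.
     (\<Sum>i<k n. indicator {p n i..<p n (Suc i)} t *\<^sub>R left_lim x (p n (Suc i)))
     + indicator {T} t *\<^sub>R x T)"

definition approx_right ::
  "real \<Rightarrow> (nat \<Rightarrow> nat \<Rightarrow> real) \<Rightarrow> (nat \<Rightarrow> nat) \<Rightarrow> (real \<Rightarrow> 'a::real_normed_vector) \<Rightarrow>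
   nat \<Rightarrow> real \<Rightarrow> 'a" where
  "approx_right T p k v n = (\<lambda>t\<in>{0..T}.
     (\<Sum>i<k n. indicator {p n i..<p n (Suc i)} t *\<^sub>R v (p n i))
     + indicator {T} t *\<^sub>R v T)"

definition pathwise_sum ::
  "real \<Rightarrow> (nat \<Rightarrow> nat \<Rightarrow> real) \<Rightarrow> (nat \<Rightarrow> nat) \<Rightarrow> ('d, 'm, real) functional \<Rightarrow>
   (real \<Rightarrow> real ^ 'd) \<Rightarrow> (real \<Rightarrow> real ^ 'm) \<Rightarrow> nat \<Rightarrow> real" where
  "pathwise_sum T p k F x v n =
     (\<Sum>i<k n.
        vgrad F (p n i)
          (vert (left_path_from (x 0) (approx_left T p k x n) (p n i)) (p n i) (jump x (p n i)))
          (left_path_from (v 0) (approx_right T p k v n) (p n i))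
        \<bullet> (x (p n (Suc i)) - x (p n i)))"

definition pathwise_integral ::
  "real \<Rightarrow> (nat \<Rightarrow> nat \<Rightarrow> real) \<Rightarrow> (nat \<Rightarrow> nat) \<Rightarrow> ('d, 'm, real) functional \<Rightarrow>
   (real \<Rightarrow> real ^ 'd) \<Rightarrow> (real \<Rightarrow> real ^ 'm) \<Rightarrow> real" where
  "pathwise_integral T p k F x v = lim (pathwise_sum T p k F x v)"

end

theory Submission
  imports Defs "HOL-Probability.Distribution_Functions"
begin

text \<open>
  Between consecutive subdivision points \<open>t\<close> and \<open>t'\<close> the increment of \<open>F\<close> along the approximating
  paths is split into a vertical move by the gap \<open>\<delta> = x(t'-) - x(t)\<close>, a horizontal move, and a
  jump \<open>\<Delta>x(t')\<close>. The gaps tend to zero uniformly, since all non-negligible jumps sit at subdivision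
  points. The horizontal moves integrate the right derivative \<open>hderiv F\<close> and converge by dominated
  convergence. The jumps contribute a sum dominated by a multiple of \<open>\<bar>\<Delta>x\<bar>\<^sup>2\<close>. A second-order Taylor
  expansion of the vertical moves leaves the gradient term of the pathwise sum and quadratic terms in
  the gaps. Mixed products of gaps and jumps vanish, so the squared gaps converge vaguely to the
  atomless part of the quadratic variation. The Hessians in these terms converge only along times
  approaching from the left, hence at all but countably many times from both sides; this is enough to
  pass to the limit against an atomless measure.
\<close>

section \<open>Paths\<close>

text \<open>Jumps are only square summable, so the sum of their absolute values may be infinite. The
  pathwise sum, however, pairs the gradient at the left end of a step with the whole increment,
  including the jump at the right end, while the expansion of that jump needs the gradient just
  before the right end. The discrepancy is therefore estimated by quantities that pair with jumps
  through sums of squares: moving the gradient horizontally costs a multiple of the step length by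
  the horizontal Lipschitz property, moving it vertically costs a multiple of the gap by the bounded
  Hessian. Both are uniformly small with bounded sums of squares, and
  \<open>cross_terms_vanish\<close> handles both. Predictability in the second variable joins the
  steps: a step ends with the second path at v^n(t-), the next begins with v^n(t), and neither F nor
  its gradient sees the difference.\<close>

lemma cadlag_value: "x \<in> cadlag T A \<Longrightarrow> s \<in> {0..T} \<Longrightarrow> x s \<in> A"
  by (auto simp: cadlag_def PiE_iff)

lemma left_lim_eqI: "(x \<longlongrightarrow> l) (at_left s) \<Longrightarrow> 0 < s \<Longrightarrow> left_lim x s = l"
  for x :: "real \<Rightarrow> 'a::t2_space"
  by (simp add: left_lim_def tendsto_Lim)

lemma left_lim_0 [simp]: "left_lim x 0 = x 0"
  by (simp add: left_lim_def)

lemma left_lim_cong: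
  fixes x y :: "real \<Rightarrow> 'a::t2_space"
  assumes "0 < s" "r < s" "\<And>u. r < u \<Longrightarrow> u < s \<Longrightarrow> x u = y u"
  shows "left_lim x s = left_lim y s"
proof -
  have "eventually (\<lambda>u. x u = y u) (at_left s)"
    using assms by (auto simp: eventually_at_left_field intro!: exI[of _ r])
  then have "(x \<longlongrightarrow> l) (at_left s) \<longleftrightarrow> (y \<longlongrightarrow> l) (at_left s)" for l
    by (rule tendsto_cong)
  then have "(\<lambda>l. (x \<longlongrightarrow> l) (at_left s)) = (\<lambda>l. (y \<longlongrightarrow> l) (at_left s))"
    by blast
  then show ?thesis
    using assms(1) by (simp add: left_lim_def t2_space_class.Lim_def)
qed

lemma cadlag_left_tendsto:
  assumes "x \<in> cadlag T A" "0 < s" "s \<le> T"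
  shows "(x \<longlongrightarrow> left_lim x s) (at_left s)"
proof -
  from assms obtain l where "(x \<longlongrightarrow> l) (at_left s)"
    unfolding cadlag_def by fastforce
  with left_lim_eqI[OF this \<open>0 < s\<close>] show ?thesis by simp
qed

lemma cadlag_left_lim_in:
  assumes "x \<in> cadlag T A" "s \<in> {0..T}"
  shows "left_lim x s \<in> A"
proof (cases "s = 0")
  case False
  with assms obtain l where "(x \<longlongrightarrow> l) (at_left s)" "l \<in> A"
    unfolding cadlag_def by fastforce
  with left_lim_eqI[OF this(1)] assms False show ?thesis by simp
qed (use assms in \<open>auto simp: cadlag_value\<close>)

lemma cadlag_right_tendsto:
  assumes "x \<in> cadlag T A" "0 \<le> s" "s < T"
  shows "(x \<longlongrightarrow> x s) (at_right s)"
  using assms unfolding cadlag_def by (auto simp: continuous_within)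

lemma jump_0 [simp]: "jump x 0 = 0"
  by (simp add: jump_def)

lemma jump_bounded_linear:
  assumes "x \<in> cadlag T A" "s \<in> {0..T}" "bounded_linear L"
  shows "left_lim (\<lambda>t. L (x t)) s = L (left_lim x s)" "jump (\<lambda>t. L (x t)) s = L (jump x s)"
proof -
  interpret L: bounded_linear L by fact
  show *: "left_lim (\<lambda>t. L (x t)) s = L (left_lim x s)"
  proof (cases "s = 0")
    case False
    with assms(2) have "0 < s" "s \<le> T" by auto
    from L.tendsto[OF cadlag_left_tendsto[OF assms(1) this]] \<open>0 < s\<close> show ?thesis
      by (rule left_lim_eqI)
  qed simp
  show "jump (\<lambda>t. L (x t)) s = L (jump x s)"
    by (simp add: jump_def * L.diff)
qed

text \<open>
  Every path at which a functional is evaluated below (restriction, left path, vertical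
  perturbation) is some \<open>x\<close> on \<open>[0,t[\<close> with a prescribed endpoint \<open>a\<close>.
\<close>

definition stop :: "(real \<Rightarrow> 'a) \<Rightarrow> real \<Rightarrow> 'a \<Rightarrow> real \<Rightarrow> 'a" where
  "stop x t a = (\<lambda>u\<in>{0..t}. if u < t then x u else a)"

lemma stop_less [simp]: "0 \<le> u \<Longrightarrow> u < t \<Longrightarrow> stop x t a u = x u"
  by (simp add: stop_def)

lemma stop_end [simp]: "0 \<le> t \<Longrightarrow> stop x t a t = a"
  by (simp add: stop_def)

lemma stop_cong: "(\<And>u. 0 \<le> u \<Longrightarrow> u < t \<Longrightarrow> x u = y u) \<Longrightarrow> stop x t a = stop y t a"
  by (auto simp: stop_def fun_eq_iff)

lemma stop_cadlag:
  assumes "x \<in> cadlag T A" "0 \<le> t" "t \<le> T" "a \<in> A"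
  shows "stop x t a \<in> cadlag t A"
  unfolding cadlag_def
proof (intro CollectI conjI ballI)
  show "stop x t a \<in> {0..t} \<rightarrow>\<^sub>E A"
    using assms(2-) by (auto simp: stop_def intro!: cadlag_value[OF assms(1)])
next
  fix s assume s: "s \<in> {0..<t}"
  have "(x \<longlongrightarrow> x s) (at_right s)"
    using s assms by (intro cadlag_right_tendsto[OF assms(1)]) auto
  moreover have "eventually (\<lambda>u. x u = stop x t a u) (at_right s)"
    using s by (auto simp: eventually_at_right_field intro!: exI[of _ t])
  ultimately have "(stop x t a \<longlongrightarrow> x s) (at_right s)"
    by (rule Lim_transform_eventually)
  then show "continuous (at_right s) (stop x t a)"
    using s by (simp add: continuous_within)
next
  fix s assume s: "s \<in> {0<..t}"
  have "(x \<longlongrightarrow> left_lim x s) (at_left s)"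
    using s assms by (intro cadlag_left_tendsto[OF assms(1)]) auto
  moreover have "eventually (\<lambda>u. x u = stop x t a u) (at_left s)"
    using s by (auto simp: eventually_at_left_field intro!: exI[of _ 0])
  ultimately have "(stop x t a \<longlongrightarrow> left_lim x s) (at_left s)"
    by (rule Lim_transform_eventually)
  moreover have "left_lim x s \<in> A"
    using s assms by (intro cadlag_left_lim_in[OF assms(1)]) auto
  ultimately show "\<exists>l\<in>A. (stop x t a \<longlongrightarrow> l) (at_left s)" by auto
qed

lemma restrict_eq_stop: "restrict x {0..t} = stop x t (x t)"
  by (auto simp: stop_def fun_eq_iff)

lemma left_path_from_eq_stop: "left_path_from a x t = stop x t (if t = 0 then a else left_lim x t)"
  by (auto simp: stop_def left_path_from_def fun_eq_iff)

lemma left_path_eq_stop: "left_path x t = stop x t (left_lim x t)"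
  by (auto simp: stop_def left_path_from_def fun_eq_iff)

lemma vert_stop [simp]: "vert (stop x t a) t e = stop x t (a + e)"
  by (auto simp: stop_def vert_def fun_eq_iff)

lemma vert_vert [simp]: "vert (vert z t a) t e = vert z t (a + e)"
  by (auto simp: vert_def fun_eq_iff)

lemma vert_0:
  assumes "z \<in> cadlag t A"
  shows "vert z t 0 = z"
proof -
  have "z \<in> extensional {0..t}" using assms by (auto simp: cadlag_def PiE_def)
  then show ?thesis by (auto simp: vert_def fun_eq_iff extensional_def)
qed

lemma cadlag_eq_stop:
  assumes "z \<in> cadlag t A"
  shows "z = stop z t (z t)"
proof -
  have "z \<in> extensional {0..t}" using assms by (auto simp: cadlag_def PiE_def)
  then show ?thesis by (auto simp: stop_def fun_eq_iff extensional_def)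
qed

lemma vert_cadlag:
  assumes "z \<in> cadlag t A" "0 \<le> t" "z t + e \<in> A"
  shows "vert z t e \<in> cadlag t A"
  by (metis assms cadlag_eq_stop order_refl stop_cadlag vert_stop)

lemma left_lim_stop: "0 < t \<Longrightarrow> left_lim (stop x t a) t = left_lim x t"
  by (rule left_lim_cong[of t 0]) auto

lemma left_path_restrict: "0 \<le> t \<Longrightarrow> left_path (stop x t (x t)) t = stop x t (left_lim x t)"
  unfolding left_path_eq_stop by (cases "t = 0") (auto simp: left_lim_stop intro!: stop_cong)

lemma restrict_cadlag: "x \<in> cadlag T A \<Longrightarrow> 0 \<le> t \<Longrightarrow> t \<le> T \<Longrightarrow> stop x t (x t) \<in> cadlag t A"
  by (rule stop_cadlag) (auto intro: cadlag_value)

lemma left_path_cadlag: "x \<in> cadlag T A \<Longrightarrow> 0 \<le> t \<Longrightarrow> t \<le> T \<Longrightarrow> stop x t (left_lim x t) \<in> cadlag t A"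
  by (rule stop_cadlag) (auto intro: cadlag_left_lim_in)

lemma hext_stop:
  assumes "0 \<le> t" "0 \<le> h" "\<And>u. t \<le> u \<Longrightarrow> u < t + h \<Longrightarrow> x u = a"
  shows "hext (stop x t a) t h = stop x (t + h) a"
  using assms by (auto simp: hext_def stop_def fun_eq_iff)

section \<open>Local behaviour of cadlag paths and its uniform consequences\<close>

lemma cadlag_local_limits:
  fixes x :: "real \<Rightarrow> 'a::real_normed_vector"
  assumes "x \<in> cadlag T A" "u \<in> {0..T}" "e > 0"
  obtains d where "d > 0"
    "\<And>s. 0 \<le> s \<Longrightarrow> s \<le> T \<Longrightarrow> u - d < s \<Longrightarrow> s < u \<Longrightarrow> norm (x s - left_lim x u) < e"
    "\<And>s. 0 \<le> s \<Longrightarrow> s \<le> T \<Longrightarrow> u \<le> s \<Longrightarrow> s < u + d \<Longrightarrow> norm (x s - x u) < e"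
proof -
  have "\<exists>d>0. \<forall>s. 0 \<le> s \<and> s \<le> T \<and> u - d < s \<and> s < u \<longrightarrow> norm (x s - left_lim x u) < e"
  proof (cases "u = 0")
    case False
    then have "(x \<longlongrightarrow> left_lim x u) (at_left u)"
      using assms by (intro cadlag_left_tendsto) auto
    from tendstoD[OF this assms(3)] obtain b where "b < u" "\<And>s. b < s \<Longrightarrow> s < u \<Longrightarrow> dist (x s) (left_lim x u) < e"
      by (auto simp: eventually_at_left_field)
    then show ?thesis by (intro exI[of _ "u - b"]) (auto simp: dist_norm)
  qed (auto intro!: exI[of _ 1])
  then obtain d1 where d1: "d1 > 0" "\<And>s. 0 \<le> s \<Longrightarrow> s \<le> T \<Longrightarrow> u - d1 < s \<Longrightarrow> s < u \<Longrightarrow> norm (x s - left_lim x u) < e"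
    by blast
  have "\<exists>d>0. \<forall>s. 0 \<le> s \<and> s \<le> T \<and> u \<le> s \<and> s < u + d \<longrightarrow> norm (x s - x u) < e"
  proof (cases "u = T")
    case True
    then show ?thesis using assms by (intro exI[of _ 1]) (auto dest: order_antisym)
  next
    case False
    then have "(x \<longlongrightarrow> x u) (at_right u)"
      using assms by (intro cadlag_right_tendsto) auto
    from tendstoD[OF this assms(3)] obtain b where "b > u" "\<And>s. u < s \<Longrightarrow> s < b \<Longrightarrow> dist (x s) (x u) < e"
      by (auto simp: eventually_at_right_field)
    then show ?thesis using assms(3) by (intro exI[of _ "b - u"]) (auto simp: dist_norm le_less)
  qed
  then obtain d2 where d2: "d2 > 0" "\<And>s. 0 \<le> s \<Longrightarrow> s \<le> T \<Longrightarrow> u \<le> s \<Longrightarrow> s < u + d2 \<Longrightarrow> norm (x s - x u) < e"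
    by blast
  show ?thesis
    by (rule that[of "min d1 d2"]) (use d1 d2 in auto)
qed

text \<open>Around each time \<open>u\<close> the path stays within c/2 of its left limit before
  \<open>u\<close> and of its value from \<open>u\<close> on. A Lebesgue number of this cover puts
  both \<open>s\<close> and \<open>t\<close> into one such neighbourhood, so the only jump to be
  charged is the one at its centre, and only if the centre lies in ]s,t].\<close>

lemma cadlag_oscillation:
  fixes x :: "real \<Rightarrow> 'a::real_normed_vector"
  assumes x: "x \<in> cadlag T A" and c: "c > 0"
  obtains \<delta> where "\<delta> > 0"
    "\<And>s t. 0 \<le> s \<Longrightarrow> s < t \<Longrightarrow> t \<le> T \<Longrightarrow> t - s < \<delta> \<Longrightarrow>
       \<exists>u. s < u \<and> u \<le> t \<and> norm (x t - x s) \<le> c + norm (jump x u)"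
proof -
  define P where "P u d \<longleftrightarrow> d > 0 \<and>
    (\<forall>s. 0 \<le> s \<and> s \<le> T \<and> u - d < s \<and> s < u \<longrightarrow> norm (x s - left_lim x u) < c / 2) \<and>
    (\<forall>s. 0 \<le> s \<and> s \<le> T \<and> u \<le> s \<and> s < u + d \<longrightarrow> norm (x s - x u) < c / 2)" for u d
  have "\<exists>d. P u d" if "u \<in> {0..T}" for u
  proof -
    have "0 < c / 2" using c by simp
    from cadlag_local_limits[OF x that this] show ?thesis unfolding P_def by metis
  qed
  then obtain d where d: "\<And>u. u \<in> {0..T} \<Longrightarrow> P u (d u)" by metis
  have "{0..T} \<subseteq> \<Union> ((\<lambda>u. ball u (d u)) ` {0..T})"
    using d by (auto simp: P_def)
  then obtain e where e: "e > 0" "\<And>y. y \<in> {0..T} \<Longrightarrow> \<exists>G\<in>(\<lambda>u. ball u (d u)) ` {0..T}. ball y e \<subseteq> G"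
    by (rule Heine_Borel_lemma[OF compact_Icc]) auto
  have "\<exists>u. s < u \<and> u \<le> t \<and> norm (x t - x s) \<le> c + norm (jump x u)"
    if st: "0 \<le> s" "s < t" "t \<le> T" "t - s < e" for s t
  proof -
    from e(2)[of s] st obtain u where u: "u \<in> {0..T}" "ball s e \<subseteq> ball u (d u)" by auto
    have "s \<in> ball s e" "t \<in> ball s e" using st e(1) by (auto simp: dist_real_def)
    then have "s \<in> ball u (d u)" "t \<in> ball u (d u)" using u(2) by blast+
    then have near: "u - d u < s" "t < u + d u" by (auto simp: dist_real_def)
    note Pu = d[OF u(1), unfolded P_def]
    consider "t < u" | "u \<le> s" | "s < u" "u \<le> t" by linarith
    then show ?thesis
    proof cases
      case 1
      then have "norm (x s - left_lim x u) < c / 2" "norm (x t - left_lim x u) < c / 2"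
        using Pu st near by auto
      then have "norm (x t - x s) \<le> c"
        using norm_triangle_ineq4[of "x t - left_lim x u" "x s - left_lim x u"] by simp
      then show ?thesis using st by (intro exI[of _ t]) (auto intro: add_increasing2)
    next
      case 2
      then have "norm (x s - x u) < c / 2" "norm (x t - x u) < c / 2"
        using Pu st near by auto
      then have "norm (x t - x s) \<le> c"
        using norm_triangle_ineq4[of "x t - x u" "x s - x u"] by simp
      then show ?thesis using st by (intro exI[of _ t]) (auto intro: add_increasing2)
    next
      case 3
      then have "norm (x s - left_lim x u) < c / 2" "norm (x t - x u) < c / 2"
        using Pu st near by auto
      moreover have "x t - x s = (x t - x u) + (jump x u - (x s - left_lim x u))"
        by (simp add: jump_def)
      moreover have "norm ((x t - x u) + (jump x u - (x s - left_lim x u)))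
        \<le> norm (x t - x u) + (norm (jump x u) + norm (x s - left_lim x u))"
        by (meson add_left_mono norm_triangle_ineq norm_triangle_ineq4 order_trans)
      ultimately have "norm (x t - x s) \<le> c + norm (jump x u)" by (smt (verit) field_sum_of_halves)
      then show ?thesis using 3 by blast
    qed
  qed
  with that e(1) show ?thesis by blast
qed

text \<open>Turns local bounds into a uniform one: by monotonicity in the natural number the largest
  parameter of a finite subcover serves everywhere.\<close>

lemma compact_local_to_global:
  fixes P :: "nat \<Rightarrow> real \<Rightarrow> bool"
  assumes mono: "\<And>m m' s. P m s \<Longrightarrow> m \<le> m' \<Longrightarrow> P m' s"
    and loc: "\<And>u. u \<in> {0..T} \<Longrightarrow> \<exists>d>0. \<exists>m. \<forall>s\<in>{0..T}. \<bar>s - u\<bar> < d \<longrightarrow> P m s"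
  shows "\<exists>m. \<forall>s\<in>{0..T}. P m s"
proof -
  from loc obtain d m where dm: "\<And>u. u \<in> {0..T} \<Longrightarrow> d u > 0 \<and> (\<forall>s\<in>{0..T}. \<bar>s - u\<bar> < d u \<longrightarrow> P (m u) s)"
    by metis
  obtain C where C: "C \<subseteq> {0..T}" "finite C" "{0..T} \<subseteq> (\<Union>u\<in>C. ball u (d u))"
    by (rule compactE_image[OF compact_Icc, of "{0..T}" "\<lambda>u. ball u (d u)" 0 T]) (use dm in auto)
  have "P (Max (m ` C)) s" if s: "s \<in> {0..T}" for s
  proof -
    from C s obtain u where "u \<in> C" "s \<in> ball u (d u)" by auto
    then have "u \<in> {0..T}" "\<bar>s - u\<bar> < d u" "m u \<le> Max (m ` C)"
      using C(1,2) by (auto simp: dist_real_def abs_minus_commute)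
    then show ?thesis using dm s mono by blast
  qed
  then show ?thesis by blast
qed

lemma cadlag_bounded:
  fixes x :: "real \<Rightarrow> 'a::real_normed_vector"
  assumes x: "x \<in> cadlag T A"
  obtains B where "\<And>s. s \<in> {0..T} \<Longrightarrow> norm (x s) \<le> B" "\<And>s. s \<in> {0..T} \<Longrightarrow> norm (jump x s) \<le> B"
proof -
  have "\<exists>m. \<forall>s\<in>{0..T}. norm (x s) \<le> real m"
  proof (rule compact_local_to_global)
    fix u assume u: "u \<in> {0..T}"
    from cadlag_local_limits[OF x u zero_less_one] obtain d where d: "d > 0"
      "\<And>s. 0 \<le> s \<Longrightarrow> s \<le> T \<Longrightarrow> u - d < s \<Longrightarrow> s < u \<Longrightarrow> norm (x s - left_lim x u) < 1"
      "\<And>s. 0 \<le> s \<Longrightarrow> s \<le> T \<Longrightarrow> u \<le> s \<Longrightarrow> s < u + d \<Longrightarrow> norm (x s - x u) < 1" by metis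
    obtain m where m: "1 + norm (left_lim x u) + norm (x u) \<le> real m" using real_arch_simple by blast
    have "norm (x s) \<le> real m" if "s \<in> {0..T}" "\<bar>s - u\<bar> < d" for s
    proof (cases "s < u")
      case True
      then have "norm (x s - left_lim x u) < 1" using d(2)[of s] that by auto
      then show ?thesis using norm_triangle_sub[of "x s" "left_lim x u"] m norm_ge_zero[of "x u"] by linarith
    next
      case False
      then have "norm (x s - x u) < 1" using d(3)[of s] that by auto
      then show ?thesis using norm_triangle_sub[of "x s" "x u"] m norm_ge_zero[of "left_lim x u"] by linarith
    qed
    then show "\<exists>d>0. \<exists>m. \<forall>s\<in>{0..T}. \<bar>s - u\<bar> < d \<longrightarrow> norm (x s) \<le> real m"
      using d(1) by blast
  qed (auto intro: order_trans)
  then obtain m where m: "\<And>s. s \<in> {0..T} \<Longrightarrow> norm (x s) \<le> real m" by blast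
  have j: "norm (jump x s) \<le> 2 * real m" if s: "s \<in> {0..T}" for s
  proof (cases "s = 0")
    case False
    have "eventually (\<lambda>u. norm (x u) \<le> real m) (at_left s)"
      using s False m by (auto simp: eventually_at_left_field intro!: exI[of _ 0])
    then have "norm (left_lim x s) \<le> real m"
      using cadlag_left_tendsto[OF x, of s] s False
      by (intro tendsto_upperbound[OF tendsto_norm]) auto
    then show ?thesis using m[OF s] norm_triangle_ineq4[of "x s" "left_lim x s"] by (simp add: jump_def)
  qed simp
  show ?thesis
  proof (rule that[of "2 * real m"])
    fix s assume "s \<in> {0..T}"
    then show "norm (x s) \<le> 2 * real m" using m[of s] norm_ge_zero[of "x s"] by linarith
  qed (rule j)
qed

text \<open>A cadlag path accumulates at its left limits as well as at its values; both lie in the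
  open set \<open>U\<close>, so near each time one radius works. The uniform \<rho> later keeps
  small vertical moves inside \<open>U\<close>.\<close>

lemma cadlag_cball_subset:
  fixes x :: "real \<Rightarrow> 'a::real_normed_vector"
  assumes x: "x \<in> cadlag T U" and U: "open U"
  obtains \<rho> where "\<rho> > 0" "\<And>s. s \<in> {0..T} \<Longrightarrow> cball (x s) \<rho> \<subseteq> U"
proof -
  have "\<exists>m. \<forall>s\<in>{0..T}. cball (x s) (1 / real (Suc m)) \<subseteq> U"
  proof (rule compact_local_to_global)
    fix m m' :: nat and s assume a: "cball (x s) (1 / real (Suc m)) \<subseteq> U" "m \<le> m'"
    have "1 / real (Suc m') \<le> 1 / real (Suc m)" using a(2) by (simp add: frac_le)
    then show "cball (x s) (1 / real (Suc m')) \<subseteq> U" using a(1) by (meson order_trans subset_cball)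
  next
    fix u assume u: "u \<in> {0..T}"
    obtain e1 where e1: "e1 > 0" "ball (left_lim x u) e1 \<subseteq> U"
      using U cadlag_left_lim_in[OF x u] openE by blast
    obtain e2 where e2: "e2 > 0" "ball (x u) e2 \<subseteq> U"
      using U cadlag_value[OF x u] openE by blast
    \<comment> \<open>Half the radius: a point within \<open>e\<close> of \<open>x s\<close>, which
      is itself within \<open>e\<close> of the limit, is within \<open>e + e\<close> of the
      limit.\<close>
    define e where "e = min e1 e2 / 2"
    have e: "e > 0" using e1 e2 by (simp add: e_def)
    from cadlag_local_limits[OF x u e] obtain d where d: "d > 0"
      "\<And>s. 0 \<le> s \<Longrightarrow> s \<le> T \<Longrightarrow> u - d < s \<Longrightarrow> s < u \<Longrightarrow> norm (x s - left_lim x u) < e"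
      "\<And>s. 0 \<le> s \<Longrightarrow> s \<le> T \<Longrightarrow> u \<le> s \<Longrightarrow> s < u + d \<Longrightarrow> norm (x s - x u) < e" by metis
    obtain m where m: "1 / real (Suc m) < e" using nat_approx_posE[OF e] by (metis of_nat_Suc)
    have near: "dist a z < e + e" if "dist b a < e" "dist b z < e" for a b z :: 'a
      using dist_triangle3[of a z b] that by linarith
    have "cball (x s) (1 / real (Suc m)) \<subseteq> U" if s: "s \<in> {0..T}" "\<bar>s - u\<bar> < d" for s
    proof (cases "s < u")
      case True
      then have "dist (x s) (left_lim x u) < e" using d(2)[of s] s by (auto simp: dist_norm)
      then have "cball (x s) (1 / real (Suc m)) \<subseteq> ball (left_lim x u) e1"
        using m near[of "x s"] unfolding e_def by force
      then show ?thesis using e1 by blast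
    next
      case False
      then have "dist (x s) (x u) < e" using d(3)[of s] s by (auto simp: dist_norm)
      then have "cball (x s) (1 / real (Suc m)) \<subseteq> ball (x u) e2"
        using m near[of "x s"] unfolding e_def by force
      then show ?thesis using e2 by blast
    qed
    then show "\<exists>d>0. \<exists>m. \<forall>s\<in>{0..T}. \<bar>s - u\<bar> < d \<longrightarrow> cball (x s) (1 / real (Suc m)) \<subseteq> U"
      using d(1) by blast
  qed
  then obtain m where "\<And>s. s \<in> {0..T} \<Longrightarrow> cball (x s) (1 / real (Suc m)) \<subseteq> U" by blast
  then show ?thesis by (intro that[of "1 / real (Suc m)"]) auto
qed

text \<open>The gaps to the left of different points of \<open>B\<close> yield different rationals,
  because the smaller of two points cannot lie in the gap of the larger.\<close>

lemma countable_if_left_isolated: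
  fixes B :: "real set"
  assumes "\<And>u. u \<in> B \<Longrightarrow> \<exists>d>0. {u - d<..<u} \<inter> B = {}"
  shows "countable B"
proof -
  from assms obtain d where d: "\<And>u. u \<in> B \<Longrightarrow> d u > 0 \<and> {u - d u<..<u} \<inter> B = {}" by metis
  have "\<exists>q. q \<in> \<rat> \<and> u - d u < q \<and> q < u" if "u \<in> B" for u
    using Rats_dense_in_real[of "u - d u" u] d[OF that] by auto
  then obtain q where q: "\<And>u. u \<in> B \<Longrightarrow> q u \<in> \<rat> \<and> u - d u < q u \<and> q u < u" by metis
  have *: "False" if "u \<in> B" "w \<in> B" "q u = q w" "u < w" for u w
  proof -
    have "u \<in> {w - d w<..<w}" using q[OF that(1)] q[OF that(2)] that by auto
    then show False using d[OF that(2)] that(1) by blast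
  qed
  then have "inj_on q B" by (metis inj_onI linorder_neqE *)
  moreover have "q ` B \<subseteq> \<rat>" using q by auto
  ultimately show ?thesis
    using countable_rat by (meson countable_image_inj_on countable_subset)
qed

text \<open>Just before \<open>u\<close> all values, and hence all left limits, are close to the
  left limit at \<open>u\<close>; so jumps above a fixed size are isolated from the left.\<close>

lemma countable_jumps:
  fixes x :: "real \<Rightarrow> 'a::real_normed_vector"
  assumes x: "x \<in> cadlag T A"
  shows "countable {u \<in> {0..T}. jump x u \<noteq> 0}"
proof -
  define B where "B m = {u \<in> {0..T}. norm (jump x u) > 1 / real (Suc m)}" for m
  have "countable (B m)" for m
  proof (rule countable_if_left_isolated)
    fix u assume u: "u \<in> B m"
    define e where "e = 1 / (2 * real (Suc m))"
    have e: "e > 0" by (simp add: e_def)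
    from u have uT: "u \<in> {0..T}" by (auto simp: B_def)
    from cadlag_local_limits[OF x uT e] obtain d where d: "d > 0"
      "\<And>s. 0 \<le> s \<Longrightarrow> s \<le> T \<Longrightarrow> u - d < s \<Longrightarrow> s < u \<Longrightarrow> norm (x s - left_lim x u) < e"
      by metis
    have "w \<notin> B m" if w: "u - d < w" "w < u" for w
    proof
      assume wB: "w \<in> B m"
      then have wT: "0 \<le> w" "w \<le> T" by (auto simp: B_def)
      have "w \<noteq> 0" using wB by (auto simp: B_def)
      have 1: "norm (x w - left_lim x u) < e" using d(2)[of w] w wT by auto
      have "eventually (\<lambda>s. norm (x s - left_lim x u) \<le> e) (at_left w)"
        unfolding eventually_at_left_field
        using d(2) w wT \<open>w \<noteq> 0\<close> by (intro exI[of _ "max 0 (u - d)"]) (auto simp: less_imp_le)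
      moreover have "((\<lambda>s. norm (x s - left_lim x u)) \<longlongrightarrow> norm (left_lim x w - left_lim x u)) (at_left w)"
        using wT \<open>w \<noteq> 0\<close> by (intro tendsto_intros cadlag_left_tendsto[OF x]) auto
      ultimately have 2: "norm (left_lim x w - left_lim x u) \<le> e"
        by (intro tendsto_upperbound) auto
      have "norm (jump x w) \<le> e + e"
        using 1 2 norm_triangle_ineq4[of "x w - left_lim x u" "left_lim x w - left_lim x u"]
        by (simp add: jump_def)
      then show False using wB by (simp add: B_def e_def field_simps)
    qed
    then show "\<exists>d>0. {u - d<..<u} \<inter> B m = {}" using d(1) by (auto intro!: exI[of _ d])
  qed
  moreover have "{u \<in> {0..T}. jump x u \<noteq> 0} \<subseteq> (\<Union>m. B m)"
  proof
    fix u assume u: "u \<in> {u \<in> {0..T}. jump x u \<noteq> 0}"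
    then have "0 < norm (jump x u)" by simp
    from nat_approx_posE[OF this] obtain m where "1 / real (Suc m) < norm (jump x u)" by (metis of_nat_Suc)
    with u show "u \<in> (\<Union>m. B m)" by (auto simp: B_def)
  qed
  ultimately show ?thesis by (meson countable_UN countable_subset countableI_type)
qed

section \<open>Subdivisions and approximating paths\<close>

locale partition_sequence =
  fixes T :: real and p :: "nat \<Rightarrow> nat \<Rightarrow> real" and k :: "nat \<Rightarrow> nat"
  assumes T_pos: "T > 0" and subdivisions: "subdivisions T p k"
begin

text \<open>Subdivision points may be repeated; the repeated ones contribute nothing to any sum.\<close>

definition steps :: "nat \<Rightarrow> nat set" where
  "steps n = {i. i < k n \<and> p n i < p n (Suc i)}"

lemma finite_steps [simp]: "finite (steps n)"
  by (simp add: steps_def)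

lemma p_0 [simp]: "p n 0 = 0" and p_k [simp]: "p n (k n) = T"
  using subdivisions by (auto simp: subdivisions_def)

lemma p_mono: "i \<le> j \<Longrightarrow> j \<le> k n \<Longrightarrow> p n i \<le> p n j"
proof (induction j rule: dec_induct)
  case (step m)
  then have "p n i \<le> p n m" "p n m \<le> p n (Suc m)"
    using subdivisions by (auto simp: subdivisions_def)
  then show ?case by simp
qed simp

lemma p_in: "i \<le> k n \<Longrightarrow> p n i \<in> {0..T}"
  using p_mono[of 0 i n] p_mono[of i "k n" n] by auto

lemma stepsD:
  assumes "i \<in> steps n"
  shows "i < k n" "0 \<le> p n i" "p n i < p n (Suc i)" "p n (Suc i) \<le> T" "0 < p n (Suc i)" "p n i < T"
  using assms p_in[of i n] p_in[of "Suc i" n] by (auto simp: steps_def)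

lemma mesh_small:
  assumes "e > 0"
  shows "\<forall>\<^sub>F n in sequentially. \<forall>i\<in>steps n. p n (Suc i) - p n i < e"
proof -
  have "(\<lambda>n. MAX i\<in>{..<k n}. p n (Suc i) - p n i) \<longlonglongrightarrow> 0"
    using subdivisions by (simp add: subdivisions_def)
  then have "\<forall>\<^sub>F n in sequentially. (MAX i\<in>{..<k n}. p n (Suc i) - p n i) < e"
    using assms by (rule order_tendstoD)
  then show ?thesis
  proof eventually_elim
    case (elim n)
    show ?case
    proof
      fix i assume "i \<in> steps n"
      then have "p n (Suc i) - p n i \<le> (MAX i\<in>{..<k n}. p n (Suc i) - p n i)"
        by (intro Max_ge) (auto simp: steps_def)
      with elim show "p n (Suc i) - p n i < e" by simp
    qed
  qed
qed

lemma step_at: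
  assumes "0 \<le> t" "t < T"
  obtains i where "i \<in> steps n" "p n i \<le> t" "t < p n (Suc i)"
proof -
  \<comment> \<open>With repeated subdivision points the last index is taken, so the step found has
    positive length.\<close>
  define i where "i = (GREATEST i. i \<le> k n \<and> p n i \<le> t)"
  have i: "i \<le> k n \<and> p n i \<le> t"
    unfolding i_def by (rule GreatestI_nat[of _ 0 "k n"]) (use assms in auto)
  then have "i \<noteq> k n" using assms by auto
  with i have "i < k n" by simp
  have "t < p n (Suc i)"
  proof (rule ccontr)
    assume "\<not> t < p n (Suc i)"
    then have "Suc i \<le> i"
      unfolding i_def using \<open>i < k n\<close> by (intro Greatest_le_nat[of _ _ "k n"]) (auto simp: i_def)
    then show False by simp
  qed
  with i \<open>i < k n\<close> show ?thesis by (intro that[of i]) (auto simp: steps_def)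
qed

lemma step_before:
  assumes "0 < t" "t \<le> T"
  obtains i where "i \<in> steps n" "p n i < t" "t \<le> p n (Suc i)"
proof -
  define i where "i = (GREATEST i. i \<le> k n \<and> p n i < t)"
  have i: "i \<le> k n \<and> p n i < t"
    unfolding i_def by (rule GreatestI_nat[of _ 0 "k n"]) (use assms in auto)
  then have "i \<noteq> k n" using assms by auto
  with i have "i < k n" by simp
  have "t \<le> p n (Suc i)"
  proof (rule ccontr)
    assume "\<not> t \<le> p n (Suc i)"
    then have "Suc i \<le> i"
      unfolding i_def using \<open>i < k n\<close> by (intro Greatest_le_nat[of _ _ "k n"]) (auto simp: i_def)
    then show False by simp
  qed
  with i \<open>i < k n\<close> show ?thesis by (intro that[of i]) (auto simp: steps_def)
qed

lemma steps_nonempty: "steps n \<noteq> {}"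
  using step_at[of 0 n] T_pos by auto

lemma step_unique:
  assumes "i < k n" "j < k n" "p n i \<le> t" "t < p n (Suc i)" "p n j \<le> t" "t < p n (Suc j)"
  shows "i = j"
proof (rule ccontr)
  assume "i \<noteq> j"
  then consider "Suc i \<le> j" | "Suc j \<le> i" by linarith
  then show False
    using p_mono[of "Suc i" j n] p_mono[of "Suc j" i n] assms by cases auto
qed

text \<open>Degenerate steps being excluded, two steps with the same right end overlap just before
  it. This makes sums over right ends sums over distinct times.\<close>

lemma inj_on_right_end: "inj_on (\<lambda>i. p n (Suc i)) (steps n)"
proof (rule inj_onI)
  fix i j assume ij: "i \<in> steps n" "j \<in> steps n" "p n (Suc i) = p n (Suc j)"
  have "max (p n i) (p n j) < p n (Suc i)" using ij by (auto simp: steps_def)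
  then show "i = j"
    by (intro step_unique[of i n j "max (p n i) (p n j)"]) (use ij in \<open>auto simp: steps_def\<close>)
qed

lemma interior_not_point:
  assumes "i < k n" "p n i < t" "t < p n (Suc i)"
  shows "t \<notin> p n ` {..k n}"
proof
  assume "t \<in> p n ` {..k n}"
  then obtain j where j: "j \<le> k n" "t = p n j" by auto
  show False
  proof (cases "j \<le> i")
    case True
    then show False using p_mono[of j i n] assms j by auto
  next
    case False
    then show False using p_mono[of "Suc i" j n] assms j by auto
  qed
qed

lemma point_is_right_end:
  assumes "t \<in> p n ` {..k n}" "0 < t"
  obtains i where "i \<in> steps n" "p n (Suc i) = t"
proof -
  from assms(1) have "t \<le> T" using p_in by auto
  from step_before[OF assms(2) this] obtain i where i: "i \<in> steps n" "p n i < t" "t \<le> p n (Suc i)" .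
  have "\<not> t < p n (Suc i)" using interior_not_point[of i n t] i assms(1) unfolding steps_def by blast
  with i show ?thesis by (intro that[of i]) auto
qed

lemma step_sum:
  fixes a :: "nat \<Rightarrow> 'a::real_vector"
  assumes "i \<in> steps n" "p n i \<le> t" "t < p n (Suc i)"
  shows "(\<Sum>j<k n. indicator {p n j..<p n (Suc j)} t *\<^sub>R a j) = a i"
proof -
  have "(\<Sum>j<k n. indicator {p n j..<p n (Suc j)} t *\<^sub>R a j) = (\<Sum>j<k n. if j = i then a i else 0)"
    using assms by (intro sum.cong) (auto simp: indicator_def steps_def dest: step_unique[of _ n i t])
  also have "\<dots> = a i" using assms by (simp add: steps_def)
  finally show ?thesis .
qed

lemma sum_steps: "(\<And>i. i < k n \<Longrightarrow> p n i = p n (Suc i) \<Longrightarrow> f i = 0) \<Longrightarrow> (\<Sum>i<k n. f i) = (\<Sum>i\<in>steps n. f i)"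
proof (rule sum.mono_neutral_right)
  assume *: "\<And>i. i < k n \<Longrightarrow> p n i = p n (Suc i) \<Longrightarrow> f i = 0"
  have "p n i \<le> p n (Suc i)" if "i < k n" for i
    using that by (intro p_mono) auto
  then show "\<forall>i\<in>{..<k n} - steps n. f i = 0"
    by (auto simp: steps_def not_less intro!: * order_antisym)
qed (auto simp: steps_def)

lemma sum_step_lengths: "(\<Sum>i\<in>steps n. p n (Suc i) - p n i) = T"
proof -
  have "(\<Sum>i\<in>steps n. p n (Suc i) - p n i) = (\<Sum>i<k n. p n (Suc i) - p n i)"
    by (rule sum_steps[symmetric]) simp
  also have "\<dots> = T" by (simp add: sum_lessThan_telescope)
  finally show ?thesis .
qed

lemma step_function_cadlag:
  fixes y :: "real \<Rightarrow> 'a::t2_space"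
  assumes ext: "y \<in> extensional {0..T}" and end_in: "y T \<in> A" and in_A: "\<And>i. i \<in> steps n \<Longrightarrow> a i \<in> A"
    and eq: "\<And>i t. i \<in> steps n \<Longrightarrow> p n i \<le> t \<Longrightarrow> t < p n (Suc i) \<Longrightarrow> y t = a i"
  shows "y \<in> cadlag T A"
  unfolding cadlag_def
proof (intro CollectI conjI ballI)
  show "y \<in> {0..T} \<rightarrow>\<^sub>E A"
  proof (rule PiE_I)
    fix t assume t: "t \<in> {0..T}"
    show "y t \<in> A"
    proof (cases "t = T")
      case False
      with t obtain i where i: "i \<in> steps n" "p n i \<le> t" "t < p n (Suc i)"
        using step_at[of t n] by auto
      then show ?thesis using eq[OF i] in_A by simp
    qed (use end_in in simp)
  qed (use ext in \<open>auto simp: extensional_def\<close>)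
next
  fix s assume s: "s \<in> {0..<T}"
  then obtain i where i: "i \<in> steps n" "p n i \<le> s" "s < p n (Suc i)"
    using step_at[of s n] by auto
  have "eventually (\<lambda>t. y t = a i) (at_right s)"
    using i eq by (auto simp: eventually_at_right_field intro!: exI[of _ "p n (Suc i)"])
  then have "(y \<longlongrightarrow> a i) (at_right s)" by (rule tendsto_eventually)
  then show "continuous (at_right s) y" using eq[OF i] by (simp add: continuous_within)
next
  fix s assume s: "s \<in> {0<..T}"
  then obtain i where i: "i \<in> steps n" "p n i < s" "s \<le> p n (Suc i)"
    using step_before[of s n] by auto
  have "eventually (\<lambda>t. y t = a i) (at_left s)"
    using i eq by (auto simp: eventually_at_left_field intro!: exI[of _ "p n i"])
  then have "(y \<longlongrightarrow> a i) (at_left s)" by (rule tendsto_eventually)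
  then show "\<exists>l\<in>A. (y \<longlongrightarrow> l) (at_left s)" using in_A i by auto
qed

end

section \<open>Uniform approximation by the step paths\<close>

locale approximated_paths = partition_sequence +
  fixes U :: "'a::real_normed_vector set" and S :: "'b::real_normed_vector set" and x v
  assumes x_cadlag: "x \<in> cadlag T U" and v_cadlag: "v \<in> cadlag T S"
    and jumps_captured:
      "(\<lambda>n. SUP t\<in>{0..T} - p n ` {..k n}. norm (jump x t) + norm (jump v t)) \<longlonglongrightarrow> 0"
begin

abbreviation xn :: "nat \<Rightarrow> real \<Rightarrow> 'a" where "xn \<equiv> approx_left T p k x"
abbreviation vn :: "nat \<Rightarrow> real \<Rightarrow> 'b" where "vn \<equiv> approx_right T p k v"

lemma xn_eq:
  assumes "i \<in> steps n" "p n i \<le> t" "t < p n (Suc i)"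
  shows "xn n t = left_lim x (p n (Suc i))"
  using assms stepsD[OF assms(1)] step_sum[OF assms, of "\<lambda>i. left_lim x (p n (Suc i))"]
  by (auto simp: approx_left_def)

lemma vn_eq:
  assumes "i \<in> steps n" "p n i \<le> t" "t < p n (Suc i)"
  shows "vn n t = v (p n i)"
  using assms stepsD[OF assms(1)] step_sum[OF assms, of "\<lambda>i. v (p n i)"]
  by (auto simp: approx_right_def)


lemma xn_T: "xn n T = x T" and vn_T: "vn n T = v T"
proof -
  have "\<not> T < p n (Suc i)" if "i < k n" for i
    using p_in[of "Suc i" n] that by auto
  then have *: "{i. i < k n \<and> p n i \<le> T \<and> T < p n (Suc i)} = {}" by blast
  show "xn n T = x T" "vn n T = v T"
    using T_pos by (simp_all add: approx_left_def approx_right_def *)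
qed



lemma xn_cadlag: "xn n \<in> cadlag T U"
proof (rule step_function_cadlag[where n = n])
  show "xn n \<in> extensional {0..T}" by (auto simp: approx_left_def)
  show "xn n T \<in> U" using cadlag_value[OF x_cadlag, of T] T_pos by (simp add: xn_T)
  fix i assume "i \<in> steps n"
  then show "left_lim x (p n (Suc i)) \<in> U"
    using stepsD[of i n] by (intro cadlag_left_lim_in[OF x_cadlag]) auto
qed (rule xn_eq)

lemma vn_cadlag: "vn n \<in> cadlag T S"
proof (rule step_function_cadlag[where n = n])
  show "vn n \<in> extensional {0..T}" by (auto simp: approx_right_def)
  show "vn n T \<in> S" using cadlag_value[OF v_cadlag, of T] T_pos by (simp add: vn_T)
  fix i assume "i \<in> steps n"
  then show "v (p n i) \<in> S"
    using stepsD[of i n] by (intro cadlag_value[OF v_cadlag]) auto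
qed (rule vn_eq)

lemma vn_point: assumes "i \<in> steps n" shows "vn n (p n i) = v (p n i)"
  using stepsD[OF assms] by (intro vn_eq[OF assms]) auto

lemma vn_0: "vn n 0 = v 0"
proof -
  obtain i where i: "i \<in> steps n" "p n i \<le> 0" "0 < p n (Suc i)" using step_at[of 0 n] T_pos by auto
  have "p n i = 0" using i stepsD[OF i(1)] by simp
  then show ?thesis using vn_point[OF i(1)] by simp
qed

lemma left_lim_xn:
  assumes "i \<in> steps n"
  shows "left_lim (xn n) (p n (Suc i)) = left_lim x (p n (Suc i))"
proof -
  have "eventually (\<lambda>t. xn n t = left_lim x (p n (Suc i))) (at_left (p n (Suc i)))"
    using stepsD[OF assms] xn_eq[OF assms]
    by (auto simp: eventually_at_left_field intro!: exI[of _ "p n i"])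
  then have "(xn n \<longlongrightarrow> left_lim x (p n (Suc i))) (at_left (p n (Suc i)))" by (rule tendsto_eventually)
  then show ?thesis by (rule left_lim_eqI) (rule stepsD[OF assms])
qed

lemma off_point_jumps_small:
  assumes "e > 0"
  shows "\<forall>\<^sub>F n in sequentially. \<forall>t\<in>{0..T} - p n ` {..k n}. norm (jump x t) < e \<and> norm (jump v t) < e"
proof -
  from cadlag_bounded[OF x_cadlag] obtain B1 where B1: "\<And>s. s \<in> {0..T} \<Longrightarrow> norm (jump x s) \<le> B1" by metis
  from cadlag_bounded[OF v_cadlag] obtain B2 where B2: "\<And>s. s \<in> {0..T} \<Longrightarrow> norm (jump v s) \<le> B2" by metis
  \<comment> \<open>A real supremum is informative only for sets bounded above; the bound comes from
    the bounded jumps of cadlag paths.\<close>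
  have bdd: "bdd_above ((\<lambda>t. norm (jump x t) + norm (jump v t)) ` ({0..T} - p n ` {..k n}))" for n
    by (rule bdd_aboveI2[of _ _ "B1 + B2"]) (use B1 B2 in \<open>auto intro: add_mono\<close>)
  from order_tendstoD(2)[OF jumps_captured assms] show ?thesis
  proof eventually_elim
    case (elim n)
    show ?case
    proof
      fix t assume "t \<in> {0..T} - p n ` {..k n}"
      from cSUP_upper[OF this bdd] elim have "norm (jump x t) + norm (jump v t) < e" by simp
      then show "norm (jump x t) < e \<and> norm (jump v t) < e"
        using norm_ge_zero[of "jump x t"] norm_ge_zero[of "jump v t"] by linarith
    qed
  qed
qed

text \<open>The jump at \<open>u\<close> is fixed while the jumps missed by the subdivision tend to
  zero. At time 0 there is no jump, so \<open>u\<close> is the right end of a step.\<close>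

lemma jump_time_is_point:
  assumes "u \<in> {0..T}" "jump x u \<noteq> 0 \<or> jump v u \<noteq> 0"
  shows "\<forall>\<^sub>F n in sequentially. \<exists>i\<in>steps n. p n (Suc i) = u"
proof -
  have u: "0 < u" using assms by (cases "u = 0") auto
  define e where "e = max (norm (jump x u)) (norm (jump v u))"
  have "e > 0" using assms(2) by (auto simp: e_def max_def)
  from off_point_jumps_small[OF this] show ?thesis
  proof eventually_elim
    case (elim n)
    have "u \<in> p n ` {..k n}"
    proof (rule ccontr)
      assume "u \<notin> p n ` {..k n}"
      then have "norm (jump x u) < e \<and> norm (jump v u) < e" using elim assms(1) by auto
      then show False by (auto simp: e_def)
    qed
    from point_is_right_end[OF this u] show ?case by metis
  qed
qed

text \<open>Inside a step every jump is below e/2, so by \<open>cadlag_oscillation\<close> the paths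
  vary by at most \<open>e\<close> there. The jump at the right end does no harm: the step value of
  \<open>x\<close> is the left limit there, reached by letting \<open>s\<close> increase to it, and
  that of \<open>v\<close> is the value at the left end.\<close>

lemma uniform_approximation:
  assumes e: "e > 0"
  shows "\<forall>\<^sub>F n in sequentially. \<forall>t\<in>{0..T}. norm (xn n t - x t) \<le> e \<and> norm (vn n t - v t) \<le> e"
proof -
  have e2: "e / 2 > 0" using e by simp
  from cadlag_oscillation[OF x_cadlag e2] obtain d1 where d1: "d1 > 0"
    "\<And>s t. 0 \<le> s \<Longrightarrow> s < t \<Longrightarrow> t \<le> T \<Longrightarrow> t - s < d1 \<Longrightarrow>
       \<exists>u. s < u \<and> u \<le> t \<and> norm (x t - x s) \<le> e / 2 + norm (jump x u)" by metis
  from cadlag_oscillation[OF v_cadlag e2] obtain d2 where d2: "d2 > 0"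
    "\<And>s t. 0 \<le> s \<Longrightarrow> s < t \<Longrightarrow> t \<le> T \<Longrightarrow> t - s < d2 \<Longrightarrow>
       \<exists>u. s < u \<and> u \<le> t \<and> norm (v t - v s) \<le> e / 2 + norm (jump v u)" by metis
  have "min d1 d2 > 0" using d1 d2 by simp
  from mesh_small[OF this] off_point_jumps_small[OF e2] show ?thesis
  proof eventually_elim
    case (elim n)
    show ?case
    proof
      fix t assume t: "t \<in> {0..T}"
      show "norm (xn n t - x t) \<le> e \<and> norm (vn n t - v t) \<le> e"
      proof (cases "t = T")
        case True
        then show ?thesis using e by (simp add: xn_T vn_T)
      next
        case False
        with t obtain i where i: "i \<in> steps n" "p n i \<le> t" "t < p n (Suc i)"
          using step_at[of t n] by auto
        note iD = stepsD[OF i(1)]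
        have mesh: "p n (Suc i) - p n i < min d1 d2" using elim(1) i by auto
        have off: "norm (jump x u) < e / 2 \<and> norm (jump v u) < e / 2" if "p n i < u" "u < p n (Suc i)" for u
          using interior_not_point[OF iD(1) that] elim(2) that iD by auto
        have "norm (x s - x t) \<le> e" if s: "t < s" "s < p n (Suc i)" for s
        proof -
          obtain u where "t < u" "u \<le> s" "norm (x s - x t) \<le> e / 2 + norm (jump x u)"
            using d1(2)[of t s] s i t iD mesh by auto
          then show ?thesis using off[of u] s i by auto
        qed
        then have ev: "eventually (\<lambda>s. norm (x s - x t) \<le> e) (at_left (p n (Suc i)))"
          using i by (auto simp: eventually_at_left_field intro!: exI[of _ t])
        have "((\<lambda>s. norm (x s - x t)) \<longlongrightarrow> norm (left_lim x (p n (Suc i)) - x t)) (at_left (p n (Suc i)))"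
          using iD by (intro tendsto_intros cadlag_left_tendsto[OF x_cadlag]) auto
        from tendsto_upperbound[OF this ev] have 1: "norm (left_lim x (p n (Suc i)) - x t) \<le> e" by simp
        have 2: "norm (v (p n i) - v t) \<le> e"
        proof (cases "p n i = t")
          case False
          then obtain u where "p n i < u" "u \<le> t" "norm (v t - v (p n i)) \<le> e / 2 + norm (jump v u)"
            using d2(2)[of "p n i" t] i t iD mesh by auto
          then show ?thesis using off[of u] i by (auto simp: norm_minus_commute)
        qed (use e in simp)
        show ?thesis using 1 2 xn_eq[OF i] vn_eq[OF i] by simp
      qed
    qed
  qed
qed

lemma left_gap_small:
  assumes "e > 0"
  shows "\<forall>\<^sub>F n in sequentially. \<forall>i\<in>steps n. norm (left_lim x (p n (Suc i)) - x (p n i)) \<le> e"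
  using uniform_approximation[OF assms]
proof eventually_elim
  case (elim n)
  show ?case
  proof
    fix i assume i: "i \<in> steps n"
    then show "norm (left_lim x (p n (Suc i)) - x (p n i)) \<le> e"
      using elim[rule_format, of "p n i"] xn_eq[OF i, of "p n i"] stepsD[OF i] by auto
  qed
qed

lemma uniform_left_limits:
  assumes "\<forall>t\<in>{0..T}. norm (xn n t - x t) \<le> e" "t \<in> {0..T}"
  shows "norm (left_lim (xn n) t - left_lim x t) \<le> e"
proof (cases "t = 0")
  case False
  then have "((\<lambda>s. norm (xn n s - x s)) \<longlongrightarrow> norm (left_lim (xn n) t - left_lim x t)) (at_left t)"
    using assms by (intro tendsto_intros cadlag_left_tendsto[OF x_cadlag] cadlag_left_tendsto[OF xn_cadlag]) auto
  moreover have "eventually (\<lambda>s. norm (xn n s - x s) \<le> e) (at_left t)"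
    using assms False by (auto simp: eventually_at_left_field intro!: exI[of _ 0])
  ultimately show ?thesis by (rule tendsto_upperbound) simp
qed (use assms in auto)

end

section \<open>Calculus of functionals\<close>

text \<open>The norm of a matrix is here its Frobenius norm, so Cauchy-Schwarz in each row
  suffices.\<close>

lemma norm_matrix_vector_mult_le: "norm (A *v a) \<le> norm A * norm a" for A :: "real ^ 'n ^ 'm"
proof -
  have "norm (A *v a) = L2_set (\<lambda>i. norm ((A *v a) $ i)) UNIV" by (simp add: norm_vec_def)
  also have "\<dots> \<le> L2_set (\<lambda>i. norm (A $ i) * norm a) UNIV"
  proof (rule L2_set_mono)
    fix i
    have "(A *v a) $ i = A $ i \<bullet> a" by (simp add: matrix_vector_mult_def inner_vec_def)
    then show "norm ((A *v a) $ i) \<le> norm (A $ i) * norm a" by (simp add: Cauchy_Schwarz_ineq2)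
  qed simp
  also have "\<dots> = norm A * norm a" by (simp add: L2_set_left_distrib[symmetric] norm_vec_def)
  finally show ?thesis .
qed

lemma abs_bilinear_le: "\<bar>(A *v a) \<bullet> b\<bar> \<le> norm A * norm a * norm b" for A :: "real ^ 'n ^ 'm"
  by (meson Cauchy_Schwarz_ineq2 mult_right_mono norm_ge_zero norm_matrix_vector_mult_le order_trans)

text \<open>The definite description requires a unique gradient: it is the vector representing the
  derivative \<open>D\<close>, namely \<open>adjoint D 1\<close>.\<close>

lemma vgrad_works:
  assumes "vert_differentiable F t z w"
  shows "((\<lambda>e. F t (vert z t e) w) has_derivative (\<lambda>h. h \<bullet> vgrad F t z w)) (at 0)"
proof -
  let ?f = "\<lambda>e. F t (vert z t e) w"
  from assms obtain D where D: "(?f has_derivative D) (at 0)"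
    by (auto simp: vert_differentiable_def differentiable_def)
  have "D = (\<lambda>h. h \<bullet> adjoint D 1)"
    using adjoint_works[OF has_derivative_linear[OF D]] by (simp add: fun_eq_iff)
  with D have 1: "GDERIV ?f 0 :> adjoint D 1" by (simp add: gderiv_def)
  have "\<exists>!G. GDERIV ?f 0 :> G"
  proof (rule ex1I, rule 1)
    fix G assume "GDERIV ?f 0 :> G"
    then have "(?f has_derivative (\<lambda>h. h \<bullet> G)) (at 0)" by (simp only: gderiv_def)
    then have "(\<lambda>h. h \<bullet> G) = D" using D by (rule has_derivative_unique)
    then have "h \<bullet> G = h \<bullet> adjoint D 1" for h
      using adjoint_works[OF has_derivative_linear[OF D], of h 1] by (simp add: fun_eq_iff)
    then show "G = adjoint D 1" using vector_eq_ldot by blast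
  qed
  from theI'[OF this] show ?thesis by (simp add: vgrad_def gderiv_def)
qed

lemma vhess_works:
  assumes "vert_differentiable (vgrad F) t z w"
  shows "((\<lambda>e. vgrad F t (vert z t e) w) has_derivative (\<lambda>h. vhess F t z w *v h)) (at 0)"
  using assms jacobian_works unfolding vert_differentiable_def vhess_def by blast

text \<open>Vertical derivatives are defined at perturbation zero only. Since perturbations at the
  same time add up, the derivative at the path already perturbed by
  \<open>\<theta> *\<^sub>R a\<close> is the derivative of the segment at parameter
  \<theta>.\<close>

lemma DERIV_along_vert:
  fixes G :: "('d::finite, 'm::finite, 'c::real_normed_vector) functional"
  assumes "((\<lambda>e. G t (vert (vert z t (\<theta> *\<^sub>R a)) t e) w) has_derivative D) (at 0)"
  shows "((\<lambda>\<theta>. G t (vert z t (\<theta> *\<^sub>R a)) w) has_vector_derivative D a) (at \<theta>)"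
proof -
  interpret D: bounded_linear D using assms by (rule has_derivative_bounded_linear)
  have 1: "((\<lambda>s. (s - \<theta>) *\<^sub>R a) has_derivative (\<lambda>h. h *\<^sub>R a)) (at \<theta>)"
    by (auto intro!: derivative_eq_intros)
  have 2: "((\<lambda>e. G t (vert z t (\<theta> *\<^sub>R a + e)) w) has_derivative D) (at ((\<theta> - \<theta>) *\<^sub>R a))"
    using assms by simp
  from has_derivative_compose[OF 1 2] show ?thesis
    by (simp add: has_vector_derivative_def D.scaleR algebra_simps)
qed

lemma vert_DERIV:
  assumes "vert_differentiable F t (vert z t (\<theta> *\<^sub>R a)) w"
  shows "((\<lambda>\<theta>. F t (vert z t (\<theta> *\<^sub>R a)) w) has_real_derivative
    vgrad F t (vert z t (\<theta> *\<^sub>R a)) w \<bullet> a) (at \<theta>)"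
  using DERIV_along_vert[where G = F and z = z, OF vgrad_works[OF assms]]
  by (simp add: has_real_derivative_iff_has_vector_derivative inner_commute)

lemma vert_DERIV2:
  assumes "vert_differentiable (vgrad F) t (vert z t (\<theta> *\<^sub>R a)) w"
  shows "((\<lambda>\<theta>. vgrad F t (vert z t (\<theta> *\<^sub>R a)) w \<bullet> b) has_real_derivative
    (vhess F t (vert z t (\<theta> *\<^sub>R a)) w *v a) \<bullet> b) (at \<theta>)"
proof -
  from DERIV_along_vert[where G = "vgrad F" and z = z, OF vhess_works[OF assms]]
  have "((\<lambda>\<theta>. vgrad F t (vert z t (\<theta> *\<^sub>R a)) w) has_vector_derivative
      vhess F t (vert z t (\<theta> *\<^sub>R a)) w *v a) (at \<theta>)" .
  then show ?thesis
    unfolding has_real_derivative_iff_has_vector_derivative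
    by (rule bounded_linear.has_vector_derivative[OF bounded_linear_inner_left])
qed

text \<open>Remainders are taken at unknown intermediate paths, and \<open>U\<close> is not assumed
  convex; that the whole segment stays \<open>U\<close>-valued is therefore part of the
  setting.\<close>

locale vert_segment =
  fixes I :: "real set" and U :: "(real ^ 'd) set" and S :: "(real ^ 'm) set"
    and F :: "('d, 'm, real) functional" and t :: real and z w a
  assumes diff: "twice_vert_differentiable_on I U S F"
    and t_in: "t \<in> I" and w_in: "w \<in> cadlag t S"
    and segment: "\<And>\<theta>. \<theta> \<in> {0..1} \<Longrightarrow> vert z t (\<theta> *\<^sub>R a) \<in> cadlag t U"
    and base: "z \<in> cadlag t U"
begin

lemma diffs:
  assumes "\<theta> \<in> {0..1}"
  shows "vert_differentiable F t (vert z t (\<theta> *\<^sub>R a)) w"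
    "vert_differentiable (vgrad F) t (vert z t (\<theta> *\<^sub>R a)) w"
  using diff t_in w_in segment[OF assms] unfolding twice_vert_differentiable_on_def by auto

lemma taylor:
  obtains \<theta> where "\<theta> \<in> {0..1}"
    "F t (vert z t a) w = F t z w + vgrad F t z w \<bullet> a + (vhess F t (vert z t (\<theta> *\<^sub>R a)) w *v a) \<bullet> a / 2"
proof -
  \<comment> \<open>The successive derivatives along the segment, in the form that Maclaurin's
    formula of order two expects.\<close>
  define f where "f m \<theta> = (case m of 0 \<Rightarrow> F t (vert z t (\<theta> *\<^sub>R a)) w
    | Suc 0 \<Rightarrow> vgrad F t (vert z t (\<theta> *\<^sub>R a)) w \<bullet> a
    | _ \<Rightarrow> (vhess F t (vert z t (\<theta> *\<^sub>R a)) w *v a) \<bullet> a)" for m :: nat and \<theta>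
  have "\<exists>\<theta>>0. \<theta> < 1 \<and> F t (vert z t (1 *\<^sub>R a)) w = (\<Sum>m<2. f m 0 / fact m * 1 ^ m) + f 2 \<theta> / fact 2 * 1 ^ 2"
  proof (rule Maclaurin)
    show "\<forall>m \<theta>. m < 2 \<and> 0 \<le> \<theta> \<and> \<theta> \<le> 1 \<longrightarrow> (f m has_real_derivative f (Suc m) \<theta>) (at \<theta>)"
    proof (intro allI impI)
      fix m :: nat and \<theta> :: real assume "m < 2 \<and> 0 \<le> \<theta> \<and> \<theta> \<le> 1"
      then have "m = 0 \<or> m = 1" "\<theta> \<in> {0..1}" by auto
      then show "(f m has_real_derivative f (Suc m) \<theta>) (at \<theta>)"
        using vert_DERIV[OF diffs(1)] vert_DERIV2[OF diffs(2)] by (auto simp: f_def[abs_def])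
    qed
  qed (auto simp: f_def)
  then obtain \<theta> where "0 < \<theta>" "\<theta> < 1"
    "F t (vert z t a) w = (\<Sum>m<2. f m 0 / fact m * 1 ^ m) + f 2 \<theta> / fact 2 * 1 ^ 2" by auto
  then show ?thesis
    by (intro that[of \<theta>]) (auto simp: f_def numeral_2_eq_2 vert_0[OF base])
qed

lemma gradient_mvt:
  obtains \<theta> where "\<theta> \<in> {0..1}"
    "(vgrad F t (vert z t a) w - vgrad F t z w) \<bullet> b = (vhess F t (vert z t (\<theta> *\<^sub>R a)) w *v a) \<bullet> b"
proof -
  have "\<exists>\<theta>>0. \<theta> < 1 \<and> vgrad F t (vert z t (1 *\<^sub>R a)) w \<bullet> b - vgrad F t (vert z t (0 *\<^sub>R a)) w \<bullet> b
      = (1 - 0) * ((vhess F t (vert z t (\<theta> *\<^sub>R a)) w *v a) \<bullet> b)"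
    by (rule MVT2) (use vert_DERIV2[OF diffs(2)] in auto)
  then obtain \<theta> where "0 < \<theta>" "\<theta> < 1" "vgrad F t (vert z t (1 *\<^sub>R a)) w \<bullet> b - vgrad F t (vert z t (0 *\<^sub>R a)) w \<bullet> b
      = (1 - 0) * ((vhess F t (vert z t (\<theta> *\<^sub>R a)) w *v a) \<bullet> b)" by blast
  then show ?thesis
    by (intro that[of \<theta>]) (auto simp: vert_0[OF base] inner_diff_left)
qed

end

text \<open>The two functions of \<open>e\<close> agree as long as the endpoint
  \<open>y t + e\<close> stays in \<open>U\<close>. As \<open>U\<close> is open, this holds on an
  open neighbourhood of zero, and a derivative at zero sees nothing else.\<close>

lemma predictable_vert_derivative:
  fixes G :: "('d::finite, 'm::finite, 'c::real_normed_vector) functional"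
  assumes "predictable_second T U S G" "open U" "t \<in> {0..T}" "y \<in> cadlag t U" "w \<in> cadlag t S"
  shows "((\<lambda>e. G t (vert y t e) w) has_derivative D) (at 0) \<longleftrightarrow>
    ((\<lambda>e. G t (vert y t e) (left_path w t)) has_derivative D) (at 0)"
proof -
  let ?E = "(\<lambda>e. y t + e) -` U"
  have E: "open ?E" "0 \<in> ?E"
    using assms(2) cadlag_value[OF assms(4), of t] assms(3)
    by (auto intro!: open_vimage continuous_intros)
  have eq: "G t (vert y t e) w = G t (vert y t e) (left_path w t)" if "e \<in> ?E" for e
    using assms(1,3,5) vert_cadlag[OF assms(4), of e] that unfolding predictable_second_def by auto
  show ?thesis
    using has_derivative_transform_within_open[OF _ E, of "\<lambda>e. G t (vert y t e) w" D UNIV]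
      has_derivative_transform_within_open[OF _ E, of "\<lambda>e. G t (vert y t e) (left_path w t)" D UNIV] eq
    by metis
qed

lemma predictable_vgrad:
  assumes "predictable_second T U S F" "open U"
  shows "predictable_second T U S (vgrad F)"
  unfolding predictable_second_def vgrad_def gderiv_def
  using predictable_vert_derivative[OF assms] by simp

section \<open>Regularity conditions in pointwise form\<close>

lemma dinf_le:
  assumes "0 \<le> t1" "t1 \<le> t"
    and "\<And>u. 0 \<le> u \<Longrightarrow> u \<le> t1 \<Longrightarrow> norm (z u - z' u) \<le> a"
    and "\<And>u. t1 < u \<Longrightarrow> u \<le> t \<Longrightarrow> norm (z u - z' t1) \<le> a"
    and "\<And>u. 0 \<le> u \<Longrightarrow> u \<le> t1 \<Longrightarrow> norm (w u - w' u) \<le> b"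
    and "\<And>u. t1 < u \<Longrightarrow> u \<le> t \<Longrightarrow> norm (w u - w' t1) \<le> b"
  shows "dinf t z w t1 z' w' \<le> a + b + (t - t1)"
proof -
  have "(SUP u\<in>{0..t}. norm (hext z t 0 u - hext z' t1 (t - t1) u)) \<le> a"
    using assms by (intro cSUP_least) (auto simp: hext_def)
  moreover have "(SUP u\<in>{0..t}. norm (hext w t 0 u - hext w' t1 (t - t1) u)) \<le> b"
    using assms by (intro cSUP_least) (auto simp: hext_def)
  ultimately show ?thesis using assms(2) by (simp add: dinf_def Let_def max_def)
qed

lemma left_continuous_functionalD:
  assumes "left_continuous_functional I U S G" "t \<in> I" "0 \<le> t" "z \<in> cadlag t U" "w \<in> cadlag t S" "\<epsilon> > 0"
  obtains \<eta> where "\<eta> > 0"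
    "\<And>t1 z' w'. \<lbrakk>0 \<le> t1; t1 \<le> t; t - t1 \<le> \<eta>; z' \<in> cadlag t1 U; w' \<in> cadlag t1 S;
      \<And>u. 0 \<le> u \<Longrightarrow> u \<le> t1 \<Longrightarrow> norm (z u - z' u) \<le> \<eta>; \<And>u. t1 < u \<Longrightarrow> u \<le> t \<Longrightarrow> norm (z u - z' t1) \<le> \<eta>;
      \<And>u. 0 \<le> u \<Longrightarrow> u \<le> t1 \<Longrightarrow> norm (w u - w' u) \<le> \<eta>; \<And>u. t1 < u \<Longrightarrow> u \<le> t \<Longrightarrow> norm (w u - w' t1) \<le> \<eta>\<rbrakk>
      \<Longrightarrow> norm (G t z w - G t1 z' w') < \<epsilon>"
proof -
  from assms obtain \<eta> where \<eta>: "\<eta> > 0" "\<And>h z' w'. h \<in> {0..t} \<Longrightarrow> z' \<in> cadlag (t - h) U \<Longrightarrow> w' \<in> cadlag (t - h) S \<Longrightarrow>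
      dinf t z w (t - h) z' w' < \<eta> \<Longrightarrow> norm (G t z w - G (t - h) z' w') < \<epsilon>"
    unfolding left_continuous_functional_def by metis
  show ?thesis
  \<comment> \<open>Two suprema and the time lag contribute at most \<eta>/4 each, which leaves the
    sum strictly below \<eta>.\<close>
  proof (rule that[of "\<eta> / 4"])
    fix t1 z' w'
    assume a: "0 \<le> t1" "t1 \<le> t" "t - t1 \<le> \<eta> / 4" "z' \<in> cadlag t1 U" "w' \<in> cadlag t1 S"
      "\<And>u. 0 \<le> u \<Longrightarrow> u \<le> t1 \<Longrightarrow> norm (z u - z' u) \<le> \<eta> / 4" "\<And>u. t1 < u \<Longrightarrow> u \<le> t \<Longrightarrow> norm (z u - z' t1) \<le> \<eta> / 4"
      "\<And>u. 0 \<le> u \<Longrightarrow> u \<le> t1 \<Longrightarrow> norm (w u - w' u) \<le> \<eta> / 4" "\<And>u. t1 < u \<Longrightarrow> u \<le> t \<Longrightarrow> norm (w u - w' t1) \<le> \<eta> / 4"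
    have "dinf t z w t1 z' w' \<le> \<eta> / 4 + \<eta> / 4 + (t - t1)" by (rule dinf_le) (use a in auto)
    then show "norm (G t z w - G t1 z' w') < \<epsilon>"
      using \<eta>(2)[of "t - t1" z' w'] a(1-5) \<eta>(1) by auto
  qed (use \<eta> in auto)
qed

lemma continuous_fixed_timesD:
  assumes "continuous_fixed_times I U S G" "t \<in> I" "0 \<le> t" "z \<in> cadlag t U" "w \<in> cadlag t S" "\<epsilon> > 0"
  obtains \<eta> where "\<eta> > 0"
    "\<And>z' w'. \<lbrakk>z' \<in> cadlag t U; w' \<in> cadlag t S;
      \<And>u. 0 \<le> u \<Longrightarrow> u \<le> t \<Longrightarrow> norm (z u - z' u) \<le> \<eta>;
      \<And>u. 0 \<le> u \<Longrightarrow> u \<le> t \<Longrightarrow> norm (w u - w' u) \<le> \<eta>\<rbrakk> \<Longrightarrow> norm (G t z w - G t z' w') < \<epsilon>"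
proof -
  from assms obtain \<eta> where \<eta>: "\<eta> > 0" "\<And>z' w'. z' \<in> cadlag t U \<Longrightarrow> w' \<in> cadlag t S \<Longrightarrow>
      dinf t z w t z' w' < \<eta> \<Longrightarrow> norm (G t z w - G t z' w') < \<epsilon>"
    unfolding continuous_fixed_times_def by metis
  show ?thesis
  proof (rule that[of "\<eta> / 4"])
    fix z' w'
    assume a: "z' \<in> cadlag t U" "w' \<in> cadlag t S"
      "\<And>u. 0 \<le> u \<Longrightarrow> u \<le> t \<Longrightarrow> norm (z u - z' u) \<le> \<eta> / 4"
      "\<And>u. 0 \<le> u \<Longrightarrow> u \<le> t \<Longrightarrow> norm (w u - w' u) \<le> \<eta> / 4"
    have "dinf t z w t z' w' \<le> \<eta> / 4 + \<eta> / 4 + (t - t)" by (rule dinf_le) (use a assms in auto)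
    then show "norm (G t z w - G t z' w') < \<epsilon>"
      using \<eta>(2)[of z' w'] a(1,2) \<eta>(1) by auto
  qed (use \<eta> in auto)
qed

lemma locally_bounded_functionalD:
  assumes "locally_bounded_functional T I U S G" "x \<in> cadlag T U" "v \<in> cadlag T S"
  obtains C \<eta> where "C > 0" "\<eta> > 0"
    "\<And>t z w. \<lbrakk>t \<in> I; 0 \<le> t; z \<in> cadlag t U; w \<in> cadlag t S;
      \<And>u. 0 \<le> u \<Longrightarrow> u \<le> t \<Longrightarrow> norm (x u - z u) \<le> \<eta>;
      \<And>u. 0 \<le> u \<Longrightarrow> u \<le> t \<Longrightarrow> norm (v u - w u) \<le> \<eta>\<rbrakk> \<Longrightarrow> norm (G t z w) \<le> C"
proof -
  from assms obtain C \<eta> where C: "C > 0" and \<eta>: "\<eta> > 0" "\<And>t z w. t \<in> I \<Longrightarrow> z \<in> cadlag t U \<Longrightarrow> w \<in> cadlag t S \<Longrightarrow>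
      dinf t (restrict x {0..t}) (restrict v {0..t}) t z w < \<eta> \<Longrightarrow> norm (G t z w) \<le> C"
    unfolding locally_bounded_functional_def by metis
  show ?thesis
  proof (rule that[of C "\<eta> / 4"])
    fix t z w
    assume a: "t \<in> I" "0 \<le> t" "z \<in> cadlag t U" "w \<in> cadlag t S"
      "\<And>u. 0 \<le> u \<Longrightarrow> u \<le> t \<Longrightarrow> norm (x u - z u) \<le> \<eta> / 4"
      "\<And>u. 0 \<le> u \<Longrightarrow> u \<le> t \<Longrightarrow> norm (v u - w u) \<le> \<eta> / 4"
    have "dinf t (restrict x {0..t}) (restrict v {0..t}) t z w \<le> \<eta> / 4 + \<eta> / 4 + (t - t)"
      by (rule dinf_le) (use a in auto)
    then show "norm (G t z w) \<le> C"
      using \<eta>(2)[of t z w] a(1-4) \<eta>(1) by auto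
  qed (use \<eta> C in auto)
qed

lemma horizontally_locally_lipschitzD:
  assumes "horizontally_locally_lipschitz T U S G" "x \<in> cadlag T U" "v \<in> cadlag T S"
  obtains C \<eta> where "C > 0" "\<eta> > 0"
    "\<And>t1 t2 z w. \<lbrakk>0 \<le> t1; t1 < t2; t2 \<le> T; z \<in> cadlag t1 U; w \<in> cadlag t1 S;
      \<And>u. 0 \<le> u \<Longrightarrow> u \<le> t1 \<Longrightarrow> norm (x u - z u) \<le> \<eta>;
      \<And>u. 0 \<le> u \<Longrightarrow> u \<le> t1 \<Longrightarrow> norm (v u - w u) \<le> \<eta>\<rbrakk> \<Longrightarrow>
      norm (G t2 (hext z t1 (t2 - t1)) (hext w t1 (t2 - t1)) - G t1 z w) \<le> C * (t2 - t1)"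
proof -
  from assms obtain C \<eta> where C: "C > 0" and \<eta>: "\<eta> > 0"
    "\<And>t1 t2 z w. 0 \<le> t1 \<Longrightarrow> t1 < t2 \<Longrightarrow> t2 \<le> T \<Longrightarrow> z \<in> cadlag t1 U \<Longrightarrow> w \<in> cadlag t1 S \<Longrightarrow>
      dinf t1 (restrict x {0..t1}) (restrict v {0..t1}) t1 z w < \<eta> \<Longrightarrow>
      norm (G t2 (hext z t1 (t2 - t1)) (hext w t1 (t2 - t1)) - G t1 z w) < C * (t2 - t1)"
    unfolding horizontally_locally_lipschitz_def by metis
  show ?thesis
  proof (rule that[of C "\<eta> / 4"])
    fix t1 t2 z w
    assume a: "0 \<le> t1" "t1 < t2" "t2 \<le> T" "z \<in> cadlag t1 U" "w \<in> cadlag t1 S"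
      "\<And>u. 0 \<le> u \<Longrightarrow> u \<le> t1 \<Longrightarrow> norm (x u - z u) \<le> \<eta> / 4"
      "\<And>u. 0 \<le> u \<Longrightarrow> u \<le> t1 \<Longrightarrow> norm (v u - w u) \<le> \<eta> / 4"
    have "dinf t1 (restrict x {0..t1}) (restrict v {0..t1}) t1 z w \<le> \<eta> / 4 + \<eta> / 4 + (t1 - t1)"
      by (rule dinf_le) (use a in auto)
    then show "norm (G t2 (hext z t1 (t2 - t1)) (hext w t1 (t2 - t1)) - G t1 z w) \<le> C * (t2 - t1)"
      using \<eta>(2)[of t1 t2 z w] a(1-5) \<eta>(1) by (auto intro: less_imp_le)
  qed (use \<eta> C in auto)
qed

lemma hderiv_works: "\<exists>D. has_hderiv F t z w D \<Longrightarrow> has_hderiv F t z w (hderiv F t z w)"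
  unfolding hderiv_def has_hderiv_def
  by (rule theI') (auto intro: tendsto_unique[rotated])

section \<open>Facts from real analysis\<close>

text \<open>Continuous induction: the times \<open>u\<close> at which \<open>f u - f s\<close> is at
  most \<open>(C + c) * (u - s)\<close> form a closed set. At its maximum the right derivative is
  below \<open>C + c\<close>, so a maximum before \<open>t\<close> could be exceeded. The lower
  bound is the same statement for \<open>- f\<close>.\<close>

lemma right_derivative_lipschitz:
  fixes f :: "real \<Rightarrow> real"
  assumes cont: "continuous_on {a..b} f"
    and deriv: "\<And>t. a \<le> t \<Longrightarrow> t < b \<Longrightarrow> ((\<lambda>h. (f (t + h) - f t) / h) \<longlongrightarrow> g t) (at_right 0)"
    and bound: "\<And>t. a \<le> t \<Longrightarrow> t < b \<Longrightarrow> \<bar>g t\<bar> \<le> C"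
    and st: "a \<le> s" "s \<le> t" "t \<le> b"
  shows "\<bar>f t - f s\<bar> \<le> C * (t - s)"
proof -
  have up: "f t - f s \<le> C * (t - s)"
    if cont: "continuous_on {a..b} f"
      and deriv: "\<And>t. a \<le> t \<Longrightarrow> t < b \<Longrightarrow> ((\<lambda>h. (f (t + h) - f t) / h) \<longlongrightarrow> g t) (at_right 0)"
      and bound: "\<And>t. a \<le> t \<Longrightarrow> t < b \<Longrightarrow> \<bar>g t\<bar> \<le> C" for f g :: "real \<Rightarrow> real"
  proof (rule field_le_epsilon)
    fix e :: real assume "e > 0"
    define c where "c = e / (t - s + 1)"
    have c: "c > 0" "c * (t - s) \<le> e" using \<open>e > 0\<close> st by (auto simp: c_def field_simps)
    define Z where "Z = {u \<in> {s..t}. f u - f s - (C + c) * (u - s) \<le> 0}"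
    have "closed Z"
      unfolding Z_def
      by (intro continuous_on_closed_Collect_le continuous_intros continuous_on_subset[OF cont]) (use st in auto)
    moreover have "bounded Z" by (rule bounded_subset[of "{s..t}"]) (auto simp: Z_def)
    ultimately have "compact Z" by (simp add: compact_eq_bounded_closed)
    moreover have "s \<in> Z" using st by (simp add: Z_def)
    ultimately obtain m where m: "m \<in> Z" "\<And>u. u \<in> Z \<Longrightarrow> u \<le> m"
      using compact_attains_sup[of Z] by auto
    have "m = t"
    proof (rule ccontr)
      assume "m \<noteq> t"
      with m have mt: "s \<le> m" "m < t" by (auto simp: Z_def)
      have "eventually (\<lambda>h. (f (m + h) - f m) / h < C + c) (at_right 0)"
        by (rule order_tendstoD[OF deriv[of m]]) (use mt st bound[of m] c in auto)
      then obtain d where d: "d > 0" "\<And>h. 0 < h \<Longrightarrow> h < d \<Longrightarrow> (f (m + h) - f m) / h < C + c"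
        by (auto simp: eventually_at_right_field)
      define h where "h = min (d / 2) (t - m)"
      have h: "0 < h" "h < d" "m + h \<le> t" using d mt by (auto simp: h_def)
      have "f (m + h) - f m < (C + c) * h" using d(2)[OF h(1,2)] h(1) by (simp add: field_simps)
      then have "m + h \<in> Z" using m(1) h mt by (auto simp: Z_def algebra_simps)
      then show False using m(2) h by force
    qed
    then have "f t - f s \<le> C * (t - s) + c * (t - s)" using m(1) by (auto simp: Z_def algebra_simps)
    then show "f t - f s \<le> C * (t - s) + e" using c by simp
  qed
  have "- f t - (- f s) \<le> C * (t - s)"
  proof (rule up[of "\<lambda>t. - f t" "\<lambda>t. - g t"])
    fix t assume "a \<le> t" "t < b"
    from tendsto_minus[OF deriv[OF this]] show "((\<lambda>h. (- f (t + h) - - f t) / h) \<longlongrightarrow> - g t) (at_right 0)"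
      by (simp add: minus_divide_left)
  qed (use bound cont in \<open>auto intro: continuous_intros\<close>)
  with up[OF cont deriv bound] show ?thesis by auto
qed

text \<open>
  The difference quotients of a Lipschitz function are bounded, and their integrals are difference
  quotients of an antiderivative; dominated convergence does the rest.
\<close>

lemma right_derivative_FTC:
  fixes f :: "real \<Rightarrow> real"
  assumes ab: "a \<le> b" and cont: "continuous_on {a..b} f"
    and deriv: "\<And>t. a \<le> t \<Longrightarrow> t < b \<Longrightarrow> ((\<lambda>h. (f (t + h) - f t) / h) \<longlongrightarrow> g t) (at_right 0)"
    and bound: "\<And>t. a \<le> t \<Longrightarrow> t < b \<Longrightarrow> \<bar>g t\<bar> \<le> C"
  shows "set_integrable lborel {a..<b} g" "(LINT u:{a..<b}|lborel. g u) = f b - f a"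
proof -
  \<comment> \<open>\<open>F\<close> continues \<open>f\<close> by constants beyond [a,b], so that
    difference quotients make sense at and near \<open>b\<close>; the extension stays
    Lipschitz.\<close>
  define c where "c u = max a (min b u)" for u
  define F where "F u = f (c u)" for u
  have c_in: "c u \<in> {a..b}" for u using ab by (auto simp: c_def)
  have contF: "continuous_on A F" for A
  proof -
    have "continuous_on UNIV (\<lambda>u. f (c u))"
      by (rule continuous_on_compose2[OF cont])
        (use c_in in \<open>auto simp: c_def[abs_def] intro!: continuous_intros\<close>)
    then show ?thesis unfolding F_def by (rule continuous_on_subset) simp
  qed
  \<comment> \<open>The interval reaches beyond \<open>b\<close> because the difference quotients
    evaluate \<Phi> at arguments up to \<open>b + 1\<close>.\<close>
  obtain \<Phi> where \<Phi>: "\<And>u. u \<in> {a..b + 2} \<Longrightarrow> (\<Phi> has_vector_derivative F u) (at u within {a..b + 2})"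
    using antiderivative_continuous[OF contF] by metis
  have \<Phi>': "(\<Phi> has_vector_derivative F u) (at u within {a..b + 1})" if "u \<in> {a..b + 1}" for u
    by (rule has_vector_derivative_within_subset[OF \<Phi>]) (use that in auto)
  define h where "h m = inverse (real (Suc m))" for m
  have h: "h m > 0" "h m \<le> 1" for m by (auto simp: h_def inverse_le_1_iff)
  have h0: "h \<longlonglongrightarrow> 0" unfolding h_def by (rule LIMSEQ_inverse_real_of_nat)
  have h0': "filterlim h (at_right 0) sequentially"
    using h0 h(1) by (auto simp: filterlim_at intro!: always_eventually) (metis less_irrefl)
  define q where "q m u = (F (u + h m) - F u) / h m" for m u
  \<comment> \<open>Integrating a difference quotient of \<open>F\<close> over [a,b] leaves the
    difference of two averages of \<open>F\<close>, taken over intervals of length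
    \<open>h m\<close> starting at \<open>b\<close> and at \<open>a\<close>; they tend to
    \<open>F b\<close> and \<open>F a\<close>.\<close>
  have int_q: "(LINT u|lborel. indicator {a..b} u *\<^sub>R q m u) = (\<Phi> (b + h m) - \<Phi> b) / h m - (\<Phi> (a + h m) - \<Phi> a) / h m" for m
  proof -
    have "(LINT u|lborel. indicator {a..b} u *\<^sub>R q m u)
        = (\<Phi> (b + h m) - \<Phi> b) / h m - (\<Phi> (a + h m) - \<Phi> a) / h m"
    proof (rule integral_FTC_atLeastAtMost[OF ab])
      fix u assume u: "a \<le> u" "u \<le> b"
      have "(\<Phi> has_vector_derivative F (u + h m)) (at (u + h m) within (\<lambda>u. u + h m) ` {a..b})"
        by (rule has_vector_derivative_within_subset[OF \<Phi>'])
          (use u h[of m] in \<open>auto\<close>)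
      moreover have "((\<lambda>u. u + h m) has_vector_derivative 1) (at u within {a..b})"
        by (auto simp: has_real_derivative_iff_has_vector_derivative[symmetric] intro!: derivative_eq_intros)
      ultimately have 1: "((\<lambda>u. \<Phi> (u + h m)) has_vector_derivative F (u + h m)) (at u within {a..b})"
        using vector_diff_chain_within[of "\<lambda>u. u + h m" 1 u "{a..b}" \<Phi> "F (u + h m)"]
        unfolding o_def by simp
      have 2: "(\<Phi> has_vector_derivative F u) (at u within {a..b})"
        by (rule has_vector_derivative_within_subset[OF \<Phi>']) (use u in auto)
      show "((\<lambda>u. (\<Phi> (u + h m) - \<Phi> u) / h m) has_vector_derivative q m u) (at u within {a..b})"
        using 1 2 h(1)[of m] unfolding q_def has_real_derivative_iff_has_vector_derivative[symmetric]
        by (auto intro!: derivative_eq_intros)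
    next
      have "continuous_on {a..b} (\<lambda>u. F (u + h m))"
        by (rule continuous_on_compose2[OF contF[of UNIV]]) (auto intro!: continuous_intros)
      then show "continuous_on {a..b} (q m)"
        unfolding q_def using h[of m] by (auto intro!: continuous_intros contF)
    qed
    then show ?thesis .
  qed
  have int_lim: "(\<lambda>m. (\<Phi> (u + h m) - \<Phi> u) / h m) \<longlonglongrightarrow> F u" if u: "a \<le> u" "u \<le> b" for u
  proof -
    have "(\<Phi> has_real_derivative F u) (at u within {a..b + 1})"
      using \<Phi>'[of u] u by (simp add: has_real_derivative_iff_has_vector_derivative)
    then have "(\<Phi> has_real_derivative F u) (at u within {u..u + 1})"
      by (rule has_field_derivative_subset) (use u in auto)
    then have "((\<lambda>y. (\<Phi> y - \<Phi> u) / (y - u)) \<longlongrightarrow> F u) (at u within {u..u + 1})"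
      by (simp add: has_field_derivative_iff)
    moreover have "filterlim (\<lambda>m. u + h m) (at u within {u..u + 1}) sequentially"
      unfolding filterlim_at
    proof (intro conjI always_eventually allI)
      show "(\<lambda>m. u + h m) \<longlonglongrightarrow> u" using tendsto_add[OF tendsto_const[of u] h0] by simp
    qed (use h in \<open>auto simp: less_imp_le less_imp_neq[symmetric]\<close>)

    ultimately have "(\<lambda>m. (\<Phi> (u + h m) - \<Phi> u) / ((u + h m) - u)) \<longlonglongrightarrow> F u"
      by (rule filterlim_compose)
    then show ?thesis by simp
  qed
  have lip: "\<bar>F t - F s\<bar> \<le> \<bar>C\<bar> * (t - s)" if "s \<le> t" for s t
  proof -
    have "c s \<le> c t" "c t - c s \<le> t - s" using that ab by (auto simp: c_def max_def min_def)
    moreover have "\<bar>f (c t) - f (c s)\<bar> \<le> \<bar>C\<bar> * (c t - c s)"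
      by (rule right_derivative_lipschitz[OF cont deriv])
        (use bound c_in[of s] c_in[of t] \<open>c s \<le> c t\<close> in \<open>force+\<close>)
    ultimately show ?thesis unfolding F_def by (smt (verit) mult_left_mono)
  qed
  \<comment> \<open>At \<open>b\<close> no derivative is given; the quotients vanish there because
    \<open>F\<close> is constant beyond \<open>b\<close>.\<close>
  define g' where "g' u = (if u < b then g u else 0)" for u
  have lim: "(\<lambda>m. indicator {a..b} u *\<^sub>R q m u) \<longlonglongrightarrow> indicator {a..b} u *\<^sub>R g' u" for u
  proof (cases "a \<le> u \<and> u < b")
    case True
    then have "(\<lambda>m. (f (u + h m) - f u) / h m) \<longlonglongrightarrow> g u"
      using filterlim_compose[OF deriv h0'] by auto
    moreover have "\<forall>\<^sub>F m in sequentially. h m < b - u"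
      by (rule order_tendstoD[OF h0]) (use True in simp)
    then have "\<forall>\<^sub>F m in sequentially. (f (u + h m) - f u) / h m = q m u"
    proof eventually_elim
      case (elim m)
      then show ?case using True h[of m] by (simp add: q_def F_def c_def)
    qed
    ultimately have "(\<lambda>m. q m u) \<longlonglongrightarrow> g u" by (rule Lim_transform_eventually)
    then show ?thesis using True by (simp add: g'_def)
  next
    case False
    then consider "u \<notin> {a..b}" | "u = b" by fastforce
    then show ?thesis
    proof cases
      case 2
      have "q m b = 0" for m using h[of m] ab by (simp add: q_def F_def c_def)
      then show ?thesis using 2 by (simp add: g'_def)
    qed simp
  qed
  have meas: "(\<lambda>u. indicator {a..b} u *\<^sub>R q m u) \<in> borel_measurable lborel" for m
  proof -
    have "F \<in> borel_measurable borel" by (rule borel_measurable_continuous_onI[OF contF])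
    then show ?thesis unfolding q_def by measurable
  qed
  have dom: "norm (indicator {a..b} u *\<^sub>R q m u) \<le> indicator {a..b} u *\<^sub>R \<bar>C\<bar>" for m u
  proof -
    have "\<bar>F (u + h m) - F u\<bar> \<le> \<bar>C\<bar> * h m" using lip[of u "u + h m"] h[of m] by simp
    then have "\<bar>q m u\<bar> \<le> \<bar>C\<bar>" using h[of m] by (simp add: q_def abs_divide field_simps)
    then show ?thesis by (simp add: indicator_def)
  qed
  have intC: "integrable lborel (\<lambda>u. indicator {a..b} u *\<^sub>R \<bar>C\<bar>)"
    by (intro integrable_scaleR_left) (auto simp: integrable_indicator_iff emeasure_lborel_Icc_eq)
  have meas': "(\<lambda>u. indicator {a..b} u *\<^sub>R g' u) \<in> borel_measurable lborel"
    by (rule borel_measurable_LIMSEQ_metric[OF meas lim])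
  note dc = integral_dominated_convergence[OF meas' meas intC AE_I2[OF lim] AE_I2[OF dom]]
    integrable_dominated_convergence[OF meas' meas intC AE_I2[OF lim] AE_I2[OF dom]]
  have eq: "indicator {a..b} u *\<^sub>R g' u = indicator {a..<b} u *\<^sub>R g u" for u
    by (auto simp: indicator_def g'_def)
  show "set_integrable lborel {a..<b} g"
    using dc(2) unfolding set_integrable_def eq .
  have "(\<lambda>m. LINT u|lborel. indicator {a..b} u *\<^sub>R q m u) \<longlonglongrightarrow> F b - F a"
    unfolding int_q by (intro tendsto_diff int_lim) (use ab in auto)
  with dc(1) have "(LINT u|lborel. indicator {a..b} u *\<^sub>R g' u) = F b - F a"
    by (rule LIMSEQ_unique)
  then show "(LINT u:{a..<b}|lborel. g u) = f b - f a"
    unfolding set_lebesgue_integral_def eq using ab by (simp add: F_def c_def)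
qed

text \<open>Dominated convergence for the counting measure: for real families summability is
  absolute, so \<open>infsum\<close> is a Lebesgue integral. The sequence is shifted to where the
  domination holds.\<close>

lemma infsum_dominated_convergence:
  fixes f :: "nat \<Rightarrow> 'i \<Rightarrow> real"
  assumes g: "g summable_on A"
    and lim: "\<And>a. a \<in> A \<Longrightarrow> (\<lambda>n. f n a) \<longlonglongrightarrow> h a"
    and dom: "\<forall>\<^sub>F n in sequentially. \<forall>a\<in>A. \<bar>f n a\<bar> \<le> g a"
  shows "h summable_on A" "(\<lambda>n. infsum (f n) A) \<longlonglongrightarrow> infsum h A"
proof -
  from dom obtain N where N: "\<And>n a. n \<ge> N \<Longrightarrow> a \<in> A \<Longrightarrow> \<bar>f n a\<bar> \<le> g a"
    by (auto simp: eventually_sequentially)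
  have abs_iff: "f' summable_on A \<longleftrightarrow> integrable (count_space A) f'" for f' :: "'i \<Rightarrow> real"
    using abs_summable_equivalent[of f' A] summable_on_iff_abs_summable_on_real[of f' A]
    unfolding abs_summable_on_def by blast
  have int_g: "integrable (count_space A) g"
    using g by (simp add: abs_iff)
  have lim': "AE a in count_space A. (\<lambda>n. f (n + N) a) \<longlonglongrightarrow> h a"
    by (rule AE_I2, rule LIMSEQ_ignore_initial_segment) (simp add: lim)
  have dom': "AE a in count_space A. norm (f (n + N) a) \<le> g a" for n
    by (rule AE_I2) (simp add: N)
  have meas: "f' \<in> borel_measurable (count_space A)" for f' :: "'i \<Rightarrow> real"
    by simp
  note dc = integrable_dominated_convergence[OF meas meas int_g lim' dom']
    integrable_dominated_convergence2[OF meas meas int_g lim' dom']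
    integral_dominated_convergence[OF meas meas int_g lim' dom']
  have "(\<lambda>n. infsetsum (f (n + N)) A) \<longlonglongrightarrow> infsetsum h A"
    unfolding infsetsum_def using dc(3) .
  then show "(\<lambda>n. infsum (f n) A) \<longlonglongrightarrow> infsum h A"
    using dc(1,2) by (simp add: infsetsum_infsum abs_summable_on_def LIMSEQ_offset)
  show "h summable_on A"
    using dc(1) by (simp add: abs_iff)

qed

section \<open>Weighted sums over the subdivision points\<close>

context partition_sequence
begin

lemma points_dense:
  assumes "t \<in> {0..T}" "e > 0"
  shows "\<forall>\<^sub>F n in sequentially. \<exists>i\<in>steps n. \<bar>p n i - t\<bar> < e"
  using mesh_small[OF assms(2)]
proof eventually_elim
  case (elim n)
  show ?case
  proof (cases "t = T")
    case True
    then obtain i where "i \<in> steps n" "p n i < t" "t \<le> p n (Suc i)"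
      using step_before[of t n] T_pos by auto
    then show ?thesis using elim by (intro bexI[of _ i]) auto
  next
    case False
    then obtain i where "i \<in> steps n" "p n i \<le> t" "t < p n (Suc i)"
      using step_at[of t n] assms(1) by auto
    then show ?thesis using elim by (intro bexI[of _ i]) auto
  qed
qed

lemma points_dense_left:
  assumes "0 < w" "w \<le> T" "a < w"
  shows "\<forall>\<^sub>F n in sequentially. \<exists>i\<in>steps n. a < p n i \<and> p n (Suc i) < w"
proof -
  \<comment> \<open>A step around \<open>w - \<gamma>\<close> that is shorter than \<gamma> lies
    between \<open>w - 2 * \<gamma>\<close> and \<open>w\<close>, hence to the right of
    \<open>a\<close>.\<close>
  define \<gamma> where "\<gamma> = min w (w - a) / 2"
  have \<gamma>: "\<gamma> > 0" "2 * \<gamma> \<le> w" "2 * \<gamma> \<le> w - a" using assms by (auto simp: \<gamma>_def)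
  from mesh_small[OF \<gamma>(1)] show ?thesis
  proof eventually_elim
    case (elim n)
    obtain i where i: "i \<in> steps n" "p n i < w - \<gamma>" "w - \<gamma> \<le> p n (Suc i)"
      using step_before[of "w - \<gamma>" n] \<gamma> assms by auto
    then show ?case using elim \<gamma> by (intro bexI[of _ i]) force+
  qed
qed

text \<open>
  The tags \<open>R n i\<close> are only known to converge along points approaching \<open>u\<close> from the left; this
  still forces two-sided convergence at all but countably many points.
\<close>

lemma countable_exceptional_points:
  fixes R :: "nat \<Rightarrow> nat \<Rightarrow> real" and H :: "real \<Rightarrow> real"
  assumes left: "\<And>u e. 0 < u \<Longrightarrow> u \<le> T \<Longrightarrow> e > 0 \<Longrightarrow> \<exists>d>0. \<forall>\<^sub>F n in sequentially. \<forall>i\<in>steps n.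
      u - d < p n i \<and> p n (Suc i) < u \<longrightarrow> \<bar>R n i - H u\<bar> < e"
  shows "countable {u \<in> {0<..T}. \<not> (\<forall>e>0. \<exists>d>0. \<forall>\<^sub>F n in sequentially. \<forall>i\<in>steps n.
      \<bar>p n i - u\<bar> < d \<longrightarrow> \<bar>R n i - H u\<bar> < e)}"
proof -
  define good where "good u e \<longleftrightarrow> (\<exists>d>0. \<forall>\<^sub>F n in sequentially. \<forall>i\<in>steps n.
      \<bar>p n i - u\<bar> < d \<longrightarrow> \<bar>R n i - H u\<bar> < e)" for u e
  have good_mono: "good u e'" if "good u e" "e \<le> e'" for u e e'
    using that unfolding good_def by (fast elim!: eventually_mono less_le_trans)
  define B where "B m = {u \<in> {0<..T}. \<not> good u (1 / real (Suc m))}" for m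
  have "countable (B m)" for m
  proof (rule countable_if_left_isolated)
    fix u assume u: "u \<in> B m"
    define e where "e = 1 / real (Suc m)"
    have e: "e / 3 > 0" by (simp add: e_def)
    from u have uT: "0 < u" "u \<le> T" by (auto simp: B_def)
    obtain d where d: "d > 0" "\<forall>\<^sub>F n in sequentially. \<forall>i\<in>steps n.
        u - d < p n i \<and> p n (Suc i) < u \<longrightarrow> \<bar>R n i - H u\<bar> < e / 3"
      using left[OF uT e] by blast
    \<comment> \<open>Left of \<open>u\<close> the tags are within e/3 of \<open>H u\<close>. A tag
      just before \<open>w\<close> compares \<open>H w\<close> with \<open>H u\<close>; then all
      tags near \<open>w\<close>, on either side, are within \<open>e\<close> of
      \<open>H w\<close>.\<close>
    have "good w e" if w: "u - d < w" "w < u" "0 < w" for w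
    proof -
      obtain d' where d': "d' > 0" "\<forall>\<^sub>F n in sequentially. \<forall>i\<in>steps n.
          w - d' < p n i \<and> p n (Suc i) < w \<longrightarrow> \<bar>R n i - H w\<bar> < e / 3"
        using left[of w "e / 3"] w uT e by auto
      have "max (w - d') (u - d) < w" using d' w by auto
      then have "\<forall>\<^sub>F n in sequentially. \<exists>i\<in>steps n. max (w - d') (u - d) < p n i \<and> p n (Suc i) < w"
        by (intro points_dense_left) (use w uT in auto)
      from eventually_happens'[OF sequentially_bot eventually_conj[OF this eventually_conj[OF d(2) d'(2)]]]
      obtain n where n: "\<exists>i\<in>steps n. max (w - d') (u - d) < p n i \<and> p n (Suc i) < w"
        "\<forall>i\<in>steps n. u - d < p n i \<and> p n (Suc i) < u \<longrightarrow> \<bar>R n i - H u\<bar> < e / 3"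
        "\<forall>i\<in>steps n. w - d' < p n i \<and> p n (Suc i) < w \<longrightarrow> \<bar>R n i - H w\<bar> < e / 3"
        by blast
      then obtain i where i: "i \<in> steps n" "max (w - d') (u - d) < p n i" "p n (Suc i) < w" by auto
      have "\<bar>R n i - H u\<bar> < e / 3" "\<bar>R n i - H w\<bar> < e / 3" using n(2,3) i w by auto
      then have uw: "\<bar>H u - H w\<bar> < 2 * e / 3" by linarith
      define \<gamma> where "\<gamma> = min (w - (u - d)) (u - w) / 2"
      have \<gamma>: "\<gamma> > 0" "2 * \<gamma> \<le> w - (u - d)" "2 * \<gamma> \<le> u - w" using w by (auto simp: \<gamma>_def)
      have "\<forall>\<^sub>F n in sequentially. \<forall>i\<in>steps n. \<bar>p n i - w\<bar> < \<gamma> \<longrightarrow> \<bar>R n i - H w\<bar> < e"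
        using mesh_small[OF \<gamma>(1)] d(2)
      proof eventually_elim
        case (elim n)
        show ?case
        proof (intro ballI impI)
          fix i assume i: "i \<in> steps n" "\<bar>p n i - w\<bar> < \<gamma>"
          have "u - d < p n i" "p n (Suc i) < u"
            using i \<gamma> elim(1)[rule_format, OF i(1)] by (auto simp: abs_less_iff)
          then have "\<bar>R n i - H u\<bar> < e / 3" using elim(2) i by auto
          then show "\<bar>R n i - H w\<bar> < e" using uw by linarith
        qed
      qed
      then show ?thesis unfolding good_def using \<gamma>(1) by blast
    qed
    then have "{u - d<..<u} \<inter> B m = {}" by (auto simp: B_def e_def)
    then show "\<exists>d>0. {u - d<..<u} \<inter> B m = {}" using d(1) by blast
  qed
  moreover have "{u \<in> {0<..T}. \<not> (\<forall>e>0. good u e)} \<subseteq> (\<Union>m. B m)"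
  proof
    fix u assume "u \<in> {u \<in> {0<..T}. \<not> (\<forall>e>0. good u e)}"
    then obtain e where u: "u \<in> {0<..T}" "e > 0" "\<not> good u e" by auto
    from nat_approx_posE[OF u(2)] obtain m where "1 / real (Suc m) < e" by (metis of_nat_Suc)
    then have "u \<in> B m" using u good_mono[of u "1 / real (Suc m)" e] by (auto simp: B_def)
    then show "u \<in> (\<Union>m. B m)" by blast
  qed
  ultimately show ?thesis unfolding good_def by (meson countable_UN countable_subset countableI_type)
qed

end

text \<open>The squared gaps in abstract form: weights at the left ends of the steps whose weak
  limit has no atoms, so that countable exceptional sets are null.\<close>

locale tagged_weights = partition_sequence +
  fixes \<mu> :: "real measure" and m :: "nat \<Rightarrow> nat \<Rightarrow> real"
  assumes finite_\<mu>: "finite_measure \<mu>" and sets_\<mu>: "sets \<mu> = sets borel"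
    and atomless: "\<And>s. emeasure \<mu> {s} = 0"
    and m_nonneg: "\<And>n i. i \<in> steps n \<Longrightarrow> 0 \<le> m n i"
    and weak_limit: "\<And>\<phi>. continuous_on {0..T} \<phi> \<Longrightarrow>
      (\<lambda>n. \<Sum>i\<in>steps n. \<phi> (p n i) * m n i) \<longlonglongrightarrow> (LINT u:{0<..T}|\<mu>. \<phi> u)"
begin

text \<open>
  The sup-convolutions \<open>h N\<close> of the tags are Lipschitz continuous, dominate the tags from stage \<open>N\<close>
  on, and decrease to \<open>H\<close> outside the exceptional set.
\<close>

lemma tagged_sums_upper:
  fixes R :: "nat \<Rightarrow> nat \<Rightarrow> real" and H :: "real \<Rightarrow> real"
  assumes bound: "\<And>n i. i \<in> steps n \<Longrightarrow> \<bar>R n i\<bar> \<le> C"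
    and left: "\<And>u e. 0 < u \<Longrightarrow> u \<le> T \<Longrightarrow> e > 0 \<Longrightarrow> \<exists>d>0. \<forall>\<^sub>F n in sequentially. \<forall>i\<in>steps n.
      u - d < p n i \<and> p n (Suc i) < u \<longrightarrow> \<bar>R n i - H u\<bar> < e"
  shows "set_integrable \<mu> {0<..T} H"
    and "\<And>e. e > 0 \<Longrightarrow> \<forall>\<^sub>F n in sequentially. (\<Sum>i\<in>steps n. R n i * m n i) < (LINT u:{0<..T}|\<mu>. H u) + e"
proof -
  interpret finite_measure \<mu> by (rule finite_\<mu>)
  define good where "good u \<longleftrightarrow> (\<forall>e>0. \<exists>d>0. \<forall>\<^sub>F n in sequentially. \<forall>i\<in>steps n.
      \<bar>p n i - u\<bar> < d \<longrightarrow> \<bar>R n i - H u\<bar> < e)" for u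
  define Bad where "Bad = {u \<in> {0<..T}. \<not> good u}"
  have Bad: "countable Bad" unfolding Bad_def good_def by (rule countable_exceptional_points) (rule left)
  define Idx where "Idx N = {(n, i). n \<ge> N \<and> i \<in> steps n}" for N :: nat
  define h where "h N t = (SUP (n, i)\<in>Idx N. R n i - real N * \<bar>p n i - t\<bar>)" for N t
  have C: "0 \<le> C" using bound steps_nonempty[of 0] by (metis abs_ge_zero all_not_in_conv order_trans)
  have Idx: "Idx N \<noteq> {}" for N using steps_nonempty[of N] by (auto simp: Idx_def)
  have le_C: "R n i - real N * \<bar>p n i - t\<bar> \<le> C" if "i \<in> steps n" for n i N t
  proof -
    have "0 \<le> real N * \<bar>p n i - t\<bar>" by simp
    then show ?thesis using bound[OF that] by linarith
  qed
  have bdd: "bdd_above ((\<lambda>(n, i). R n i - real N * \<bar>p n i - t\<bar>) ` Idx N)" for N t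
    by (rule bdd_aboveI2[of _ _ C]) (auto simp: Idx_def intro: le_C)
  have h_ge: "R n i - real N * \<bar>p n i - t\<bar> \<le> h N t" if "n \<ge> N" "i \<in> steps n" for n i N t
    unfolding h_def using cSUP_upper[OF _ bdd, of "(n, i)" N t] that by (auto simp: Idx_def)
  have h_le: "h N t \<le> c" if "\<And>n i. n \<ge> N \<Longrightarrow> i \<in> steps n \<Longrightarrow> R n i - real N * \<bar>p n i - t\<bar> \<le> c" for N t c
    unfolding h_def using Idx[of N] that by (intro cSUP_least) (auto simp: Idx_def)
  have h_le_C: "h N t \<le> C" for N t by (rule h_le) (rule le_C)
  have near: "\<exists>n\<ge>N. \<exists>i\<in>steps n. \<bar>p n i - t\<bar> < e" if "t \<in> {0..T}" "e > 0" for N t e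
    using eventually_conj[OF points_dense[OF that] eventually_ge_at_top[of N]]
    by (auto simp: eventually_sequentially)
  \<comment> \<open>Tags from late stages lie so close to \<open>t\<close> that their penalty is
    below any given \<open>e\<close>.\<close>
  have h_ge_C: "- C \<le> h N t" if t: "t \<in> {0..T}" for N t
  proof (rule field_le_epsilon)
    fix e :: real assume e: "e > 0"
    obtain n i where ni: "n \<ge> N" "i \<in> steps n" "\<bar>p n i - t\<bar> < e / (real N + 1)"
      using near[OF t, of "e / (real N + 1)" N] e by auto
    have "real N * \<bar>p n i - t\<bar> \<le> (real N + 1) * (e / (real N + 1))"
      by (rule mult_mono) (use ni in auto)
    then have "real N * \<bar>p n i - t\<bar> \<le> e" by simp
    then show "- C \<le> h N t + e" using h_ge[OF ni(1,2), of t] bound[OF ni(2)] by linarith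
  qed
  have lip: "h N t \<le> h N s + real N * \<bar>t - s\<bar>" for N t s
  proof (rule h_le)
    fix n i assume ni: "n \<ge> N" "i \<in> steps n"
    have "real N * \<bar>p n i - s\<bar> \<le> real N * (\<bar>p n i - t\<bar> + \<bar>t - s\<bar>)" by (rule mult_left_mono) auto
    then show "R n i - real N * \<bar>p n i - t\<bar> \<le> h N s + real N * \<bar>t - s\<bar>"
      using h_ge[OF ni, of s] by (simp add: algebra_simps)
  qed
  have cont: "continuous_on A (h N)" for A N
  proof -
    have "(real N)-lipschitz_on UNIV (h N)"
    proof (rule lipschitz_onI)
      fix s t
      show "dist (h N s) (h N t) \<le> real N * dist s t"
        using lip[of N s t] lip[of N t s] by (simp add: dist_real_def abs_le_iff abs_minus_commute[of t s])
    qed simp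
    then show ?thesis by (meson continuous_on_subset lipschitz_on_continuous_on subset_UNIV)
  qed
  have lim: "(\<lambda>N. h N u) \<longlonglongrightarrow> H u" if u: "u \<in> {0<..T}" "good u" for u
  proof -
    have uT: "u \<in> {0..T}" using u by auto
    have lower: "H u \<le> h N u" for N
    proof (rule field_le_epsilon)
      fix e :: real assume e: "e > 0"
      then obtain d where d: "d > 0" "\<forall>\<^sub>F n in sequentially. \<forall>i\<in>steps n. \<bar>p n i - u\<bar> < d \<longrightarrow> \<bar>R n i - H u\<bar> < e / 2"
        using u(2) unfolding good_def by (meson half_gt_zero)
      define d' where "d' = min d (e / (2 * (real N + 1)))"
      have "d' > 0" using d e by (auto simp: d'_def)
      from eventually_conj[OF points_dense[OF uT this] eventually_conj[OF d(2) eventually_ge_at_top[of N]]]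
      obtain n i where ni: "n \<ge> N" "i \<in> steps n" "\<bar>p n i - u\<bar> < d'" "\<bar>R n i - H u\<bar> < e / 2"
        unfolding d'_def by (auto simp: eventually_sequentially)
      have "real N * \<bar>p n i - u\<bar> \<le> (real N + 1) * (e / (2 * (real N + 1)))"
        by (rule mult_mono) (use ni in \<open>auto simp: d'_def\<close>)
      also have "\<dots> = e / 2" by (simp add: field_simps)
      finally show "H u \<le> h N u + e" using h_ge[OF ni(1,2), of u] ni(4) by linarith
    qed
    have "- C \<le> H u"
    proof (rule field_le_epsilon)
      fix e :: real assume e: "e > 0"
      then obtain d where d: "d > 0" "\<forall>\<^sub>F n in sequentially. \<forall>i\<in>steps n. \<bar>p n i - u\<bar> < d \<longrightarrow> \<bar>R n i - H u\<bar> < e"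
        using u(2) unfolding good_def by blast
      from eventually_conj[OF points_dense[OF uT d(1)] d(2)]
      obtain n i where ni: "i \<in> steps n" "\<bar>R n i - H u\<bar> < e" by (auto simp: eventually_sequentially)
      then show "- C \<le> H u + e" using bound[OF ni(1)] by linarith
    qed
    show ?thesis
    proof (rule LIMSEQ_I)
      fix e :: real assume e: "e > 0"
      then obtain d N0 where d: "d > 0" "\<And>n i. n \<ge> N0 \<Longrightarrow> i \<in> steps n \<Longrightarrow> \<bar>p n i - u\<bar> < d \<Longrightarrow> \<bar>R n i - H u\<bar> < e / 2"
        using u(2) unfolding good_def eventually_sequentially by (meson half_gt_zero)
      \<comment> \<open>From here on the penalty of a tag at distance at least \<open>d\<close> is
        at least \<open>2 * C\<close>, which brings it below \<open>- C\<close> and so below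
        \<open>H u\<close>.\<close>
      obtain N1 where N1: "2 * C / d \<le> real N1" using real_arch_simple by blast
      have "norm (h N u - H u) < e" if N: "N \<ge> max N0 N1" for N
      proof -
        have "h N u \<le> H u + e / 2"
        proof (rule h_le)
          fix n i assume ni: "n \<ge> N" "i \<in> steps n"
          show "R n i - real N * \<bar>p n i - u\<bar> \<le> H u + e / 2"
          proof (cases "\<bar>p n i - u\<bar> < d")
            case True
            then have "\<bar>R n i - H u\<bar> < e / 2" using d(2) ni N by auto
            moreover have "0 \<le> real N * \<bar>p n i - u\<bar>" by simp
            ultimately show ?thesis by linarith
          next
            case False
            have "2 * C / d \<le> real N" using N1 N by auto
            then have "2 * C \<le> real N * d" using d(1) by (simp add: field_simps)
            also have "\<dots> \<le> real N * \<bar>p n i - u\<bar>" using False by (intro mult_left_mono) auto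
            finally show ?thesis using bound[OF ni(2)] \<open>- C \<le> H u\<close> e by linarith
          qed
        qed
        then show ?thesis using lower[of N] e unfolding real_norm_def by linarith
      qed
      then show "\<exists>no. \<forall>N\<ge>no. norm (h N u - H u) < e" by blast
    qed
  qed
  have sp [simp]: "space \<mu> = UNIV" using sets_eq_imp_space_eq[OF sets_\<mu>] by simp
  have meas_h: "(\<lambda>u. indicator {0<..T} u *\<^sub>R h N u) \<in> borel_measurable \<mu>" for N
  proof -
    have "h N \<in> borel_measurable borel" by (rule borel_measurable_continuous_onI[OF cont])
    then have "(\<lambda>u. indicator {0<..T} u *\<^sub>R h N u) \<in> borel_measurable borel" by measurable
    then show ?thesis by (simp add: measurable_cong_sets[OF sets_\<mu> refl])
  qed
  have singl: "{u} \<in> sets \<mu>" for u by (simp add: sets_\<mu>)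
  have Bad_sets: "Bad \<in> sets \<mu>" using Bad singl by (rule sets.countable[rotated])
  \<comment> \<open>Measurability of \<open>H\<close> has to be derived: off the countable set
    \<open>Bad\<close> it is a limit of measurable functions, and altering a function at countably
    many points keeps it measurable.\<close>
  have lim': "(\<lambda>N. if u \<in> Bad then 0 else indicator {0<..T} u *\<^sub>R h N u)
      \<longlonglongrightarrow> (if u \<in> Bad then 0 else indicator {0<..T} u *\<^sub>R H u)" for u
    using lim[of u] by (cases "u \<in> {0<..T}") (auto simp: Bad_def)
  have meas0: "(\<lambda>u. if u \<in> Bad then 0 else indicator {0<..T} u *\<^sub>R h N u) \<in> borel_measurable \<mu>" for N
    using meas_h[of N] Bad_sets by measurable
  have "(\<lambda>u. if u \<in> Bad then 0 else indicator {0<..T} u *\<^sub>R H u) \<in> borel_measurable \<mu>"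
    by (rule borel_measurable_LIMSEQ_metric[OF meas0 lim'])
  then have meas_H: "(\<lambda>u. indicator {0<..T} u *\<^sub>R H u) \<in> borel_measurable \<mu>"
    by (rule measurable_discrete_difference[OF _ Bad]) (use singl in auto)
  have "emeasure \<mu> Bad = (\<integral>\<^sup>+u. emeasure \<mu> {u} \<partial>count_space Bad)"
    by (rule emeasure_countable_singleton[OF singl Bad])
  then have "Bad \<in> null_sets \<mu>" using Bad_sets by (intro null_setsI) (auto simp: atomless)
  then have "AE u in \<mu>. u \<notin> Bad" by (rule AE_not_in)
  then have AE_lim: "AE u in \<mu>. (\<lambda>N. indicator {0<..T} u *\<^sub>R h N u) \<longlonglongrightarrow> indicator {0<..T} u *\<^sub>R H u"
  proof eventually_elim
    case (elim u)
    then show ?case using lim'[of u] by simp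
  qed
  have dom: "AE u in \<mu>. norm (indicator {0<..T} u *\<^sub>R h N u) \<le> C" for N
    using h_le_C[of N] h_ge_C[of _ N] C by (intro AE_I2) (auto simp: indicator_def abs_le_iff minus_le_iff)
  have intC: "integrable \<mu> (\<lambda>u. C)" by simp
  note dc = integrable_dominated_convergence[OF meas_H meas_h intC AE_lim dom]
    integral_dominated_convergence[OF meas_H meas_h intC AE_lim dom]
  show "set_integrable \<mu> {0<..T} H" using dc(1) by (simp add: set_integrable_def)
  fix e :: real assume e: "e > 0"
  have "\<forall>\<^sub>F N in sequentially. (LINT u:{0<..T}|\<mu>. h N u) < (LINT u:{0<..T}|\<mu>. H u) + e"
    using dc(2) e unfolding set_lebesgue_integral_def by (intro order_tendstoD) auto
  then obtain N where "(LINT u:{0<..T}|\<mu>. h N u) < (LINT u:{0<..T}|\<mu>. H u) + e"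
    by (auto simp: eventually_sequentially)
  from order_tendstoD(2)[OF weak_limit[OF cont] this] eventually_ge_at_top[of N]
  show "\<forall>\<^sub>F n in sequentially. (\<Sum>i\<in>steps n. R n i * m n i) < (LINT u:{0<..T}|\<mu>. H u) + e"
  proof eventually_elim
    case (elim n)
    have "(\<Sum>i\<in>steps n. R n i * m n i) \<le> (\<Sum>i\<in>steps n. h N (p n i) * m n i)"
    proof (intro sum_mono mult_right_mono m_nonneg)
      fix i assume "i \<in> steps n"
      from h_ge[OF elim(2) this, of "p n i"] show "R n i \<le> h N (p n i)" by simp
    qed
    then show ?case using elim(1) by simp
  qed
qed

text \<open>The upper estimate is applied to the tags and to their negatives. Tags of the finitely
  many stages before the bound holds are set to zero, which does not affect the limits.\<close>

lemma tagged_sums_converge: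
  fixes R :: "nat \<Rightarrow> nat \<Rightarrow> real" and H :: "real \<Rightarrow> real"
  assumes bound: "\<forall>\<^sub>F n in sequentially. \<forall>i\<in>steps n. \<bar>R n i\<bar> \<le> C"
    and left: "\<And>u e. 0 < u \<Longrightarrow> u \<le> T \<Longrightarrow> e > 0 \<Longrightarrow> \<exists>d>0. \<forall>\<^sub>F n in sequentially. \<forall>i\<in>steps n.
      u - d < p n i \<and> p n (Suc i) < u \<longrightarrow> \<bar>R n i - H u\<bar> < e"
  shows "set_integrable \<mu> {0<..T} H"
    and "(\<lambda>n. \<Sum>i\<in>steps n. R n i * m n i) \<longlonglongrightarrow> (LINT u:{0<..T}|\<mu>. H u)"
proof -
  from bound obtain N where N: "\<And>n i. n \<ge> N \<Longrightarrow> i \<in> steps n \<Longrightarrow> \<bar>R n i\<bar> \<le> C"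
    by (auto simp: eventually_sequentially)
  define R' where "R' n i = (if n \<ge> N then R n i else 0)" for n i
  have R': "\<forall>\<^sub>F n in sequentially. R' n = R n"
    using eventually_ge_at_top[of N] by eventually_elim (auto simp: R'_def)
  have C: "0 \<le> C" using N[of N] steps_nonempty[of N] by (metis abs_ge_zero all_not_in_conv order_refl order_trans)
  have b: "\<bar>R' n i\<bar> \<le> C" if "i \<in> steps n" for n i using N that C by (simp add: R'_def)
  have l: "\<exists>d>0. \<forall>\<^sub>F n in sequentially. \<forall>i\<in>steps n.
      u - d < p n i \<and> p n (Suc i) < u \<longrightarrow> \<bar>R' n i - H u\<bar> < e" if u: "0 < u" "u \<le> T" "e > 0" for u e
  proof -
    obtain d where d: "d > 0" "\<forall>\<^sub>F n in sequentially. \<forall>i\<in>steps n.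
        u - d < p n i \<and> p n (Suc i) < u \<longrightarrow> \<bar>R n i - H u\<bar> < e" using left[OF u] by blast
    have "\<forall>\<^sub>F n in sequentially. \<forall>i\<in>steps n.
        u - d < p n i \<and> p n (Suc i) < u \<longrightarrow> \<bar>R' n i - H u\<bar> < e"
      using d(2) R' by eventually_elim simp
    then show ?thesis using d(1) by blast
  qed
  have l': "\<exists>d>0. \<forall>\<^sub>F n in sequentially. \<forall>i\<in>steps n.
      u - d < p n i \<and> p n (Suc i) < u \<longrightarrow> \<bar>- R' n i - (- H u)\<bar> < e" if u: "0 < u" "u \<le> T" "e > 0" for u e
    using l[OF u] by (simp add: abs_minus_commute)
  have up: "\<forall>\<^sub>F n in sequentially. (\<Sum>i\<in>steps n. R' n i * m n i) < (LINT u:{0<..T}|\<mu>. H u) + e"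
    if "e > 0" for e by (rule tagged_sums_upper(2)) (fact b l that)+
  have b': "\<bar>- R' n i\<bar> \<le> C" if "i \<in> steps n" for n i using b[OF that] by simp
  have low: "\<forall>\<^sub>F n in sequentially. (\<Sum>i\<in>steps n. - R' n i * m n i) < (LINT u:{0<..T}|\<mu>. - H u) + e"
    if "e > 0" for e by (rule tagged_sums_upper(2)) (fact b' l' that)+
  show int: "set_integrable \<mu> {0<..T} H" by (rule tagged_sums_upper(1)) (fact b l)+
  have "(\<lambda>n. \<Sum>i\<in>steps n. R' n i * m n i) \<longlonglongrightarrow> (LINT u:{0<..T}|\<mu>. H u)"
  proof (rule LIMSEQ_I)
    fix e :: real assume e: "e > 0"
    have "\<forall>\<^sub>F n in sequentially. (\<Sum>i\<in>steps n. - R' n i * m n i) < (LINT u:{0<..T}|\<mu>. - H u) + e"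
      by (rule low[OF e])
    with up[OF e] have "\<forall>\<^sub>F n in sequentially. norm ((\<Sum>i\<in>steps n. R' n i * m n i) - (LINT u:{0<..T}|\<mu>. H u)) < e"
    proof eventually_elim
      case (elim n)
      then show ?case by (simp add: sum_negf set_lebesgue_integral_def abs_less_iff)
    qed
    then show "\<exists>no. \<forall>n\<ge>no. norm ((\<Sum>i\<in>steps n. R' n i * m n i) - (LINT u:{0<..T}|\<mu>. H u)) < e"
      by (simp add: eventually_sequentially)
  qed
  moreover have "\<forall>\<^sub>F n in sequentially. (\<Sum>i\<in>steps n. R' n i * m n i) = (\<Sum>i\<in>steps n. R n i * m n i)"
    using R' by eventually_elim simp
  ultimately show "(\<lambda>n. \<Sum>i\<in>steps n. R n i * m n i) \<longlonglongrightarrow> (LINT u:{0<..T}|\<mu>. H u)"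
    by (rule Lim_transform_eventually)
qed

end

section \<open>Quadratic variation\<close>

lemma (in finite_measure) has_sum_atoms:
  assumes "countable X" "\<And>s. s \<in> X \<Longrightarrow> {s} \<in> sets M"
  shows "((\<lambda>s. measure M {s}) has_sum measure M X) X"
proof -
  have fin: "(\<integral>\<^sup>+s. ennreal (measure M {s}) \<partial>count_space X) = emeasure M X"
    using emeasure_countable_singleton[OF assms(2,1)] by (simp add: emeasure_eq_measure)
  have abs: "(\<lambda>s. measure M {s}) summable_on X"
  proof (rule nonneg_bdd_above_summable_on)
    show "bdd_above (sum (\<lambda>s. measure M {s}) ` {F. F \<subseteq> X \<and> finite F})"
    proof (rule bdd_aboveI2)
      fix F assume F: "F \<in> {F. F \<subseteq> X \<and> finite F}"
      then have "(\<Sum>s\<in>F. measure M {s}) = measure M F"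
        using assms(2) by (intro finite_measure_eq_sum_singleton[symmetric]) auto
      then show "(\<Sum>s\<in>F. measure M {s}) \<le> measure M (space M)" by (simp add: bounded_measure)
    qed
  qed simp
  have "infsetsum (\<lambda>s. measure M {s}) X = enn2real (emeasure M X)"
    using infsetsum_conv_nn_integral[of X "\<lambda>s. measure M {s}"] fin by simp
  moreover have "Infinite_Set_Sum.abs_summable_on (\<lambda>s. measure M {s}) X"
    using abs by (subst abs_summable_equivalent[symmetric]) simp
  ultimately have "infsum (\<lambda>s. measure M {s}) X = measure M X"
    by (simp add: infsetsum_infsum measure_def)
  then show ?thesis using has_sum_infsum[OF abs] by simp
qed

text \<open>Recovers a single term of a sum from the sums over intervals shrinking to it from the
  left.\<close>

lemma infsum_left_shrink:
  fixes g :: "real \<Rightarrow> real"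
  assumes g: "g summable_on {0<..u}" "\<And>s. 0 \<le> g s" and u: "0 < u"
  shows "(\<lambda>n. infsum g {u - u / (real n + 1)<..u}) \<longlonglongrightarrow> g u"
proof -
  define r where "r n = u - u / (real n + 1)" for n
  have r: "0 \<le> r n" "r n < u" for n using u by (auto simp: r_def field_simps)
  have rlim: "r \<longlonglongrightarrow> u - 0"
    unfolding r_def using LIMSEQ_Suc[OF lim_const_over_n[of u]]
    by (intro tendsto_diff tendsto_const) (simp add: add.commute)
  have "(\<lambda>n. infsum (\<lambda>s. if r n < s then g s else 0) {0<..u}) \<longlonglongrightarrow> infsum (\<lambda>s. if s = u then g s else 0) {0<..u}"
  proof (rule infsum_dominated_convergence(2)[OF g(1)])
    fix s assume s: "s \<in> {0<..u}"
    show "(\<lambda>n. if r n < s then g s else 0) \<longlonglongrightarrow> (if s = u then g s else 0)"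
    proof (cases "s = u")
      case True
      then show ?thesis using r by simp
    next
      case False
      then have "s < u" using s by simp
      then have "\<forall>\<^sub>F n in sequentially. s < r n" using order_tendstoD(1)[OF rlim] by simp
      then have "\<forall>\<^sub>F n in sequentially. (if r n < s then g s else 0) = 0" by eventually_elim simp
      then show ?thesis using False by (simp add: tendsto_eventually)
    qed
  qed (use g(2) in simp)
  also have "infsum (\<lambda>s. if s = u then g s else 0) {0<..u} = infsum g {u}"
    by (rule infsum_cong_neutral) (use u in auto)
  also have "(\<lambda>n. infsum (\<lambda>s. if r n < s then g s else 0) {0<..u}) = (\<lambda>n. infsum g {r n<..u})"
    by (intro ext infsum_cong_neutral) (use r in \<open>auto intro: le_less_trans\<close>)
  finally show ?thesis by (simp add: r_def)
qed

lemma interval_measure_unique: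
  assumes N: "finite_borel_measure N" and G: "\<And>t. G t = measure N {..t}"
  shows "interval_measure G = N"
proof -
  interpret finite_borel_measure N by fact
  have Gc: "G = cdf N" by (simp add: fun_eq_iff G cdf_def2)
  have Ioc: "emeasure (interval_measure G) {a<..b} = emeasure N {a<..b}" for a b
  proof (cases "a \<le> b")
    case True
    then have "emeasure (interval_measure G) {a<..b} = G b - G a"
      by (intro emeasure_interval_measure_Ioc) (auto simp: Gc cdf_nondecreasing cdf_is_right_cont)
    then show ?thesis using emeasure_Ioc[OF True] by (simp add: Gc)
  qed simp
  show ?thesis
  proof (rule measure_eqI_generator_eq[where \<Omega> = UNIV])
    show "(\<Union>i. {- real (i::nat)<..real i}) = UNIV" by (rule UN_Ioc_eq_UNIV)
    show "emeasure (interval_measure G) {- real i<..real i} \<noteq> \<infinity>" for i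
      by (simp add: Ioc emeasure_eq_measure)
  qed (auto simp: Ioc M_is_borel borel_sigma_sets_Ioc Int_stable_def)
qed

section \<open>Sums over subdivision points as integrals and series\<close>

context partition_sequence
begin

lemma discrete_qv_integral:
  assumes "continuous_on {0..T} \<phi>"
  shows "integral\<^sup>L (discrete_qv T p k f n) \<phi> = (\<Sum>i\<in>steps n. \<phi> (p n i) * (f (p n (Suc i)) - f (p n i))\<^sup>2)"
proof -
  have "integral\<^sup>L (discrete_qv T p k f n) \<phi>
      = integral\<^sup>L (point_measure {..<k n} (\<lambda>i. ennreal ((f (p n (Suc i)) - f (p n i))\<^sup>2))) (\<lambda>i. \<phi> (p n i))"
    unfolding discrete_qv_def
  proof (rule integral_distr)
    show "p n \<in> point_measure {..<k n} (\<lambda>i. ennreal ((f (p n (Suc i)) - f (p n i))\<^sup>2)) \<rightarrow>\<^sub>M restrict_space borel {0..T}"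
      using p_in by (auto simp: space_restrict_space Pi_iff simp del: atLeastAtMost_iff)
    show "\<phi> \<in> borel_measurable (restrict_space borel {0..T})"
      using assms by (rule borel_measurable_continuous_on_restrict)
  qed
  also have "\<dots> = (\<Sum>i<k n. \<phi> (p n i) * (f (p n (Suc i)) - f (p n i))\<^sup>2)"
    by (subst lebesgue_integral_point_measure_finite) (auto simp: mult.commute)
  also have "\<dots> = (\<Sum>i\<in>steps n. \<phi> (p n i) * (f (p n (Suc i)) - f (p n i))\<^sup>2)"
    by (rule sum_steps) simp
  finally show ?thesis .
qed

lemma sum_right_ends_le_infsum:
  fixes g :: "real \<Rightarrow> real"
  assumes "g summable_on {0<..T} - J" "\<And>s. 0 \<le> g s"
  shows "(\<Sum>i\<in>{i\<in>steps n. p n (Suc i) \<notin> J}. g (p n (Suc i))) \<le> infsum g ({0<..T} - J)"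
proof -
  let ?I = "{i\<in>steps n. p n (Suc i) \<notin> J}"
  have "inj_on (\<lambda>i. p n (Suc i)) ?I" using inj_on_right_end[of n] by (rule inj_on_subset) auto
  then have "(\<Sum>i\<in>?I. g (p n (Suc i))) = sum g ((\<lambda>i. p n (Suc i)) ` ?I)"
    by (simp add: sum.reindex)
  also have "\<dots> \<le> infsum g ({0<..T} - J)"
    using assms stepsD(4,5)[of _ n] by (intro finite_sum_le_infsum) auto
  finally show ?thesis .
qed

text \<open>Moves the dependence on \<open>n\<close> from the index set into the summand, as
  dominated convergence over the fixed set ]0,T] requires.\<close>

lemma sum_right_ends_as_infsum:
  fixes g :: "real \<Rightarrow> real"
  shows "(\<Sum>i\<in>steps n. g (p n (Suc i))) = infsum (\<lambda>s. if \<exists>i\<in>steps n. p n (Suc i) = s then g s else 0) {0<..T}"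
proof -
  let ?E = "(\<lambda>i. p n (Suc i)) ` steps n"
  have "(\<Sum>i\<in>steps n. g (p n (Suc i))) = sum g ?E"
    using inj_on_right_end[of n] by (simp add: sum.reindex)
  also have "\<dots> = infsum g ?E" by simp
  also have "\<dots> = infsum (\<lambda>s. if \<exists>i\<in>steps n. p n (Suc i) = s then g s else 0) {0<..T}"
    using stepsD(4,5)[of _ n] by (intro infsum_cong_neutral) auto
  finally show ?thesis .
qed

text \<open>All but a small part of the sum of squares of \<open>D\<close> is carried by a finite
  set \<open>J\<close>. On \<open>J\<close> the uniform smallness of \<open>d\<close> suffices; off
  \<open>J\<close> a weighted inequality of arithmetic and geometric means pairs the bounded sum of
  squares of \<open>d\<close> with the small tail.\<close>

lemma cross_terms_vanish:
  fixes d :: "nat \<Rightarrow> nat \<Rightarrow> real" and D :: "real \<Rightarrow> real"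
  assumes D: "(\<lambda>s. (D s)\<^sup>2) summable_on {0<..T}"
    and d_small: "\<And>e. e > 0 \<Longrightarrow> \<forall>\<^sub>F n in sequentially. \<forall>i\<in>steps n. \<bar>d n i\<bar> \<le> e"
    and d_bounded: "\<forall>\<^sub>F n in sequentially. (\<Sum>i\<in>steps n. (d n i)\<^sup>2) \<le> K"
  shows "(\<lambda>n. \<Sum>i\<in>steps n. \<bar>d n i\<bar> * \<bar>D (p n (Suc i))\<bar>) \<longlonglongrightarrow> 0"
proof (rule LIMSEQ_I)
  fix \<epsilon> :: real assume \<epsilon>: "\<epsilon> > 0"
  \<comment> \<open>With this weight the squares of \<open>d\<close> contribute at most
    \<epsilon>/3. The tail of the squares of \<open>D\<close> is then taken below
    \<open>a * \<epsilon> / 3\<close>, since it gets divided by \<open>a\<close>. The summand 1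
    guards against \<open>K = 0\<close>.\<close>
  define a where "a = \<epsilon> / (3 * (\<bar>K\<bar> + 1))"
  have a: "a > 0" "a * K \<le> \<epsilon> / 3"
  proof -
    show "a > 0" using \<epsilon> by (simp add: a_def)
    have "a * K \<le> a * (\<bar>K\<bar> + 1)" using \<open>a > 0\<close> by (intro mult_left_mono) auto
    also have "\<dots> = \<epsilon> / 3" by (simp add: a_def field_simps)
    finally show "a * K \<le> \<epsilon> / 3" .
  qed
  let ?g = "\<lambda>s. (D s)\<^sup>2"
  have "a * \<epsilon> / 3 > 0" using a \<epsilon> by simp
  from tendstoD[OF has_sum_infsum[OF D, unfolded has_sum_def] this]
  obtain J where J: "finite J" "J \<subseteq> {0<..T}" "dist (sum ?g J) (infsum ?g {0<..T}) < a * \<epsilon> / 3"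
    unfolding eventually_finite_subsets_at_top by blast
  have gJ: "?g summable_on {0<..T} - J" using D by (rule summable_on_subset_banach) auto
  have "infsum ?g ({0<..T} - J) = infsum ?g {0<..T} - sum ?g J"
    using infsum_Diff[OF D _ J(2)] J(1) by simp
  then have rest: "infsum ?g ({0<..T} - J) \<le> a * \<epsilon> / 3" using J(3) unfolding dist_real_def by linarith
  \<comment> \<open>The factor 4 instead of 3 makes the estimate on \<open>J\<close> strict, and the
    summand 1 covers a vanishing sum.\<close>
  define e where "e = \<epsilon> / (4 * (sum (\<lambda>s. \<bar>D s\<bar>) J + 1))"
  have sJ: "0 \<le> sum (\<lambda>s. \<bar>D s\<bar>) J" by (rule sum_nonneg) simp
  have "0 < \<epsilon> / (4 * (q + 1))" if "0 \<le> q" for q using \<epsilon> that by simp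
  from this[OF sJ] have e: "e > 0" by (simp only: e_def)
  have eJ: "e * sum (\<lambda>s. \<bar>D s\<bar>) J < \<epsilon> / 3"
  proof -
    have "e * sum (\<lambda>s. \<bar>D s\<bar>) J \<le> e * (sum (\<lambda>s. \<bar>D s\<bar>) J + 1)" using e by (intro mult_left_mono) auto
    also have "\<dots> = \<epsilon> / 4"
    proof -
      have *: "\<epsilon> / (4 * y) * y = \<epsilon> / 4" if "y \<noteq> 0" for y using that by simp
      have "0 \<le> q \<Longrightarrow> q + 1 \<noteq> 0" for q :: real by simp
      from *[OF this[OF sJ]] show ?thesis unfolding e_def .
    qed
    finally show ?thesis using \<epsilon> by simp
  qed
  have "\<forall>\<^sub>F n in sequentially. norm ((\<Sum>i\<in>steps n. \<bar>d n i\<bar> * \<bar>D (p n (Suc i))\<bar>) - 0) < \<epsilon>"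
    using d_small[OF e] d_bounded
  proof eventually_elim
    case (elim n)
    let ?I = "{i\<in>steps n. p n (Suc i) \<in> J}" and ?I' = "{i\<in>steps n. p n (Suc i) \<notin> J}"
    have split: "(\<Sum>i\<in>steps n. f i) = (\<Sum>i\<in>?I. f i) + (\<Sum>i\<in>?I'. f i)" for f :: "nat \<Rightarrow> real"
      by (subst sum.union_disjoint[symmetric]) (auto intro!: sum.cong)
    have "(\<Sum>i\<in>?I. \<bar>d n i\<bar> * \<bar>D (p n (Suc i))\<bar>) \<le> (\<Sum>i\<in>?I. e * \<bar>D (p n (Suc i))\<bar>)"
      using elim(1) by (intro sum_mono mult_right_mono) auto
    also have "\<dots> = e * sum (\<lambda>s. \<bar>D s\<bar>) ((\<lambda>i. p n (Suc i)) ` ?I)"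
      using inj_on_subset[OF inj_on_right_end, of ?I n] by (simp add: sum.reindex sum_distrib_left)
    also have "\<dots> \<le> e * sum (\<lambda>s. \<bar>D s\<bar>) J"
      using e J(1) by (intro mult_left_mono sum_mono2) auto
    finally have 1: "(\<Sum>i\<in>?I. \<bar>d n i\<bar> * \<bar>D (p n (Suc i))\<bar>) < \<epsilon> / 3" using eJ by simp
    have am_gm: "\<bar>y\<bar> * \<bar>z\<bar> \<le> a * y\<^sup>2 + z\<^sup>2 / a" for y z :: real
    proof -
      have "0 \<le> (a * \<bar>y\<bar> - \<bar>z\<bar>)\<^sup>2 / a + \<bar>y\<bar> * \<bar>z\<bar>" using a by simp
      also have "\<dots> = a * y\<^sup>2 + z\<^sup>2 / a - \<bar>y\<bar> * \<bar>z\<bar>"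
        using a by (simp add: power2_eq_square field_simps)
      finally show ?thesis by simp
    qed
    have "(\<Sum>i\<in>?I'. \<bar>d n i\<bar> * \<bar>D (p n (Suc i))\<bar>) \<le> (\<Sum>i\<in>?I'. a * (d n i)\<^sup>2 + (D (p n (Suc i)))\<^sup>2 / a)"
      by (intro sum_mono am_gm)
    also have "\<dots> = a * (\<Sum>i\<in>?I'. (d n i)\<^sup>2) + (\<Sum>i\<in>?I'. (D (p n (Suc i)))\<^sup>2) / a"
      by (simp add: sum.distrib sum_distrib_left sum_divide_distrib)
    also have "\<dots> \<le> a * K + (a * \<epsilon> / 3) / a"
    proof (intro add_mono mult_left_mono divide_right_mono)
      have "(\<Sum>i\<in>?I'. (d n i)\<^sup>2) \<le> (\<Sum>i\<in>steps n. (d n i)\<^sup>2)" by (rule sum_mono2) auto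
      then show "(\<Sum>i\<in>?I'. (d n i)\<^sup>2) \<le> K" using elim(2) by simp
      show "(\<Sum>i\<in>?I'. (D (p n (Suc i)))\<^sup>2) \<le> a * \<epsilon> / 3"
        using sum_right_ends_le_infsum[OF gJ, of n] rest by simp
    qed (use a in auto)
    also have "\<dots> \<le> 2 * \<epsilon> / 3" using a by simp
    finally have 2: "(\<Sum>i\<in>?I'. \<bar>d n i\<bar> * \<bar>D (p n (Suc i))\<bar>) \<le> 2 * \<epsilon> / 3" .
    have "0 \<le> (\<Sum>i\<in>steps n. \<bar>d n i\<bar> * \<bar>D (p n (Suc i))\<bar>)" by (rule sum_nonneg) simp
    then show ?case using 1 2 split[of "\<lambda>i. \<bar>d n i\<bar> * \<bar>D (p n (Suc i))\<bar>"] by simp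
  qed
  then show "\<exists>no. \<forall>n\<ge>no. norm ((\<Sum>i\<in>steps n. \<bar>d n i\<bar> * \<bar>D (p n (Suc i))\<bar>) - 0) < \<epsilon>"
    by (simp add: eventually_sequentially)
qed

end

text \<open>\<open>L\<close> will be a coordinate or a sum of two coordinates, the scalar paths
  whose quadratic variation is given.\<close>

locale qv_component = approximated_paths T p k U S x v
  for T p k and U :: "'a::real_normed_vector set" and S :: "'b::real_normed_vector set" and x v +
  fixes L :: "'a \<Rightarrow> real" and M
  assumes L: "bounded_linear L" and M: "qv_measure T p k (\<lambda>t. L (x t)) M"
begin

sublocale L: bounded_linear L by (rule L)
sublocale M: finite_measure M using M by (simp add: qv_measure_def)

abbreviation f :: "real \<Rightarrow> real" where "f \<equiv> \<lambda>t. L (x t)"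

lemma sets_M: "A \<in> sets M \<longleftrightarrow> A \<in> sets borel \<and> A \<subseteq> {0..T}"
  using M by (simp add: qv_measure_def sets_restrict_space_iff conj_commute)

lemma space_M: "space M = {0..T}"
  using M sets_eq_imp_space_eq[of M "restrict_space borel {0..T}"] by (simp add: qv_measure_def space_restrict_space)

lemma jump_f: "s \<in> {0..T} \<Longrightarrow> jump f s = L (jump x s)"
  by (rule jump_bounded_linear(2)[OF x_cadlag _ L])

lemma vague_limit:
  assumes "continuous_on {0..T} \<phi>"
  shows "(\<lambda>n. \<Sum>i\<in>steps n. \<phi> (p n i) * (f (p n (Suc i)) - f (p n i))\<^sup>2) \<longlonglongrightarrow> integral\<^sup>L M \<phi>"
  using M assms discrete_qv_integral[OF assms, of f] by (auto simp: qv_measure_def)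

definition At :: "real set" where "At = {s. measure M {s} \<noteq> 0}"

lemma At_subset: "At \<subseteq> {0..T}"
proof
  fix s assume "s \<in> At"
  then have "{s} \<in> sets M" unfolding At_def using measure_notin_sets by blast
  then show "s \<in> {0..T}" by (simp add: sets_M)
qed

lemma countable_At: "countable At"
  unfolding At_def by (rule M.countable_support)

lemma At_sets: "X \<inter> At \<in> sets M"
  using At_subset countable_subset[OF _ countable_At, of "X \<inter> At"] sets.countable[of "X \<inter> At" borel]
  by (auto simp: sets_M)

lemma infsum_atoms:
  assumes "A \<subseteq> {0..T}"
  shows "((\<lambda>s. measure M {s}) has_sum measure M (A \<inter> At)) A"
proof -
  have "((\<lambda>s. measure M {s}) has_sum measure M (A \<inter> At)) (A \<inter> At)"
    using countable_At At_subset by (intro M.has_sum_atoms countable_Int2) (auto simp: sets_M)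
  then show ?thesis
    by (rule has_sum_cong_neutral[THEN iffD1, rotated -1]) (auto simp: At_def)
qed

lemma jumps_has_sum:
  assumes "t \<in> {0..T}"
  shows "((\<lambda>s. (jump f s)\<^sup>2) has_sum measure M ({0..t} \<inter> At)) {0<..t}"
proof -
  have "((\<lambda>s. (jump f s)\<^sup>2) has_sum (measure M {0..t} - cont_part M t)) {0<..t}"
    using M assms by (simp add: qv_measure_def)
  moreover have "infsum (\<lambda>s. measure M {s}) {0..t} = measure M ({0..t} \<inter> At)"
    using assms by (intro infsumI infsum_atoms) auto
  ultimately show ?thesis by (simp add: cont_part_def)
qed

text \<open>At time 0 the sum of squared jumps is empty, which forces the atom there to
  vanish.\<close>

lemma atom_0: "measure M {0} = 0"
proof -
  have "((\<lambda>s. (jump f s)\<^sup>2) has_sum measure M ({0} \<inter> At)) {}"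
    using jumps_has_sum[of 0] T_pos by simp
  then have "measure M ({0} \<inter> At) = 0" using has_sum_unique has_sum_empty by blast
  then show ?thesis by (cases "0 \<in> At") (auto simp: At_def)
qed

text \<open>The definition of quadratic variation equates only sums over intervals starting at 0.
  Differences give equality on ]r,s], and letting \<open>r\<close> increase to \<open>s\<close>
  isolates the two terms.\<close>

lemma atom_eq_jump:
  assumes "s \<in> {0<..T}"
  shows "measure M {s} = (jump f s)\<^sup>2"
proof -
  define r where "r n = s - s / (real n + 1)" for n
  have r: "0 \<le> r n" "r n < s" for n using assms by (auto simp: r_def field_simps)
  let ?a = "\<lambda>s. (jump f s)\<^sup>2" and ?b = "\<lambda>s. measure M {s}"
  have sum: "?a summable_on {0<..t}" "?b summable_on {0..t}" "infsum ?a {0<..t} = infsum ?b {0..t}"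
    if "t \<in> {0..T}" for t
    using jumps_has_sum[OF that] infsum_atoms[of "{0..t}"] that
    by (auto simp: has_sum_imp_summable infsumI)
  have sT: "s \<in> {0..T}" using assms by auto
  have "infsum ?a {r n<..s} = infsum ?b {r n<..s}" for n
  proof -
    have rT: "r n \<in> {0..T}" using r[of n] sT by auto
    have "infsum ?a ({0<..s} - {0<..r n}) = infsum ?a {0<..s} - infsum ?a {0<..r n}"
      using sum[OF sT] sum[OF rT] r[of n] by (intro infsum_Diff) auto
    moreover have "infsum ?b ({0..s} - {0..r n}) = infsum ?b {0..s} - infsum ?b {0..r n}"
      using sum[OF sT] sum[OF rT] r[of n] by (intro infsum_Diff) auto
    moreover have "{0<..s} - {0<..r n} = {r n<..s}" "{0..s} - {0..r n} = {r n<..s}" using r[of n] by auto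
    ultimately show ?thesis using sum(3)[OF sT] sum(3)[OF rT] by simp
  qed
  moreover have "(\<lambda>n. infsum ?a {r n<..s}) \<longlonglongrightarrow> ?a s"
    unfolding r_def using sum(1)[OF sT] assms by (intro infsum_left_shrink) auto
  moreover have "?b summable_on {0<..s}"
    by (rule summable_on_subset_banach[OF sum(2)[OF sT]]) auto
  then have "(\<lambda>n. infsum ?b {r n<..s}) \<longlonglongrightarrow> ?b s"
    unfolding r_def using assms by (intro infsum_left_shrink) auto
  ultimately show ?thesis using LIMSEQ_unique by fastforce
qed

lemma jumps_summable: "(\<lambda>s. (L (jump x s))\<^sup>2) summable_on {0<..T}"
proof -
  have "(\<lambda>s. (jump f s)\<^sup>2) summable_on {0<..T}"
    using jumps_has_sum[of T] T_pos has_sum_imp_summable by auto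
  then show ?thesis by (rule summable_on_cong[THEN iffD1, rotated]) (simp add: jump_f)
qed

text \<open>The atomless part of \<open>M\<close>, carried from [0,T] to the whole line, where the
  Stieltjes measure of \<open>cont_part\<close> lives.\<close>

definition \<mu> :: "real measure" where
  "\<mu> = distr (restrict_space M ({0..T} - At)) borel (\<lambda>s. s)"

lemma id_measurable: "(\<lambda>s. s) \<in> restrict_space M ({0..T} - At) \<rightarrow>\<^sub>M borel"
proof -
  have "(\<lambda>s. s) \<in> M \<rightarrow>\<^sub>M borel"
    by (rule measurableI) (auto simp: sets_M space_M Int_commute intro!: sets.Int)
  then show ?thesis by (rule measurable_restrict_space1)
qed

lemma cont_set: "{0..T} - At \<in> sets M" "({0..T} - At) \<inter> space M \<in> sets M"
proof -
  have "space M - UNIV \<inter> At \<in> sets M" using At_sets[of UNIV] by (rule sets.compl_sets)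
  then show *: "{0..T} - At \<in> sets M" by (simp add: space_M)
  have "({0..T} - At) \<inter> space M = {0..T} - At" by (auto simp: space_M)
  with * show "({0..T} - At) \<inter> space M \<in> sets M" by simp
qed

lemma sets_\<mu>: "sets \<mu> = sets borel"
  by (simp add: \<mu>_def)

lemma emeasure_\<mu>:
  assumes "B \<in> sets borel"
  shows "emeasure \<mu> B = emeasure M (B \<inter> ({0..T} - At))"
proof -
  have "emeasure \<mu> B = emeasure (restrict_space M ({0..T} - At)) (B \<inter> ({0..T} - At))"
    unfolding \<mu>_def using assms id_measurable
    by (subst emeasure_distr) (auto simp: space_restrict_space space_M intro!: arg_cong2[where f = emeasure])
  also have "\<dots> = emeasure M (B \<inter> ({0..T} - At))"
    by (rule emeasure_restrict_space[OF cont_set(2)]) auto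
  finally show ?thesis .
qed

lemma finite_\<mu>: "finite_measure \<mu>"
proof (rule finite_measureI)
  have "emeasure \<mu> (space \<mu>) = emeasure M (UNIV \<inter> ({0..T} - At))"
    using emeasure_\<mu>[of UNIV] sets_eq_imp_space_eq[OF sets_\<mu>] by simp
  then show "emeasure \<mu> (space \<mu>) \<noteq> \<infinity>" by (simp add: M.emeasure_eq_measure)
qed

lemma measure_singleton_off_atoms: "measure M ({s} \<inter> ({0..T} - At)) = 0"
proof (cases "s \<in> {0..T} - At")
  case True
  then have "{s} \<inter> ({0..T} - At) = {s}" "measure M {s} = 0" by (auto simp: At_def)
  then show ?thesis by simp
next
  case False
  then have "{s} \<inter> ({0..T} - At) = {}" by auto
  then show ?thesis by simp
qed

lemma atomless_\<mu>: "emeasure \<mu> {s} = 0"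
  using measure_singleton_off_atoms[of s] by (simp add: emeasure_\<mu> M.emeasure_eq_measure)

text \<open>The clamped argument matches the constant extension in \<open>dqv_cont\<close>; for
  negative \<open>t\<close> both sides vanish because 0 has no mass off the atoms.\<close>

lemma measure_\<mu>_atMost: "measure \<mu> {..t} = cont_part M (max 0 (min T t))"
proof -
  define s where "s = max 0 (min T t)"
  have s: "s \<in> {0..T}" using T_pos by (auto simp: s_def)
  have "{0..s} \<inter> ({0..T} - At) = {0..s} - {0..s} \<inter> At" using s by auto
  then have "measure M ({0..s} \<inter> ({0..T} - At)) = measure M {0..s} - measure M ({0..s} \<inter> At)"
    using s At_sets by (auto simp: sets_M intro!: M.finite_measure_Diff)
  also have "measure M ({0..s} \<inter> At) = infsum (\<lambda>s. measure M {s}) {0..s}"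
    using s by (intro infsumI[symmetric] infsum_atoms) auto
  finally have 1: "measure M ({0..s} \<inter> ({0..T} - At)) = cont_part M s" by (simp add: cont_part_def)
  have 2: "measure \<mu> {..t} = measure M ({..t} \<inter> ({0..T} - At))"
    by (simp add: measure_def emeasure_\<mu>)
  show ?thesis
  proof (cases "0 \<le> t")
    case True
    then have "{..t} \<inter> ({0..T} - At) = {0..s} \<inter> ({0..T} - At)" by (auto simp: s_def)
    then show ?thesis using 1 2 by (simp add: s_def)
  next
    case False
    then have e: "{..t} \<inter> ({0..T} - At) = {}" "s = 0" by (auto simp: s_def)
    have "measure M ({0..0} \<inter> ({0..T} - At)) = 0"
      using measure_singleton_off_atoms[of 0] by simp
    then show ?thesis using 1 2 e by (simp add: s_def)
  qed
qed

lemma interval_measure_cont_part: "interval_measure (\<lambda>t. cont_part M (max 0 (min T t))) = \<mu>"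
  using finite_\<mu> sets_\<mu>
  by (intro interval_measure_unique) (auto simp: measure_\<mu>_atMost finite_borel_measure_def finite_borel_measure_axioms_def)

lemma integral_\<mu>:
  fixes \<phi> :: "real \<Rightarrow> real"
  assumes "continuous_on {0..T} \<phi>"
  shows "(LINT s:{0<..T}|\<mu>. \<phi> s) = (LINT s:{0..T} - At|M. \<phi> s)"
proof -
  have "continuous_on {0<..T} \<phi>" using assms by (rule continuous_on_subset) auto
  then have meas: "(\<lambda>s. indicator {0<..T} s *\<^sub>R \<phi> s) \<in> borel_measurable borel"
    by (intro borel_measurable_continuous_on_indicator) auto
  have "(LINT s:{0<..T}|\<mu>. \<phi> s) = integral\<^sup>L (restrict_space M ({0..T} - At)) (\<lambda>s. indicator {0<..T} s *\<^sub>R \<phi> s)"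
    unfolding set_lebesgue_integral_def \<mu>_def by (rule integral_distr[OF id_measurable meas])
  also have "\<dots> = (LINT s:{0..T} - At|M. indicator {0<..T} s *\<^sub>R \<phi> s)"
    unfolding set_lebesgue_integral_def by (rule integral_restrict_space[OF cont_set(2)])
  also have "\<dots> = (LINT s:{0..T} - At|M. \<phi> s)"
    unfolding set_lebesgue_integral_def
  proof (rule integral_discrete_difference[of "{0}"])
    fix s assume "s \<in> {0::real}"
    then show "emeasure M {s} = 0" using atom_0 by (simp add: M.emeasure_eq_measure)
    show "{s} \<in> sets M" using \<open>s \<in> {0}\<close> T_pos by (simp add: sets_M)
  qed (auto simp: space_M indicator_def)
  finally show ?thesis .
qed

lemma continuous_bounded:
  fixes \<phi> :: "real \<Rightarrow> real"
  assumes "continuous_on {0..T} \<phi>"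
  obtains B where "B > 0" "\<And>s. s \<in> {0..T} \<Longrightarrow> \<bar>\<phi> s\<bar> \<le> B"
proof -
  have "bounded (\<phi> ` {0..T})" by (intro compact_imp_bounded compact_continuous_image assms compact_Icc)
  then obtain B where "B > 0" "\<forall>y\<in>\<phi> ` {0..T}. norm y \<le> B" unfolding bounded_pos by blast
  then show ?thesis by (intro that[of B]) auto
qed

text \<open>Jumps sit at right ends of steps, but \<phi> is evaluated at left ends. Reading the sum
  as the \<open>M\<close>-integral of a function on the atoms, dominated convergence applies: every
  atom is eventually a right end, and then \<phi> at the left end approaches its value at the
  atom.\<close>

lemma jump_part_limit:
  assumes \<phi>: "continuous_on {0..T} \<phi>"
  shows "(\<lambda>n. \<Sum>i\<in>steps n. \<phi> (p n i) * (L (jump x (p n (Suc i))))\<^sup>2) \<longlonglongrightarrow> (LINT s:At|M. \<phi> s)"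
proof -
  obtain B where B: "B > 0" "\<And>s. s \<in> {0..T} \<Longrightarrow> \<bar>\<phi> s\<bar> \<le> B" using continuous_bounded[OF \<phi>] by metis
  define \<psi> where "\<psi> n s = (\<Sum>i\<in>steps n. \<phi> (p n i) * indicator ({p n (Suc i)} \<inter> At) s)" for n s
  have \<psi>_eq: "\<psi> n s = \<phi> (p n i)" if "i \<in> steps n" "p n (Suc i) = s" "s \<in> At" for n s i
  proof -
    have "\<psi> n s = (\<Sum>j\<in>steps n. if j = i then \<phi> (p n i) else 0)"
      unfolding \<psi>_def using that inj_on_right_end[of n]
      by (intro sum.cong) (auto simp: indicator_def inj_on_def)
    then show ?thesis using that by simp
  qed
  have \<psi>_0: "\<psi> n s = 0" if "s \<notin> At \<or> (\<forall>i\<in>steps n. p n (Suc i) \<noteq> s)" for n s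
    unfolding \<psi>_def using that by (intro sum.neutral) (auto simp: indicator_def)
  have int: "integral\<^sup>L M (\<psi> n) = (\<Sum>i\<in>steps n. \<phi> (p n i) * (L (jump x (p n (Suc i))))\<^sup>2)" for n
  proof -
    have "integral\<^sup>L M (\<psi> n) = (\<Sum>i\<in>steps n. \<phi> (p n i) * measure M ({p n (Suc i)} \<inter> At))"
    proof -
      have "X \<inter> At \<inter> {0..T} = X \<inter> At" for X using At_subset by auto
      then show ?thesis
        unfolding \<psi>_def using At_sets
        by (subst Bochner_Integration.integral_sum) (auto simp: space_M M.emeasure_eq_measure)
    qed
    also have "\<dots> = (\<Sum>i\<in>steps n. \<phi> (p n i) * (L (jump x (p n (Suc i))))\<^sup>2)"
    proof (intro sum.cong refl)
      fix i assume i: "i \<in> steps n"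
      let ?s = "p n (Suc i)"
      have s: "?s \<in> {0<..T}" "?s \<in> {0..T}" using stepsD[OF i] by auto
      have "measure M ({?s} \<inter> At) = measure M {?s}" by (cases "?s \<in> At") (auto simp: At_def)
      then show "\<phi> (p n i) * measure M ({?s} \<inter> At) = \<phi> (p n i) * (L (jump x ?s))\<^sup>2"
        using atom_eq_jump[OF s(1)] jump_f[OF s(2)] by simp
    qed
    finally show ?thesis .
  qed
  have lim: "(\<lambda>n. \<psi> n s) \<longlonglongrightarrow> indicator At s *\<^sub>R \<phi> s" for s
  proof (cases "s \<in> At")
    case False
    then show ?thesis by (simp add: \<psi>_0)
  next
    case True
    then have s: "s \<in> {0..T}" "s \<noteq> 0" using At_subset atom_0 by (auto simp: At_def)
    then have "jump f s \<noteq> 0" using atom_eq_jump[of s] True by (auto simp: At_def)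
    then have "jump x s \<noteq> 0" using jump_f[OF s(1)] L.zero by auto
    then have ev: "\<forall>\<^sub>F n in sequentially. \<exists>i\<in>steps n. p n (Suc i) = s"
      using jump_time_is_point[OF s(1)] by blast
    have "(\<lambda>n. \<psi> n s) \<longlonglongrightarrow> \<phi> s"
    proof (rule LIMSEQ_I)
      fix e :: real assume e: "e > 0"
      obtain d where d: "d > 0" "\<And>t. t \<in> {0..T} \<Longrightarrow> dist t s < d \<Longrightarrow> dist (\<phi> t) (\<phi> s) < e"
        using \<phi> s(1) e unfolding continuous_on_iff by blast
      have "\<forall>\<^sub>F n in sequentially. norm (\<psi> n s - \<phi> s) < e"
        using ev mesh_small[OF d(1)]
      proof eventually_elim
        case (elim n)
        then obtain i where i: "i \<in> steps n" "p n (Suc i) = s" by auto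
        have "dist (p n i) s < d" "p n i \<in> {0..T}"
          using elim(2) i stepsD[OF i(1)] by (auto simp: dist_real_def)
        then have "dist (\<phi> (p n i)) (\<phi> s) < e" using d(2) by blast
        then show ?case using \<psi>_eq[OF i True] by (simp add: dist_norm)
      qed
      then show "\<exists>no. \<forall>n\<ge>no. norm (\<psi> n s - \<phi> s) < e" by (simp add: eventually_sequentially)
    qed
    then show ?thesis using True by simp
  qed
  have meas: "\<psi> n \<in> borel_measurable M" for n
    unfolding \<psi>_def using At_sets by (intro borel_measurable_sum borel_measurable_times borel_measurable_indicator) auto
  have meas': "(\<lambda>s. indicator At s *\<^sub>R \<phi> s) \<in> borel_measurable M"
    by (rule borel_measurable_LIMSEQ_metric[OF meas lim])
  have bnd: "norm (\<psi> n s) \<le> B" for n s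
  proof (cases "s \<notin> At \<or> (\<forall>i\<in>steps n. p n (Suc i) \<noteq> s)")
    case True
    then show ?thesis using \<psi>_0[OF True] B by simp
  next
    case False
    then obtain i where i: "i \<in> steps n" "p n (Suc i) = s" "s \<in> At" by auto
    show ?thesis using \<psi>_eq[OF i] B(2)[of "p n i"] stepsD[OF i(1)] by simp
  qed
  have "(\<lambda>n. integral\<^sup>L M (\<psi> n)) \<longlonglongrightarrow> (LINT s|M. indicator At s *\<^sub>R \<phi> s)"
    by (rule integral_dominated_convergence[OF meas' meas _ AE_I2[OF lim] AE_I2[OF bnd]]) simp
  then show ?thesis by (simp add: int set_lebesgue_integral_def)
qed

lemma gap_small:
  assumes "e > 0"
  shows "\<forall>\<^sub>F n in sequentially. \<forall>i\<in>steps n. \<bar>L (left_lim x (p n (Suc i)) - x (p n i))\<bar> \<le> e"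
proof -
  obtain K where K: "K > 0" "\<And>y. norm (L y) \<le> norm y * K" using L.pos_bounded by blast
  have "e / K > 0" using assms K by simp
  from left_gap_small[OF this] show ?thesis
  proof eventually_elim
    case (elim n)
    show ?case
    proof
      fix i assume "i \<in> steps n"
      then have "norm (left_lim x (p n (Suc i)) - x (p n i)) * K \<le> e / K * K"
        using elim K by (intro mult_right_mono) auto
      then show "\<bar>L (left_lim x (p n (Suc i)) - x (p n i))\<bar> \<le> e"
        using K(2)[of "left_lim x (p n (Suc i)) - x (p n i)"] K(1) by simp
    qed
  qed
qed

lemma increment_split:
  "f (p n (Suc i)) - f (p n i) = L (left_lim x (p n (Suc i)) - x (p n i)) + L (jump x (p n (Suc i)))"
  by (simp add: L.diff jump_def)

text \<open>The test function 1 bounds the squared increments, and summability bounds the squared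
  jumps; a gap is an increment minus a jump.\<close>

lemma gap_squares_bounded:
  "\<exists>K. \<forall>\<^sub>F n in sequentially. (\<Sum>i\<in>steps n. (L (left_lim x (p n (Suc i)) - x (p n i)))\<^sup>2) \<le> K"
proof -
  let ?K1 = "integral\<^sup>L M (\<lambda>_. 1) + 1" and ?K2 = "infsum (\<lambda>s. (L (jump x s))\<^sup>2) {0<..T}"
  have "\<forall>\<^sub>F n in sequentially. (\<Sum>i\<in>steps n. 1 * (f (p n (Suc i)) - f (p n i))\<^sup>2) < ?K1"
    by (rule order_tendstoD(2)[OF vague_limit]) (auto intro: continuous_intros)
  then have "\<forall>\<^sub>F n in sequentially. (\<Sum>i\<in>steps n. (L (left_lim x (p n (Suc i)) - x (p n i)))\<^sup>2) \<le> 2 * ?K1 + 2 * ?K2"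
  proof eventually_elim
    case (elim n)
    have "(\<Sum>i\<in>steps n. (L (left_lim x (p n (Suc i)) - x (p n i)))\<^sup>2)
      \<le> (\<Sum>i\<in>steps n. 2 * (f (p n (Suc i)) - f (p n i))\<^sup>2 + 2 * (L (jump x (p n (Suc i))))\<^sup>2)"
    proof (rule sum_mono)
      fix i
      have sq: "a\<^sup>2 \<le> 2 * (a + b)\<^sup>2 + 2 * b\<^sup>2" for a b :: real
        using zero_le_power2[of "a + 2 * b"] by (simp add: power2_eq_square algebra_simps)
      show "(L (left_lim x (p n (Suc i)) - x (p n i)))\<^sup>2
        \<le> 2 * (f (p n (Suc i)) - f (p n i))\<^sup>2 + 2 * (L (jump x (p n (Suc i))))\<^sup>2"
        unfolding increment_split by (rule sq)
    qed
    also have "\<dots> = 2 * (\<Sum>i\<in>steps n. (f (p n (Suc i)) - f (p n i))\<^sup>2) + 2 * (\<Sum>i\<in>steps n. (L (jump x (p n (Suc i))))\<^sup>2)"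
      by (simp add: sum.distrib sum_distrib_left)
    also have "\<dots> \<le> 2 * ?K1 + 2 * ?K2"
      using elim sum_right_ends_le_infsum[of "\<lambda>s. (L (jump x s))\<^sup>2" "{}" n] jumps_summable
      by (intro add_mono mult_left_mono) auto
    finally show ?case .
  qed
  then show ?thesis by blast
qed

text \<open>An increment is a gap plus a jump. In its square the mixed term vanishes in the limit
  and the squared jumps exhaust the atoms, so the atomless part is left for the gaps.\<close>

lemma gap_squares_limit:
  assumes \<phi>: "continuous_on {0..T} \<phi>"
  shows "(\<lambda>n. \<Sum>i\<in>steps n. \<phi> (p n i) * (L (left_lim x (p n (Suc i)) - x (p n i)))\<^sup>2)
    \<longlonglongrightarrow> (LINT s:{0<..T}|\<mu>. \<phi> s)"
proof -
  let ?d = "\<lambda>n i. L (left_lim x (p n (Suc i)) - x (p n i))" and ?D = "\<lambda>s. L (jump x s)"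
  obtain B where B: "B > 0" "\<And>s. s \<in> {0..T} \<Longrightarrow> \<bar>\<phi> s\<bar> \<le> B" using continuous_bounded[OF \<phi>] by metis
  obtain K where K: "\<forall>\<^sub>F n in sequentially. (\<Sum>i\<in>steps n. (?d n i)\<^sup>2) \<le> K"
    using gap_squares_bounded by blast
  have "(\<lambda>n. B * (\<Sum>i\<in>steps n. \<bar>?d n i\<bar> * \<bar>?D (p n (Suc i))\<bar>)) \<longlonglongrightarrow> B * 0"
    by (intro tendsto_mult tendsto_const cross_terms_vanish[OF jumps_summable gap_small K])
  then have "(\<lambda>n. B * (\<Sum>i\<in>steps n. \<bar>?d n i\<bar> * \<bar>?D (p n (Suc i))\<bar>)) \<longlonglongrightarrow> 0" by simp
  then have cross: "(\<lambda>n. \<Sum>i\<in>steps n. \<phi> (p n i) * (?d n i * ?D (p n (Suc i)))) \<longlonglongrightarrow> 0"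
  proof (rule Lim_null_comparison[rotated], intro always_eventually allI)
    fix n
    have "norm (\<Sum>i\<in>steps n. \<phi> (p n i) * (?d n i * ?D (p n (Suc i))))
      \<le> (\<Sum>i\<in>steps n. B * (\<bar>?d n i\<bar> * \<bar>?D (p n (Suc i))\<bar>))"
    proof (rule sum_norm_le)
      fix i assume "i \<in> steps n"
      then have "\<bar>\<phi> (p n i)\<bar> \<le> B" using B(2) stepsD[of i n] by auto
      then show "norm (\<phi> (p n i) * (?d n i * ?D (p n (Suc i)))) \<le> B * (\<bar>?d n i\<bar> * \<bar>?D (p n (Suc i))\<bar>)"
        by (simp add: abs_mult mult_right_mono)
    qed
    then show "norm (\<Sum>i\<in>steps n. \<phi> (p n i) * (?d n i * ?D (p n (Suc i))))
      \<le> B * (\<Sum>i\<in>steps n. \<bar>?d n i\<bar> * \<bar>?D (p n (Suc i))\<bar>)" by (simp add: sum_distrib_left)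
  qed
  have "(\<lambda>n. (\<Sum>i\<in>steps n. \<phi> (p n i) * (f (p n (Suc i)) - f (p n i))\<^sup>2)
      - 2 * (\<Sum>i\<in>steps n. \<phi> (p n i) * (?d n i * ?D (p n (Suc i))))
      - (\<Sum>i\<in>steps n. \<phi> (p n i) * (?D (p n (Suc i)))\<^sup>2)) \<longlonglongrightarrow> integral\<^sup>L M \<phi> - 2 * 0 - (LINT s:At|M. \<phi> s)"
    by (intro tendsto_diff tendsto_mult tendsto_const vague_limit[OF \<phi>] cross jump_part_limit[OF \<phi>])
  moreover have "(\<Sum>i\<in>steps n. \<phi> (p n i) * (f (p n (Suc i)) - f (p n i))\<^sup>2)
      - 2 * (\<Sum>i\<in>steps n. \<phi> (p n i) * (?d n i * ?D (p n (Suc i))))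
      - (\<Sum>i\<in>steps n. \<phi> (p n i) * (?D (p n (Suc i)))\<^sup>2) = (\<Sum>i\<in>steps n. \<phi> (p n i) * (?d n i)\<^sup>2)" for n
    unfolding increment_split sum_distrib_left sum_subtractf[symmetric]
    by (intro sum.cong refl) (simp add: power2_eq_square algebra_simps)
  moreover have "integral\<^sup>L M \<phi> = (LINT s:At|M. \<phi> s) + (LINT s:{0..T} - At|M. \<phi> s)"
  proof -
    have "\<phi> \<in> borel_measurable (restrict_space borel {0..T})"
      using \<phi> by (rule borel_measurable_continuous_on_restrict)
    then have "\<phi> \<in> borel_measurable M"
      using M by (simp add: qv_measure_def cong: measurable_cong_sets)
    then have int: "integrable M \<phi>"
      by (rule M.integrable_const_bound[rotated, of _ B]) (use B(2) in \<open>auto simp: space_M intro!: AE_I2\<close>)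
    have At: "At \<in> sets M" using At_sets[of UNIV] by simp
    have "integral\<^sup>L M \<phi> = (LINT s:At \<union> ({0..T} - At)|M. \<phi> s)"
      unfolding set_lebesgue_integral_def
      by (rule Bochner_Integration.integral_cong) (auto simp: space_M indicator_def)
    also have "\<dots> = (LINT s:At|M. \<phi> s) + (LINT s:{0..T} - At|M. \<phi> s)"
      using At cont_set(1) by (intro set_integral_Un)
        (auto simp: set_integrable_def simp del: real_scaleR_def intro!: integrable_mult_indicator int)
    finally show ?thesis .
  qed
  ultimately show ?thesis by (simp add: integral_\<mu>[OF \<phi>])
qed

sublocale tagged_weights T p k \<mu> "\<lambda>n i. (L (left_lim x (p n (Suc i)) - x (p n i)))\<^sup>2"
  by (intro tagged_weights.intro tagged_weights_axioms.intro partition_sequence_axioms finite_\<mu> sets_\<mu>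
      atomless_\<mu> gap_squares_limit) auto

end

section \<open>The change of variable formula\<close>

lemma finite_superlevel:
  fixes g :: "'i \<Rightarrow> real"
  assumes g: "g summable_on A" "\<And>a. a \<in> A \<Longrightarrow> 0 \<le> g a" and c: "c > 0"
  shows "finite {a \<in> A. c < g a}"
proof (rule ccontr)
  assume "infinite {a \<in> A. c < g a}"
  moreover obtain N where N: "infsum g A / c < real N" using reals_Archimedean2 by blast
  ultimately obtain B where B: "finite B" "card B = N" "B \<subseteq> {a \<in> A. c < g a}"
    using infinite_arbitrarily_large by metis
  have "real N * c = (\<Sum>a\<in>B. c)" using B by simp
  also have "\<dots> \<le> sum g B" using B by (intro sum_mono) (auto intro: less_imp_le)
  also have "\<dots> \<le> infsum g A" using B g by (intro finite_sum_le_infsum) auto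
  finally show False using N c by (simp add: field_simps)
qed

text \<open>This is the case \<open>h = 0\<close>. It supplies continuity of the gradient also at
  time \<open>T\<close>, where \<open>C12\<close> speaks of \<open>F\<close> alone.\<close>

lemma left_continuous_imp_fixed_times:
  assumes "left_continuous_functional I U S G" "I \<subseteq> {0..}"
  shows "continuous_fixed_times I U S G"
  unfolding continuous_fixed_times_def
proof (intro ballI allI impI)
  fix t z w and \<epsilon> :: real
  assume a: "t \<in> I" "z \<in> cadlag t U" "w \<in> cadlag t S" "\<epsilon> > 0"
  then obtain \<eta> where \<eta>: "\<eta> > 0" "\<And>h z' w'. h \<in> {0..t} \<Longrightarrow> z' \<in> cadlag (t - h) U \<Longrightarrow> w' \<in> cadlag (t - h) S \<Longrightarrow>
      dinf t z w (t - h) z' w' < \<eta> \<Longrightarrow> norm (G t z w - G (t - h) z' w') < \<epsilon>"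
    using assms(1) unfolding left_continuous_functional_def by metis
  show "\<exists>\<eta>>0. \<forall>z'\<in>cadlag t U. \<forall>w'\<in>cadlag t S. dinf t z w t z' w' < \<eta> \<longrightarrow> norm (G t z w - G t z' w') < \<epsilon>"
    using \<eta>(1) \<eta>(2)[of 0] a(1) assms(2) by (intro exI[of _ \<eta>]) auto
qed

locale ito_setting = approximated_paths T p k U S x v
  for T p k and U :: "(real ^ 'd::finite) set" and S :: "(real ^ 'm::finite) set" and x v +
  fixes F :: "('d, 'm, real) functional"
  assumes open_U: "open U"
    and has_qv: "has_qv T p k x"
    and C12: "C12 T U S F"
    and predictable: "predictable_second T U S F"
    and twice_diff: "twice_vert_differentiable_on {0..T} U S F"
    and bounded_vhess: "locally_bounded_functional T {0..T} U S (vhess F)"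
    and bounded_hderiv: "locally_bounded_functional T {0..<T} U S (hderiv F)"
    and lc_F: "left_continuous_functional {0..T} U S F"
    and lc_vgrad: "left_continuous_functional {0..T} U S (vgrad F)"
    and lc_vhess: "left_continuous_functional {0..T} U S (vhess F)"
    and lip_vgrad: "horizontally_locally_lipschitz T U S (vgrad F)"
begin

abbreviation \<delta> :: "nat \<Rightarrow> nat \<Rightarrow> real ^ 'd" where
  "\<delta> n i \<equiv> left_lim x (p n (Suc i)) - x (p n i)"

abbreviation Xa :: "nat \<Rightarrow> real \<Rightarrow> real ^ 'd \<Rightarrow> real \<Rightarrow> real ^ 'd" where
  "Xa n t a \<equiv> stop (xn n) t a"

abbreviation V :: "nat \<Rightarrow> real \<Rightarrow> real \<Rightarrow> real ^ 'm" where
  "V n t \<equiv> stop (vn n) t (vn n t)"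

text \<open>By predictability the evaluations of the functional, its gradient and its Hessian at
  stage \<open>n\<close> take this form, with only the time and the endpoint of the first path
  varying.\<close>

abbreviation "Fa n t a \<equiv> F t (Xa n t a) (V n t)"
abbreviation "Ga n t a \<equiv> vgrad F t (Xa n t a) (V n t)"
abbreviation "Ha n t a \<equiv> vhess F t (Xa n t a) (V n t)"

lemma V_cadlag: "t \<in> {0..T} \<Longrightarrow> V n t \<in> cadlag t S"
  by (rule restrict_cadlag[OF vn_cadlag]) auto

lemma Xa_cadlag: "t \<in> {0..T} \<Longrightarrow> a \<in> U \<Longrightarrow> Xa n t a \<in> cadlag t U"
  by (rule stop_cadlag[OF xn_cadlag]) auto

lemma x_in: "t \<in> {0..T} \<Longrightarrow> x t \<in> U" and left_lim_x_in: "t \<in> {0..T} \<Longrightarrow> left_lim x t \<in> U"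
  using cadlag_value[OF x_cadlag] cadlag_left_lim_in[OF x_cadlag] by auto

lemma pts:
  assumes "i \<in> steps n"
  shows "p n i \<in> {0..T}" "p n (Suc i) \<in> {0..T}" "p n (Suc i) \<in> {0<..T}"
  using stepsD[OF assms] by auto

text \<open>A horizontal step ends with the second path at v^n(t-), the next one starts from v^n(t);
  this identifies the two evaluations.\<close>

lemma V_predictable:
  assumes "predictable_second T U S G" "t \<in> {0..T}" "y \<in> cadlag t U"
  shows "G t y (stop (vn n) t (left_lim (vn n) t)) = G t y (V n t)"
proof -
  have "G t y (V n t) = G t y (left_path (V n t) t)"
    using assms V_cadlag[OF assms(2)] unfolding predictable_second_def by blast
  then show ?thesis using left_path_restrict[of t "vn n"] assms(2) by simp
qed

lemma v_predictable:
  assumes "predictable_second T U S G" "t \<in> {0..T}" "y \<in> cadlag t U"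
  shows "G t y (stop v t (left_lim v t)) = G t y (stop v t (v t))"
proof -
  have "stop v t (v t) \<in> cadlag t S" using assms(2) by (intro restrict_cadlag[OF v_cadlag]) auto
  then have "G t y (stop v t (v t)) = G t y (left_path (stop v t (v t)) t)"
    using assms unfolding predictable_second_def by blast
  then show ?thesis using left_path_restrict[of t v] assms(2) by simp
qed

text \<open>The step paths converge uniformly, so only the endpoint has to be controlled; it may
  vary with \<open>n\<close>, as left limits of x^n do.\<close>

lemma fixed_time_limit:
  assumes G: "continuous_fixed_times I U S G" and t: "t \<in> I" "t \<in> {0..T}"
    and a: "a \<in> U" "\<And>n. b n \<in> U" "b \<longlonglongrightarrow> a"
  shows "(\<lambda>n. G t (Xa n t (b n)) (V n t)) \<longlonglongrightarrow> G t (stop x t a) (stop v t (v t))"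
proof (rule tendstoI)
  fix \<epsilon> :: real assume "\<epsilon> > 0"
  have z: "stop x t a \<in> cadlag t U" and w: "stop v t (v t) \<in> cadlag t S"
    using t a stop_cadlag[OF x_cadlag] restrict_cadlag[OF v_cadlag] by auto
  have "0 \<le> t" using t by simp
  obtain \<eta> where \<eta>: "\<eta> > 0"
    "\<And>z' w'. \<lbrakk>z' \<in> cadlag t U; w' \<in> cadlag t S;
      \<And>u. 0 \<le> u \<Longrightarrow> u \<le> t \<Longrightarrow> norm (stop x t a u - z' u) \<le> \<eta>;
      \<And>u. 0 \<le> u \<Longrightarrow> u \<le> t \<Longrightarrow> norm (stop v t (v t) u - w' u) \<le> \<eta>\<rbrakk> \<Longrightarrow>
      norm (G t (stop x t a) (stop v t (v t)) - G t z' w') < \<epsilon>"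
    by (rule continuous_fixed_timesD[OF G t(1) \<open>0 \<le> t\<close> z w \<open>\<epsilon> > 0\<close>]) blast
  from uniform_approximation[OF \<eta>(1)] tendstoD[OF a(3) \<eta>(1)]
  show "\<forall>\<^sub>F n in sequentially. dist (G t (Xa n t (b n)) (V n t)) (G t (stop x t a) (stop v t (v t))) < \<epsilon>"
  proof eventually_elim
    case (elim n)
    have "norm (G t (stop x t a) (stop v t (v t)) - G t (Xa n t (b n)) (V n t)) < \<epsilon>"
    proof (rule \<eta>(2))
      fix u assume u: "0 \<le> u" "u \<le> t"
      then have "u \<in> {0..T}" using t by auto
      then have "norm (x u - xn n u) \<le> \<eta>" "norm (v u - vn n u) \<le> \<eta>"
        using elim(1) by (auto simp: norm_minus_commute)
      then show "norm (stop x t a u - Xa n t (b n) u) \<le> \<eta>" "norm (stop v t (v t) u - V n t u) \<le> \<eta>"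
        using elim(2) u by (cases "u = t"; auto simp: dist_norm norm_minus_commute less_imp_le)+
    qed (use t a V_cadlag Xa_cadlag in auto)
    then show ?case by (simp add: dist_norm norm_minus_commute)
  qed
qed

text \<open>One \<open>C\<close> and one \<eta> for all local conditions around the given pair. For
  large \<open>n\<close> the step paths lie in that neighbourhood, and the endpoint remains free
  within \<eta> of \<open>x t\<close>, as the intermediate points of the expansions require.\<close>

lemma near_bounds:
  obtains C \<eta> where "C > 0" "\<eta> > 0" "\<And>t a. t \<in> {0..T} \<Longrightarrow> norm (a - x t) \<le> \<eta> \<Longrightarrow> a \<in> U"
    "\<forall>\<^sub>F n in sequentially. \<forall>t\<in>{0..T}. \<forall>a. norm (a - x t) \<le> \<eta> \<longrightarrow> norm (Ha n t a) \<le> C"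
    "\<forall>\<^sub>F n in sequentially. \<forall>t\<in>{0..<T}. norm (hderiv F t (Xa n t (xn n t)) (V n t)) \<le> C"
    "\<forall>\<^sub>F n in sequentially. \<forall>t1 t2. 0 \<le> t1 \<longrightarrow> t1 < t2 \<longrightarrow> t2 \<le> T \<longrightarrow>
      norm (vgrad F t2 (hext (Xa n t1 (xn n t1)) t1 (t2 - t1)) (hext (V n t1) t1 (t2 - t1))
        - Ga n t1 (xn n t1)) \<le> C * (t2 - t1)"
proof -
  obtain \<rho> where \<rho>: "\<rho> > 0" "\<And>s. s \<in> {0..T} \<Longrightarrow> cball (x s) \<rho> \<subseteq> U"
    using cadlag_cball_subset[OF x_cadlag open_U] by metis
  obtain C1 e1 where 1: "C1 > 0" "e1 > 0"
    "\<And>t z w. \<lbrakk>t \<in> {0..T}; 0 \<le> t; z \<in> cadlag t U; w \<in> cadlag t S;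
      \<And>u. 0 \<le> u \<Longrightarrow> u \<le> t \<Longrightarrow> norm (x u - z u) \<le> e1;
      \<And>u. 0 \<le> u \<Longrightarrow> u \<le> t \<Longrightarrow> norm (v u - w u) \<le> e1\<rbrakk> \<Longrightarrow> norm (vhess F t z w) \<le> C1"
    by (rule locally_bounded_functionalD[OF bounded_vhess x_cadlag v_cadlag]) blast
  obtain C2 e2 where 2: "C2 > 0" "e2 > 0"
    "\<And>t z w. \<lbrakk>t \<in> {0..<T}; 0 \<le> t; z \<in> cadlag t U; w \<in> cadlag t S;
      \<And>u. 0 \<le> u \<Longrightarrow> u \<le> t \<Longrightarrow> norm (x u - z u) \<le> e2;
      \<And>u. 0 \<le> u \<Longrightarrow> u \<le> t \<Longrightarrow> norm (v u - w u) \<le> e2\<rbrakk> \<Longrightarrow> norm (hderiv F t z w) \<le> C2"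
    by (rule locally_bounded_functionalD[OF bounded_hderiv x_cadlag v_cadlag]) blast
  obtain C3 e3 where 3: "C3 > 0" "e3 > 0"
    "\<And>t1 t2 z w. \<lbrakk>0 \<le> t1; t1 < t2; t2 \<le> T; z \<in> cadlag t1 U; w \<in> cadlag t1 S;
      \<And>u. 0 \<le> u \<Longrightarrow> u \<le> t1 \<Longrightarrow> norm (x u - z u) \<le> e3;
      \<And>u. 0 \<le> u \<Longrightarrow> u \<le> t1 \<Longrightarrow> norm (v u - w u) \<le> e3\<rbrakk> \<Longrightarrow>
      norm (vgrad F t2 (hext z t1 (t2 - t1)) (hext w t1 (t2 - t1)) - vgrad F t1 z w) \<le> C3 * (t2 - t1)"
    by (rule horizontally_locally_lipschitzD[OF lip_vgrad x_cadlag v_cadlag]) blast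
  define \<eta> where "\<eta> = min \<rho> (min e1 (min e2 e3))"
  define C where "C = max C1 (max C2 C3)"
  have \<eta>: "\<eta> > 0" "\<eta> \<le> \<rho>" "\<eta> \<le> e1" "\<eta> \<le> e2" "\<eta> \<le> e3" using \<rho> 1 2 3 by (auto simp: \<eta>_def)
  have C: "C > 0" "C1 \<le> C" "C2 \<le> C" "C3 \<le> C" using 1 by (auto simp: C_def)
  have inU: "a \<in> U" if "t \<in> {0..T}" "norm (a - x t) \<le> \<eta>" for t a
    using \<rho>(2)[OF that(1)] that(2) \<eta>(2) by (auto simp: dist_norm norm_minus_commute subset_iff)
  have near: "norm (x u - Xa n t a u) \<le> \<eta>" "norm (v u - V n t u) \<le> \<eta>"
    if "\<forall>t\<in>{0..T}. norm (xn n t - x t) \<le> \<eta> \<and> norm (vn n t - v t) \<le> \<eta>" "t \<in> {0..T}" "norm (a - x t) \<le> \<eta>" "0 \<le> u" "u \<le> t"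
    for n t a u
  proof -
    have "u \<in> {0..T}" using that by auto
    then have "norm (x u - xn n u) \<le> \<eta>" "norm (v u - vn n u) \<le> \<eta>"
      using that(1) by (auto simp: norm_minus_commute)
    then show "norm (x u - Xa n t a u) \<le> \<eta>" "norm (v u - V n t u) \<le> \<eta>"
      using that by (cases "u = t"; auto simp: norm_minus_commute)+
  qed
  show ?thesis
  proof (rule that[OF C(1) \<eta>(1) inU])
    show "\<forall>\<^sub>F n in sequentially. \<forall>t\<in>{0..T}. \<forall>a. norm (a - x t) \<le> \<eta> \<longrightarrow> norm (Ha n t a) \<le> C"
      using uniform_approximation[OF \<eta>(1)]
    proof eventually_elim
      case (elim n)
      show ?case
      proof (intro ballI allI impI)
        fix t a assume t: "t \<in> {0..T}" "norm (a - x t) \<le> \<eta>"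
        have "norm (Ha n t a) \<le> C1"
          using t near[OF elim t] \<eta> inU[OF t] by (intro 1(3) V_cadlag Xa_cadlag) (auto intro: order_trans)
        then show "norm (Ha n t a) \<le> C" using C by simp
      qed
    qed
    show "\<forall>\<^sub>F n in sequentially. \<forall>t\<in>{0..<T}. norm (hderiv F t (Xa n t (xn n t)) (V n t)) \<le> C"
      using uniform_approximation[OF \<eta>(1)]
    proof eventually_elim
      case (elim n)
      show ?case
      proof
        fix t assume t0: "t \<in> {0..<T}"
        then have t: "t \<in> {0..T}" "norm (xn n t - x t) \<le> \<eta>" using elim by auto
        have "norm (hderiv F t (Xa n t (xn n t)) (V n t)) \<le> C2"
          using t t0 near[OF elim t] \<eta> inU[OF t] by (intro 2(3) V_cadlag Xa_cadlag) (auto intro: order_trans)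
        then show "norm (hderiv F t (Xa n t (xn n t)) (V n t)) \<le> C" using C by simp
      qed
    qed
    show "\<forall>\<^sub>F n in sequentially. \<forall>t1 t2. 0 \<le> t1 \<longrightarrow> t1 < t2 \<longrightarrow> t2 \<le> T \<longrightarrow>
      norm (vgrad F t2 (hext (Xa n t1 (xn n t1)) t1 (t2 - t1)) (hext (V n t1) t1 (t2 - t1))
        - Ga n t1 (xn n t1)) \<le> C * (t2 - t1)"
      using uniform_approximation[OF \<eta>(1)]
    proof eventually_elim
      case (elim n)
      show ?case
      proof (intro allI impI)
        fix t1 t2 assume t12: "0 \<le> t1" "t1 < t2" "t2 \<le> T"
        then have t: "t1 \<in> {0..T}" "norm (xn n t1 - x t1) \<le> \<eta>" using elim by auto
        have "norm (vgrad F t2 (hext (Xa n t1 (xn n t1)) t1 (t2 - t1)) (hext (V n t1) t1 (t2 - t1))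
            - Ga n t1 (xn n t1)) \<le> C3 * (t2 - t1)"
          using t12 t near[OF elim t] \<eta> inU[OF t] by (intro 3(3) V_cadlag Xa_cadlag) (auto intro: order_trans)
        also have "\<dots> \<le> C * (t2 - t1)" using C t12 by (intro mult_right_mono) auto
        finally show "norm (vgrad F t2 (hext (Xa n t1 (xn n t1)) t1 (t2 - t1)) (hext (V n t1) t1 (t2 - t1))
            - Ga n t1 (xn n t1)) \<le> C * (t2 - t1)" .
      qed
    qed
  qed
qed

text \<open>The step paths are constant on the step, so a horizontal extension follows them up to
  the right end, where the endpoint keeps the step value.\<close>

lemma hext_X:
  assumes "i \<in> steps n" "p n i \<le> s" "s < p n (Suc i)" "0 \<le> h" "s + h \<le> p n (Suc i)"
  shows "hext (Xa n s (xn n s)) s h = Xa n (s + h) (left_lim x (p n (Suc i)))"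
    "hext (V n s) s h = stop (vn n) (s + h) (v (p n i))"
proof -
  have "0 \<le> s" using assms stepsD[OF assms(1)] by simp
  then show "hext (Xa n s (xn n s)) s h = Xa n (s + h) (left_lim x (p n (Suc i)))"
    "hext (V n s) s h = stop (vn n) (s + h) (v (p n i))"
    using assms xn_eq[OF assms(1)] vn_eq[OF assms(1)] by (simp_all add: hext_stop)
qed

lemma left_lim_vn:
  assumes "i \<in> steps n"
  shows "left_lim (vn n) (p n (Suc i)) = v (p n i)"
proof -
  have "eventually (\<lambda>t. vn n t = v (p n i)) (at_left (p n (Suc i)))"
    using stepsD[OF assms] vn_eq[OF assms]
    by (auto simp: eventually_at_left_field intro!: exI[of _ "p n i"])
  then have "(vn n \<longlongrightarrow> v (p n i)) (at_left (p n (Suc i)))" by (rule tendsto_eventually)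
  then show ?thesis by (rule left_lim_eqI) (rule stepsD[OF assms])
qed

end

section \<open>The horizontal part\<close>

context ito_setting
begin

text \<open>
  On a subdivision interval the approximating paths are constant, so \<open>F\<close> along them has right
  derivative \<open>hderiv F\<close> everywhere; it is left-continuous by assumption.
\<close>

lemma horizontal_step:
  assumes i: "i \<in> steps n"
    and bound: "\<forall>t\<in>{0..<T}. norm (hderiv F t (Xa n t (xn n t)) (V n t)) \<le> C"
  shows "set_integrable lborel {p n i..<p n (Suc i)} (\<lambda>s. hderiv F s (Xa n s (xn n s)) (V n s))"
    and "(LINT s:{p n i..<p n (Suc i)}|lborel. hderiv F s (Xa n s (xn n s)) (V n s))
      = Fa n (p n (Suc i)) (left_lim x (p n (Suc i)))
        - Fa n (p n i) (xn n (p n i))"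
proof -
  let ?t = "p n i" and ?t' = "p n (Suc i)"
  \<comment> \<open>Both endpoints are frozen at the step values, so that \<psi> stays continuous up
    to the right end, where x^n and v^n may already have moved on.\<close>
  define \<psi> where "\<psi> s = F s (Xa n s (left_lim x ?t')) (stop (vn n) s (v ?t))" for s
  note iD = stepsD[OF i] and xe = xn_eq[OF i] and ve = vn_eq[OF i]
  have aU: "left_lim x ?t' \<in> U" using iD by (intro left_lim_x_in) auto
  have bS: "v ?t \<in> S" using iD cadlag_value[OF v_cadlag] by auto
  have \<psi>_eq: "\<psi> s = Fa n s (xn n s)" if "?t \<le> s" "s < ?t'" for s
    using xe[OF that] ve[OF that] by (simp add: \<psi>_def)
  have deriv: "((\<lambda>h. (\<psi> (s + h) - \<psi> s) / h) \<longlongrightarrow> hderiv F s (Xa n s (xn n s)) (V n s)) (at_right 0)"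
    if s: "?t \<le> s" "s < ?t'" for s
  proof -
    have sT: "s \<in> {0..<T}" "s \<in> {0..T}" using s iD by auto
    have "Xa n s (xn n s) \<in> cadlag s U" "V n s \<in> cadlag s S"
      using sT xe[OF s] aU by (auto intro!: Xa_cadlag V_cadlag)
    then have "\<exists>D. has_hderiv F s (Xa n s (xn n s)) (V n s) D"
      using C12 sT unfolding C12_def by blast
    from hderiv_works[OF this]
    have "((\<lambda>h. (F (s + h) (hext (Xa n s (xn n s)) s h) (hext (V n s) s h) - Fa n s (xn n s)) / h)
        \<longlongrightarrow> hderiv F s (Xa n s (xn n s)) (V n s)) (at_right 0)" by (simp add: has_hderiv_def)
    moreover have "\<forall>\<^sub>F h in at_right 0. (F (s + h) (hext (Xa n s (xn n s)) s h) (hext (V n s) s h)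
        - Fa n s (xn n s)) / h = (\<psi> (s + h) - \<psi> s) / h"
      using s hext_X[OF i s] \<psi>_eq[OF s] unfolding eventually_at_right_field
      by (intro exI[of _ "?t' - s"]) (auto simp: \<psi>_def)
    ultimately show ?thesis by (rule Lim_transform_eventually)
  qed
  have left_cont: "\<exists>d>0. \<forall>r. ?t \<le> r \<and> r \<le> s \<and> s - r < d \<longrightarrow> \<bar>\<psi> r - \<psi> s\<bar> < e"
    if s: "?t \<le> s" "s \<le> ?t'" and e: "e > 0" for s e
  proof -
    have sT: "s \<in> {0..T}" "0 \<le> s" using s iD by auto
    have z: "Xa n s (left_lim x ?t') \<in> cadlag s U" "stop (vn n) s (v ?t) \<in> cadlag s S"
      using sT aU bS by (auto intro!: Xa_cadlag stop_cadlag[OF vn_cadlag])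
    obtain \<eta> where \<eta>: "\<eta> > 0"
      "\<And>t1 z' w'. \<lbrakk>0 \<le> t1; t1 \<le> s; s - t1 \<le> \<eta>; z' \<in> cadlag t1 U; w' \<in> cadlag t1 S;
      \<And>u. 0 \<le> u \<Longrightarrow> u \<le> t1 \<Longrightarrow> norm (Xa n s (left_lim x ?t') u - z' u) \<le> \<eta>;
      \<And>u. t1 < u \<Longrightarrow> u \<le> s \<Longrightarrow> norm (Xa n s (left_lim x ?t') u - z' t1) \<le> \<eta>;
      \<And>u. 0 \<le> u \<Longrightarrow> u \<le> t1 \<Longrightarrow> norm (stop (vn n) s (v ?t) u - w' u) \<le> \<eta>;
      \<And>u. t1 < u \<Longrightarrow> u \<le> s \<Longrightarrow> norm (stop (vn n) s (v ?t) u - w' t1) \<le> \<eta>\<rbrakk>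
      \<Longrightarrow> norm (F s (Xa n s (left_lim x ?t')) (stop (vn n) s (v ?t)) - F t1 z' w') < e"
      by (rule left_continuous_functionalD[OF lc_F sT z e]) blast
    have "\<bar>\<psi> r - \<psi> s\<bar> < e" if r: "?t \<le> r" "r \<le> s" "s - r < \<eta>" for r
    proof -
      have rT: "r \<in> {0..T}" "0 \<le> r" "r \<le> T" using r sT iD by auto
      have x1: "Xa n s (left_lim x ?t') u = Xa n r (left_lim x ?t') u" if "0 \<le> u" "u \<le> r" for u
        using that r s xe[of u] by (cases "u = r"; cases "u = s") auto
      have v1: "stop (vn n) s (v ?t) u = stop (vn n) r (v ?t) u" if "0 \<le> u" "u \<le> r" for u
        using that r s ve[of u] by (cases "u = r"; cases "u = s") auto
      have x2: "Xa n s (left_lim x ?t') u = left_lim x ?t'" if "r < u" "u \<le> s" for u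
        using that r s rT xe[of u] by (cases "u = s") auto
      have v2: "stop (vn n) s (v ?t) u = v ?t" if "r < u" "u \<le> s" for u
        using that r s rT ve[of u] by (cases "u = s") auto
      have "norm (F s (Xa n s (left_lim x ?t')) (stop (vn n) s (v ?t)) - F r (Xa n r (left_lim x ?t')) (stop (vn n) r (v ?t))) < e"
        using r rT aU bS \<eta>(1)
        by (intro \<eta>(2)) (auto simp: x1 x2 v1 v2 intro!: Xa_cadlag stop_cadlag[OF vn_cadlag])
      then show ?thesis by (simp add: \<psi>_def abs_minus_commute)
    qed
    then show ?thesis using \<eta>(1) by blast
  qed
  have right_cont: "\<exists>d>0. \<forall>r. s \<le> r \<and> r \<le> ?t' \<and> r - s < d \<longrightarrow> \<bar>\<psi> r - \<psi> s\<bar> < e"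
    if s: "?t \<le> s" "s \<le> ?t'" and e: "e > 0" for s e
  proof (cases "s = ?t'")
    case True
    then show ?thesis using e by (intro exI[of _ 1]) auto
  next
    case False
    then have s': "s < ?t'" using s by simp
    \<comment> \<open>Right continuity follows from the right derivative: the increment is
      \<open>h\<close> times a convergent quotient.\<close>
    have "((\<lambda>h. h * ((\<psi> (s + h) - \<psi> s) / h)) \<longlongrightarrow> 0 * hderiv F s (Xa n s (xn n s)) (V n s)) (at_right 0)"
      by (intro tendsto_mult deriv[OF s(1) s'] tendsto_ident_at)
    then have "\<forall>\<^sub>F h in at_right 0. dist (h * ((\<psi> (s + h) - \<psi> s) / h)) 0 < e"
      using e by (intro tendstoD) simp_all
    then obtain d where d: "d > 0" "\<And>h. 0 < h \<Longrightarrow> h < d \<Longrightarrow> \<bar>h * ((\<psi> (s + h) - \<psi> s) / h)\<bar> < e"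
      by (auto simp: eventually_at_right_field)
    have "\<bar>\<psi> r - \<psi> s\<bar> < e" if "s \<le> r" "r - s < d" for r
      using d(2)[of "r - s"] that e by (cases "r = s") auto
    then show ?thesis using d(1) by blast
  qed
  have cont: "continuous_on {?t..?t'} \<psi>"
    unfolding continuous_on_iff
  proof (intro ballI allI impI)
    fix s e :: real assume s: "s \<in> {?t..?t'}" and e: "e > 0"
    then obtain d1 d2 where d: "d1 > 0" "d2 > 0"
      "\<And>r. ?t \<le> r \<Longrightarrow> r \<le> s \<Longrightarrow> s - r < d1 \<Longrightarrow> \<bar>\<psi> r - \<psi> s\<bar> < e"
      "\<And>r. s \<le> r \<Longrightarrow> r \<le> ?t' \<Longrightarrow> r - s < d2 \<Longrightarrow> \<bar>\<psi> r - \<psi> s\<bar> < e"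
      using left_cont[of s e] right_cont[of s e] by auto
    have "\<forall>r\<in>{?t..?t'}. dist r s < min d1 d2 \<longrightarrow> dist (\<psi> r) (\<psi> s) < e"
    proof (intro ballI impI)
      fix r assume "r \<in> {?t..?t'}" "dist r s < min d1 d2"
      then show "dist (\<psi> r) (\<psi> s) < e"
        using d(3)[of r] d(4)[of r] by (cases "r \<le> s") (auto simp: dist_real_def)
    qed
    then show "\<exists>d>0. \<forall>r\<in>{?t..?t'}. dist r s < d \<longrightarrow> dist (\<psi> r) (\<psi> s) < e"
      using d(1,2) by (intro exI[of _ "min d1 d2"]) auto
  qed
  have bound': "\<bar>hderiv F s (Xa n s (xn n s)) (V n s)\<bar> \<le> C" if "?t \<le> s" "s < ?t'" for s
    using bound that iD by auto
  have le: "?t \<le> ?t'" using iD by simp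
  \<comment> \<open>At the right end \<psi> carries the left limit of v^n; predictability replaces
    it by the value.\<close>
  have "\<psi> ?t' = Fa n ?t' (left_lim x ?t')"
    using V_predictable[OF predictable, of ?t' "Xa n ?t' (left_lim x ?t')" n] left_lim_vn[OF i] iD aU
    by (simp add: \<psi>_def Xa_cadlag)
  moreover have "\<psi> ?t = Fa n ?t (xn n ?t)" using \<psi>_eq[of ?t] iD by simp
  ultimately show "set_integrable lborel {?t..<?t'} (\<lambda>s. hderiv F s (Xa n s (xn n s)) (V n s))"
    "(LINT s:{?t..<?t'}|lborel. hderiv F s (Xa n s (xn n s)) (V n s))
      = Fa n ?t' (left_lim x ?t') - Fa n ?t (xn n ?t)"
    using right_derivative_FTC[OF le cont deriv bound'] by simp_all
qed

abbreviation DF :: "real \<Rightarrow> real" where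
  "DF u \<equiv> hderiv F u (left_path x u) (left_path v u)"

text \<open>The steps add up to the integral over [0,T[ of the horizontal derivative along the step
  paths, eventually bounded by a constant. The integrand converges at every interior time where
  neither \<open>x\<close> nor \<open>v\<close> jumps, since there path and left path coincide and
  continuity at fixed times applies.\<close>

lemma horizontal_limit:
  "set_integrable lborel {0<..T} DF"
  "(\<lambda>n. \<Sum>i\<in>steps n. Fa n (p n (Suc i)) (left_lim x (p n (Suc i)))
      - Fa n (p n i) (xn n (p n i))) \<longlonglongrightarrow> (LINT u:{0<..T}|lborel. DF u)"
proof -
  obtain C where "\<forall>\<^sub>F n in sequentially. \<forall>t\<in>{0..<T}. norm (hderiv F t (Xa n t (xn n t)) (V n t)) \<le> C"
    by (rule near_bounds) (rule that)
  then obtain N where N: "\<And>n. n \<ge> N \<Longrightarrow> \<forall>t\<in>{0..<T}. norm (hderiv F t (Xa n t (xn n t)) (V n t)) \<le> C"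
    by (auto simp: eventually_sequentially)
  define g where "g n u = hderiv F u (Xa n u (xn n u)) (V n u)" for n u
  \<comment> \<open>The bound holds from stage \<open>N\<close> on, so the sequence starts
    there.\<close>
  define f where "f n u = indicator {0..<T} u *\<^sub>R g (n + N) u" for n u
  have f_sum: "f n u = (\<Sum>i\<in>steps (n + N). indicator {p (n + N) i..<p (n + N) (Suc i)} u *\<^sub>R g (n + N) u)" for n u
  proof (cases "u \<in> {0..<T}")
    case True
    then obtain i where i: "i \<in> steps (n + N)" "p (n + N) i \<le> u" "u < p (n + N) (Suc i)"
      using step_at[of u "n + N"] by auto
    have "f n u = (\<Sum>i<k (n + N). indicator {p (n + N) i..<p (n + N) (Suc i)} u *\<^sub>R g (n + N) u)"
      using step_sum[OF i, of "\<lambda>_. g (n + N) u"] True by (simp add: f_def)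
    also have "\<dots> = (\<Sum>i\<in>steps (n + N). indicator {p (n + N) i..<p (n + N) (Suc i)} u *\<^sub>R g (n + N) u)"
      by (rule sum_steps) simp
    finally show ?thesis .
  next
    case False
    then have "u \<notin> {p (n + N) i..<p (n + N) (Suc i)}" if "i \<in> steps (n + N)" for i
      using stepsD[OF that] by auto
    then show ?thesis using False by (auto simp: f_def intro!: sum.neutral[symmetric])
  qed
  have step_int: "integrable lborel (\<lambda>u. indicator {p (n + N) i..<p (n + N) (Suc i)} u *\<^sub>R g (n + N) u)"
    "(LINT u|lborel. indicator {p (n + N) i..<p (n + N) (Suc i)} u *\<^sub>R g (n + N) u)
      = Fa (n + N) (p (n + N) (Suc i)) (left_lim x (p (n + N) (Suc i)))
      - Fa (n + N) (p (n + N) i) (xn (n + N) (p (n + N) i))"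
    if "i \<in> steps (n + N)" for n i
    using horizontal_step[OF that N[of "n + N"]] unfolding g_def set_integrable_def set_lebesgue_integral_def by auto
  have f_int: "integrable lborel (f n)" for n
    unfolding f_sum by (intro Bochner_Integration.integrable_sum step_int)
  have f_integral: "integral\<^sup>L lborel (f n) = (\<Sum>i\<in>steps (n + N).
      Fa (n + N) (p (n + N) (Suc i)) (left_lim x (p (n + N) (Suc i)))
      - Fa (n + N) (p (n + N) i) (xn (n + N) (p (n + N) i)))" for n
    unfolding f_sum by (subst Bochner_Integration.integral_sum) (auto simp: step_int simp del: real_scaleR_def)
  \<comment> \<open>The end points are included because the integrals run over
    [0,T[ along the sequence and over ]0,T] in the limit.\<close>
  define E where "E = {u \<in> {0..T}. jump x u \<noteq> 0} \<union> {u \<in> {0..T}. jump v u \<noteq> 0} \<union> {0, T}"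
  have E: "countable E"
    unfolding E_def using countable_jumps[OF x_cadlag] countable_jumps[OF v_cadlag] by auto
  have E_sets: "E \<in> sets lborel" using sets.countable[OF _ E, of borel] by simp
  have lim: "(\<lambda>n. if u \<in> E then 0 else f n u) \<longlonglongrightarrow> (if u \<in> E then 0 else indicator {0<..T} u *\<^sub>R DF u)" for u
  proof (cases "u \<in> {0<..<T} - E")
    case True
    then have u: "u \<in> {0..<T}" "u \<in> {0..T}" "jump x u = 0" "jump v u = 0" "u \<notin> E" by (auto simp: E_def)
    have cf: "continuous_fixed_times {0..<T} U S (hderiv F)" using C12 by (simp add: C12_def)
    have xlim: "(\<lambda>n. xn n u) \<longlonglongrightarrow> x u"
    proof (rule LIMSEQ_I)
      fix r :: real assume "0 < r"
      have "\<forall>\<^sub>F n in sequentially. norm (xn n u - x u) < r"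
        using uniform_approximation[OF half_gt_zero[OF \<open>0 < r\<close>]]
      proof eventually_elim
        case (elim n)
        then have "norm (xn n u - x u) \<le> r / 2" using u(2) by blast
        then show ?case using \<open>0 < r\<close> by linarith
      qed
      then show "\<exists>no. \<forall>n\<ge>no. norm (xn n u - x u) < r" by (simp add: eventually_sequentially)
    qed
    have "(\<lambda>n. g n u) \<longlonglongrightarrow> hderiv F u (stop x u (x u)) (stop v u (v u))"
      unfolding g_def using u xlim cadlag_value[OF xn_cadlag u(2)] x_in[OF u(2)]
      by (intro fixed_time_limit[OF cf]) auto
    moreover have "left_path x u = stop x u (x u)" "left_path v u = stop v u (v u)"
      using u(3,4) unfolding left_path_eq_stop jump_def by auto
    ultimately have "(\<lambda>n. g n u) \<longlonglongrightarrow> DF u" by simp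
    then have "(\<lambda>n. g (n + N) u) \<longlonglongrightarrow> DF u" by (rule LIMSEQ_ignore_initial_segment)
    then show ?thesis using u True by (simp add: f_def)
  next
    case False
    then show ?thesis by (cases "u \<in> E") (auto simp: f_def E_def indicator_def)
  qed
  have meas0: "(\<lambda>u. if u \<in> E then 0 else f n u) \<in> borel_measurable lborel" for n
    using borel_measurable_integrable[OF f_int] E_sets by measurable
  have "(\<lambda>u. if u \<in> E then 0 else indicator {0<..T} u *\<^sub>R DF u) \<in> borel_measurable lborel"
    by (rule borel_measurable_LIMSEQ_metric[OF meas0 lim])
  then have meas: "(\<lambda>u. indicator {0<..T} u *\<^sub>R DF u) \<in> borel_measurable lborel"
    by (rule measurable_discrete_difference[OF _ E]) auto
  have "AE u in lborel. u \<notin> E" using E by (intro AE_not_in countable_imp_null_set_lborel)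
  then have AE_lim: "AE u in lborel. (\<lambda>n. f n u) \<longlonglongrightarrow> indicator {0<..T} u *\<^sub>R DF u"
  proof eventually_elim
    case (elim u)
    then show ?case using lim[of u] by simp
  qed
  have dom: "AE u in lborel. norm (f n u) \<le> indicator {0..T} u *\<^sub>R \<bar>C\<bar>" for n
    using N[of "n + N"] by (intro AE_I2) (force simp: f_def g_def indicator_def)
  have intC: "integrable lborel (\<lambda>u. indicator {0..T} u *\<^sub>R \<bar>C\<bar>)"
    by (intro integrable_scaleR_left) (auto simp: integrable_indicator_iff emeasure_lborel_Icc_eq)
  note fm = borel_measurable_integrable[OF f_int]
  show "set_integrable lborel {0<..T} DF"
    unfolding set_integrable_def by (rule integrable_dominated_convergence[OF meas fm intC AE_lim dom])
  have "(\<lambda>n. integral\<^sup>L lborel (f n)) \<longlonglongrightarrow> (LINT u:{0<..T}|lborel. DF u)"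
    unfolding set_lebesgue_integral_def by (rule integral_dominated_convergence[OF meas fm intC AE_lim dom])
  then show "(\<lambda>n. \<Sum>i\<in>steps n. Fa n (p n (Suc i)) (left_lim x (p n (Suc i)))
      - Fa n (p n i) (xn n (p n i))) \<longlonglongrightarrow> (LINT u:{0<..T}|lborel. DF u)"
    unfolding f_integral by (rule LIMSEQ_offset)
qed

end

section \<open>The second-order part\<close>

context approximated_paths
begin

lemma component_limit:
  fixes R :: "nat \<Rightarrow> nat \<Rightarrow> real" and H :: "real \<Rightarrow> real"
  assumes L: "bounded_linear L" and qv: "has_qv_real T p k (\<lambda>t. L (x t))"
    and bound: "\<forall>\<^sub>F n in sequentially. \<forall>i\<in>steps n. \<bar>R n i\<bar> \<le> C"
    and left: "\<And>u e. 0 < u \<Longrightarrow> u \<le> T \<Longrightarrow> e > 0 \<Longrightarrow> \<exists>d>0. \<forall>\<^sub>F n in sequentially. \<forall>i\<in>steps n.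
      u - d < p n i \<and> p n (Suc i) < u \<longrightarrow> \<bar>R n i - H u\<bar> < e"
  shows "set_integrable (dqv_cont T p k (\<lambda>t. L (x t))) {0<..T} H"
    and "(\<lambda>n. \<Sum>i\<in>steps n. R n i * (L (left_lim x (p n (Suc i)) - x (p n i)))\<^sup>2)
      \<longlonglongrightarrow> (LINT u:{0<..T}|dqv_cont T p k (\<lambda>t. L (x t)). H u)"
proof -
  \<comment> \<open>\<open>dqv_cont\<close> is built on this chosen measure, so the atomless part
    has to be taken of the same one.\<close>
  define M where "M = (SOME M. qv_measure T p k (\<lambda>t. L (x t)) M)"
  have M: "qv_measure T p k (\<lambda>t. L (x t)) M"
    unfolding M_def using qv someI_ex unfolding has_qv_real_def by metis
  interpret qv_component T p k U S x v L M
    by (intro qv_component.intro qv_component_axioms.intro approximated_paths_axioms L M)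
  have eq: "dqv_cont T p k (\<lambda>t. L (x t)) = \<mu>"
    using interval_measure_cont_part by (simp add: dqv_cont_def qv_cont_def M_def)
  show "set_integrable (dqv_cont T p k (\<lambda>t. L (x t))) {0<..T} H"
    unfolding eq by (rule tagged_sums_converge(1)[OF bound left])
  show "(\<lambda>n. \<Sum>i\<in>steps n. R n i * (L (left_lim x (p n (Suc i)) - x (p n i)))\<^sup>2)
      \<longlonglongrightarrow> (LINT u:{0<..T}|dqv_cont T p k (\<lambda>t. L (x t)). H u)"
    unfolding eq by (rule tagged_sums_converge(2)[OF bound left])
qed

lemma component_squares:
  assumes L: "bounded_linear L" and qv: "has_qv_real T p k (\<lambda>t. L (x t))"
  shows "(\<lambda>s. (L (jump x s))\<^sup>2) summable_on {0<..T}"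
    and "\<exists>K. \<forall>\<^sub>F n in sequentially. (\<Sum>i\<in>steps n. (L (left_lim x (p n (Suc i)) - x (p n i)))\<^sup>2) \<le> K"
proof -
  obtain M where M: "qv_measure T p k (\<lambda>t. L (x t)) M" using qv by (auto simp: has_qv_real_def)
  interpret qv_component T p k U S x v L M
    by (intro qv_component.intro qv_component_axioms.intro approximated_paths_axioms L M)
  show "(\<lambda>s. (L (jump x s))\<^sup>2) summable_on {0<..T}" by (rule jumps_summable)
  show "\<exists>K. \<forall>\<^sub>F n in sequentially. (\<Sum>i\<in>steps n. (L (left_lim x (p n (Suc i)) - x (p n i)))\<^sup>2) \<le> K"
    by (rule gap_squares_bounded)
qed

end

context ito_setting
begin

lemma norm_vec_squared: "(norm y)\<^sup>2 = (\<Sum>j\<in>UNIV. (y $ j)\<^sup>2)" for y :: "real ^ 'd"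
  by (simp add: norm_vec_def L2_set_def sum_nonneg)

lemma has_qv_component: "has_qv_real T p k (\<lambda>t. x t $ j)"
  using has_qv by (simp add: has_qv_def)

lemma jump_squares_summable: "(\<lambda>s. (norm (jump x s))\<^sup>2) summable_on {0<..T}"
proof -
  have "(\<lambda>s. \<Sum>j\<in>A. (jump x s $ j)\<^sup>2) summable_on {0<..T}" if "finite A" for A :: "'d set"
    using that
  proof induction
    case (insert j A)
    then show ?case
      using component_squares(1)[OF bounded_linear_vec_nth has_qv_component] by (simp add: summable_on_add)
  qed simp
  then show ?thesis by (simp add: norm_vec_squared)
qed

lemma gap_norm_squares_bounded:
  "\<exists>K. \<forall>\<^sub>F n in sequentially. (\<Sum>i\<in>steps n. (norm (\<delta> n i))\<^sup>2) \<le> K"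
proof -
  obtain K where K: "\<And>j. \<forall>\<^sub>F n in sequentially. (\<Sum>i\<in>steps n. (\<delta> n i $ j)\<^sup>2) \<le> K j"
    using choice[of "\<lambda>j K. \<forall>\<^sub>F n in sequentially. (\<Sum>i\<in>steps n. (\<delta> n i $ j)\<^sup>2) \<le> K"]
      component_squares(2)[OF bounded_linear_vec_nth has_qv_component] by blast
  have "\<forall>\<^sub>F n in sequentially. \<forall>j\<in>UNIV. (\<Sum>i\<in>steps n. (\<delta> n i $ j)\<^sup>2) \<le> K j"
    using K by (intro eventually_ball_finite) auto
  then have "\<forall>\<^sub>F n in sequentially. (\<Sum>i\<in>steps n. (norm (\<delta> n i))\<^sup>2) \<le> (\<Sum>j\<in>UNIV. K j)"
  proof eventually_elim
    case (elim n)
    have "(\<Sum>i\<in>steps n. (norm (\<delta> n i))\<^sup>2) = (\<Sum>j\<in>UNIV. \<Sum>i\<in>steps n. (\<delta> n i $ j)\<^sup>2)"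
      unfolding norm_vec_squared by (rule sum.swap)
    also have "\<dots> \<le> (\<Sum>j\<in>UNIV. K j)" using elim by (intro sum_mono) auto
    finally show ?case .
  qed
  then show ?thesis by blast
qed

lemma gap_jump_products_vanish:
  "(\<lambda>n. \<Sum>i\<in>steps n. norm (\<delta> n i) * norm (jump x (p n (Suc i)))) \<longlonglongrightarrow> 0"
proof -
  obtain K where "\<forall>\<^sub>F n in sequentially. (\<Sum>i\<in>steps n. (norm (\<delta> n i))\<^sup>2) \<le> K"
    using gap_norm_squares_bounded by blast
  from cross_terms_vanish[OF jump_squares_summable _ this] left_gap_small show ?thesis by simp
qed

text \<open>Step lengths qualify as the factor \<open>d\<close> in
  \<open>cross_terms_vanish\<close>: they are uniformly small, and their squares sum to at most
  \<open>T * T\<close>.\<close>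

lemma length_jump_products_vanish:
  "(\<lambda>n. \<Sum>i\<in>steps n. (p n (Suc i) - p n i) * norm (jump x (p n (Suc i)))) \<longlonglongrightarrow> 0"
proof -
  let ?d = "\<lambda>n i. if i \<in> steps n then p n (Suc i) - p n i else 0"
  have "\<forall>\<^sub>F n in sequentially. (\<Sum>i\<in>steps n. (?d n i)\<^sup>2) \<le> T * T"
  proof (intro always_eventually allI)
    fix n
    have "(\<Sum>i\<in>steps n. (?d n i)\<^sup>2) \<le> (\<Sum>i\<in>steps n. T * (p n (Suc i) - p n i))"
    proof (rule sum_mono)
      fix i assume i: "i \<in> steps n"
      then show "(?d n i)\<^sup>2 \<le> T * (p n (Suc i) - p n i)"
        using stepsD[OF i] by (auto simp: power2_eq_square intro!: mult_right_mono)
    qed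
    also have "\<dots> = T * T" unfolding sum_distrib_left[symmetric] by (simp add: sum_step_lengths)
    finally show "(\<Sum>i\<in>steps n. (?d n i)\<^sup>2) \<le> T * T" .
  qed
  moreover have "\<forall>\<^sub>F n in sequentially. \<forall>i\<in>steps n. \<bar>?d n i\<bar> \<le> e" if "e > 0" for e
    using mesh_small[OF that] by eventually_elim (use stepsD in \<open>force simp: less_imp_le\<close>)
  ultimately have "(\<lambda>n. \<Sum>i\<in>steps n. \<bar>?d n i\<bar> * \<bar>norm (jump x (p n (Suc i)))\<bar>) \<longlonglongrightarrow> 0"
    by (intro cross_terms_vanish[OF jump_squares_summable])
  moreover have "(\<Sum>i\<in>steps n. \<bar>?d n i\<bar> * \<bar>norm (jump x (p n (Suc i)))\<bar>)
    = (\<Sum>i\<in>steps n. (p n (Suc i) - p n i) * norm (jump x (p n (Suc i))))" for n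
    using stepsD(3)[of _ n] by (intro sum.cong) (auto simp: less_imp_le)
  ultimately show ?thesis by simp
qed

lemma X_eq: "i \<in> steps n \<Longrightarrow> xn n (p n i) = x (p n i) + \<delta> n i"
  using stepsD[of i n] by (simp add: xn_eq)

text \<open>Paths stopped before \<open>u\<close> are compared with the left path at
  \<open>u\<close>, which is the direction that \<open>left_continuous_functional\<close> permits.
  The estimate is uniform in \<theta>, so the unknown intermediate points of the expansion are
  covered.\<close>

lemma vhess_left_limit:
  assumes u: "0 < u" "u \<le> T" and e: "e > 0"
  shows "\<exists>d>0. \<forall>\<^sub>F n in sequentially. \<forall>i\<in>steps n. u - d < p n i \<and> p n (Suc i) < u \<longrightarrow>
    (\<forall>\<theta>\<in>{0..1}. x (p n i) + \<theta> *\<^sub>R \<delta> n i \<in> U \<longrightarrow>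
      norm (Ha n (p n i) (x (p n i) + \<theta> *\<^sub>R \<delta> n i)
        - vhess F u (left_path x u) (left_path v u)) < e)"
proof -
  have uT: "u \<in> {0..T}" "0 \<le> u" using u by auto
  have z: "left_path x u \<in> cadlag u U" "left_path v u \<in> cadlag u S"
    unfolding left_path_eq_stop using u left_path_cadlag[OF x_cadlag] left_path_cadlag[OF v_cadlag] by auto
  obtain \<eta> where \<eta>: "\<eta> > 0"
    "\<And>t1 z' w'. \<lbrakk>0 \<le> t1; t1 \<le> u; u - t1 \<le> \<eta>; z' \<in> cadlag t1 U; w' \<in> cadlag t1 S;
      \<And>s. 0 \<le> s \<Longrightarrow> s \<le> t1 \<Longrightarrow> norm (left_path x u s - z' s) \<le> \<eta>; \<And>s. t1 < s \<Longrightarrow> s \<le> u \<Longrightarrow> norm (left_path x u s - z' t1) \<le> \<eta>;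
      \<And>s. 0 \<le> s \<Longrightarrow> s \<le> t1 \<Longrightarrow> norm (left_path v u s - w' s) \<le> \<eta>; \<And>s. t1 < s \<Longrightarrow> s \<le> u \<Longrightarrow> norm (left_path v u s - w' t1) \<le> \<eta>\<rbrakk>
      \<Longrightarrow> norm (vhess F u (left_path x u) (left_path v u) - vhess F t1 z' w') < e"
    by (rule left_continuous_functionalD[OF lc_vhess uT z e]) blast
  \<comment> \<open>Up to three errors of size \<gamma> add up: the distances to the left limit at
    \<open>u\<close> at the two times compared, and the shift of the endpoint or the distance to the
    step path.\<close>
  define \<gamma> where "\<gamma> = \<eta> / 4"
  have \<gamma>: "\<gamma> > 0" using \<eta>(1) by (simp add: \<gamma>_def)
  obtain d1 where d1: "d1 > 0"
    "\<And>s. 0 \<le> s \<Longrightarrow> s \<le> T \<Longrightarrow> u - d1 < s \<Longrightarrow> s < u \<Longrightarrow> norm (x s - left_lim x u) < \<gamma>"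
    by (rule cadlag_local_limits[OF x_cadlag uT(1) \<gamma>]) blast
  obtain d2 where d2: "d2 > 0"
    "\<And>s. 0 \<le> s \<Longrightarrow> s \<le> T \<Longrightarrow> u - d2 < s \<Longrightarrow> s < u \<Longrightarrow> norm (v s - left_lim v u) < \<gamma>"
    by (rule cadlag_local_limits[OF v_cadlag uT(1) \<gamma>]) blast
  define d where "d = min \<eta> (min d1 d2)"
  have d: "d > 0" "d \<le> \<eta>" "d \<le> d1" "d \<le> d2" using \<eta>(1) d1 d2 by (auto simp: d_def)
  have "\<forall>\<^sub>F n in sequentially. \<forall>i\<in>steps n. u - d < p n i \<and> p n (Suc i) < u \<longrightarrow>
    (\<forall>\<theta>\<in>{0..1}. x (p n i) + \<theta> *\<^sub>R \<delta> n i \<in> U \<longrightarrow>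
      norm (Ha n (p n i) (x (p n i) + \<theta> *\<^sub>R \<delta> n i)
        - vhess F u (left_path x u) (left_path v u)) < e)"
    using uniform_approximation[OF \<gamma>] left_gap_small[OF \<gamma>]
  proof eventually_elim
    case (elim n)
    show ?case
    proof (intro ballI impI)
      fix i and \<theta> :: real
      assume i: "i \<in> steps n" and near: "u - d < p n i \<and> p n (Suc i) < u" and \<theta>: "\<theta> \<in> {0..1}"
        and inU: "x (p n i) + \<theta> *\<^sub>R \<delta> n i \<in> U"
      let ?t = "p n i" and ?a = "x (p n i) + \<theta> *\<^sub>R \<delta> n i"
      have t: "0 \<le> ?t" "?t < u" "?t \<le> T" "?t \<in> {0..T}" using stepsD[OF i] near by auto
      have "norm (\<theta> *\<^sub>R \<delta> n i) = \<theta> * norm (\<delta> n i)" using \<theta> by simp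
      also have "\<dots> \<le> 1 * \<gamma>" using \<theta> elim(2) i \<gamma> by (intro mult_mono) auto
      finally have shift: "norm (\<theta> *\<^sub>R \<delta> n i) \<le> \<gamma>" by simp
      have xt: "norm (x ?t - left_lim x u) < \<gamma>" and vt: "norm (v ?t - left_lim v u) < \<gamma>"
        using d1(2)[of ?t] d2(2)[of ?t] t near d by auto
      have unif: "norm (x s - xn n s) \<le> \<gamma>" "norm (v s - vn n s) \<le> \<gamma>" if "0 \<le> s" "s \<le> u" for s
        using elim(1) that u by (auto simp: norm_minus_commute)
      have xlate: "norm (left_path x u s - left_lim x u) \<le> \<gamma>" "norm (left_path v u s - left_lim v u) \<le> \<gamma>"
        if "?t < s" "s \<le> u" for s
        using that t near d d1(2)[of s] d2(2)[of s] u \<gamma> unfolding left_path_eq_stop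
        by (cases "s = u"; auto)+
      have "norm (vhess F u (left_path x u) (left_path v u) - Ha n ?t ?a) < e"
      proof (rule \<eta>(2))
        fix s assume s: "0 \<le> s" "s \<le> ?t"
        show "norm (left_path x u s - Xa n ?t ?a s) \<le> \<eta>"
          using s t unif[of s] shift \<gamma> unfolding left_path_eq_stop \<gamma>_def
          by (cases "s = ?t") (auto simp del: norm_scaleR)
        show "norm (left_path v u s - V n ?t s) \<le> \<eta>"
          using s t unif[of s] \<gamma> unfolding left_path_eq_stop \<gamma>_def by (cases "s = ?t") auto
      next
        fix s assume s: "?t < s" "s \<le> u"
        have "left_path x u s - Xa n ?t ?a ?t
          = (left_path x u s - left_lim x u) - (x ?t - left_lim x u) - \<theta> *\<^sub>R \<delta> n i" using t by simp
        also have "norm \<dots> \<le> norm (left_path x u s - left_lim x u) + norm (x ?t - left_lim x u) + norm (\<theta> *\<^sub>R \<delta> n i)"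
          by (rule order_trans[OF norm_triangle_ineq4 add_right_mono[OF norm_triangle_ineq4]])
        also have "\<dots> \<le> \<eta>" using xlate(1)[OF s] xt shift \<gamma> unfolding \<gamma>_def by linarith
        finally show "norm (left_path x u s - Xa n ?t ?a ?t) \<le> \<eta>" .
        have "left_path v u s - V n ?t ?t
          = (left_path v u s - left_lim v u) - (v ?t - left_lim v u) + (v ?t - vn n ?t)" using t by simp
        also have "norm \<dots> \<le> norm (left_path v u s - left_lim v u) + norm (v ?t - left_lim v u) + norm (v ?t - vn n ?t)"
          by (rule order_trans[OF norm_triangle_ineq add_right_mono[OF norm_triangle_ineq4]])
        also have "\<dots> \<le> \<eta>" using xlate(2)[OF s] vt unif(2)[of ?t] t \<gamma> unfolding \<gamma>_def by linarith
        finally show "norm (left_path v u s - V n ?t ?t) \<le> \<eta>" .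
      qed (use t near d inU in \<open>auto intro: V_cadlag Xa_cadlag\<close>)
      then show "norm (Ha n ?t ?a - vhess F u (left_path x u) (left_path v u)) < e"
        by (simp add: norm_minus_commute)
    qed
  qed
  then show ?thesis using d(1) by blast
qed

abbreviation Hess :: "real \<Rightarrow> real ^ 'd ^ 'd" where
  "Hess u \<equiv> vhess F u (left_path x u) (left_path v u)"

text \<open>The Hessians in Taylor's remainders serve as tags. Their intermediate points are
  arbitrary choices, so nothing relates them across steps or stages except the common limit from the
  left.\<close>

lemma second_order_tags:
  obtains R :: "nat \<Rightarrow> nat \<Rightarrow> real ^ 'd ^ 'd" and C where
    "\<forall>\<^sub>F n in sequentially. \<forall>i\<in>steps n. norm (R n i) \<le> C"
    "\<forall>\<^sub>F n in sequentially. \<forall>i\<in>steps n.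
      Fa n (p n i) (xn n (p n i)) - Fa n (p n i) (x (p n i))
        - Ga n (p n i) (x (p n i)) \<bullet> \<delta> n i = (R n i *v \<delta> n i) \<bullet> \<delta> n i / 2"
    "\<And>u e. 0 < u \<Longrightarrow> u \<le> T \<Longrightarrow> e > 0 \<Longrightarrow> \<exists>d>0. \<forall>\<^sub>F n in sequentially. \<forall>i\<in>steps n.
      u - d < p n i \<and> p n (Suc i) < u \<longrightarrow> norm (R n i - Hess u) < e"
proof -
  obtain C \<eta> where C: "C > 0" "\<eta> > 0" "\<And>t a. t \<in> {0..T} \<Longrightarrow> norm (a - x t) \<le> \<eta> \<Longrightarrow> a \<in> U"
    and bnd: "\<forall>\<^sub>F n in sequentially. \<forall>t\<in>{0..T}. \<forall>a. norm (a - x t) \<le> \<eta> \<longrightarrow> norm (Ha n t a) \<le> C"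
    by (rule near_bounds) (rule that)
  let ?z = "\<lambda>n i \<theta>. Xa n (p n i) (x (p n i) + \<theta> *\<^sub>R \<delta> n i)"
  define ok where "ok n i \<theta> \<longleftrightarrow> \<theta> \<in> {0..1} \<and> x (p n i) + \<theta> *\<^sub>R \<delta> n i \<in> U \<and>
    norm (vhess F (p n i) (?z n i \<theta>) (V n (p n i))) \<le> C \<and>
    Fa n (p n i) (xn n (p n i)) - Fa n (p n i) (x (p n i))
        - Ga n (p n i) (x (p n i)) \<bullet> \<delta> n i
      = (vhess F (p n i) (?z n i \<theta>) (V n (p n i)) *v \<delta> n i) \<bullet> \<delta> n i / 2" for n i and \<theta> :: real
  define \<theta> where "\<theta> n i = (SOME \<theta>. ok n i \<theta>)" for n i
  have ok: "\<forall>\<^sub>F n in sequentially. \<forall>i\<in>steps n. ok n i (\<theta> n i)"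
    using left_gap_small[OF C(2)] bnd
  proof eventually_elim
    case (elim n)
    show ?case
    proof
      fix i assume i: "i \<in> steps n"
      let ?t = "p n i"
      have t: "?t \<in> {0..T}" using pts[OF i] by simp
      have small: "norm (x ?t + \<theta> *\<^sub>R \<delta> n i - x ?t) \<le> \<eta>" if "\<theta> \<in> {0..1}" for \<theta> :: real
      proof -
        have "norm (\<theta> *\<^sub>R \<delta> n i) = \<theta> * norm (\<delta> n i)" using that by simp
        also have "\<dots> \<le> 1 * \<eta>" using that elim(1) i C by (intro mult_mono) auto
        finally show ?thesis by simp
      qed
      have inU: "x ?t + \<theta> *\<^sub>R \<delta> n i \<in> U" if "\<theta> \<in> {0..1}" for \<theta> :: real
        by (rule C(3)[OF t small[OF that]])
      interpret vert_segment "{0..T}" U S F ?t "Xa n ?t (x ?t)" "V n ?t" "\<delta> n i"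
        by unfold_locales (use twice_diff t inU inU[of 0] in \<open>auto intro!: V_cadlag Xa_cadlag x_in\<close>)
      obtain th where th: "th \<in> {0..1}"
        "F ?t (vert (Xa n ?t (x ?t)) ?t (\<delta> n i)) (V n ?t) = Fa n ?t (x ?t)
          + Ga n ?t (x ?t) \<bullet> \<delta> n i
          + (vhess F ?t (vert (Xa n ?t (x ?t)) ?t (th *\<^sub>R \<delta> n i)) (V n ?t) *v \<delta> n i) \<bullet> \<delta> n i / 2"
        by (rule taylor)
      have "ok n i th"
        unfolding ok_def using th inU[OF th(1)] small[OF th(1)] elim(2) t X_eq[OF i] by simp
      then show "ok n i (\<theta> n i)" unfolding \<theta>_def by (rule someI)
    qed
  qed
  show ?thesis
  proof (rule that[of "\<lambda>n i. vhess F (p n i) (?z n i (\<theta> n i)) (V n (p n i))" C])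
    fix u e :: real assume u: "0 < u" "u \<le> T" "e > 0"
    obtain d where d: "d > 0" "\<forall>\<^sub>F n in sequentially. \<forall>i\<in>steps n. u - d < p n i \<and> p n (Suc i) < u \<longrightarrow>
      (\<forall>\<theta>\<in>{0..1}. x (p n i) + \<theta> *\<^sub>R \<delta> n i \<in> U \<longrightarrow> norm (vhess F (p n i) (?z n i \<theta>) (V n (p n i)) - Hess u) < e)"
      using vhess_left_limit[OF u] by blast
    from d(2) ok have "\<forall>\<^sub>F n in sequentially. \<forall>i\<in>steps n. u - d < p n i \<and> p n (Suc i) < u \<longrightarrow>
        norm (vhess F (p n i) (?z n i (\<theta> n i)) (V n (p n i)) - Hess u) < e"
      by eventually_elim (auto simp: ok_def)
    then show "\<exists>d>0. \<forall>\<^sub>F n in sequentially. \<forall>i\<in>steps n. u - d < p n i \<and> p n (Suc i) < u \<longrightarrow>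
        norm (vhess F (p n i) (?z n i (\<theta> n i)) (V n (p n i)) - Hess u) < e"
      using d(1) by blast
  qed (use ok in \<open>auto simp: ok_def elim!: eventually_mono\<close>)
qed

text \<open>The quadratic form splits into entries. The diagonal involves squared gaps of
  coordinates; off the diagonal polarisation reduces products to squared gaps of x_i + x_j, x_i and
  x_j, matching the definition of the integral.\<close>

lemma second_order_limit:
  "qv_cont_integrable T p k x i j (\<lambda>u. Hess u $ i $ j)"
  "(\<lambda>n. \<Sum>l\<in>steps n. Fa n (p n l) (xn n (p n l)) - Fa n (p n l) (x (p n l))
      - Ga n (p n l) (x (p n l)) \<bullet> \<delta> n l)
    \<longlonglongrightarrow> trace_qv_cont_integral T p k x (\<lambda>u. (1 / 2) *\<^sub>R Hess u)"
proof -
  obtain R :: "nat \<Rightarrow> nat \<Rightarrow> real ^ 'd ^ 'd" and C where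
    R: "\<forall>\<^sub>F n in sequentially. \<forall>l\<in>steps n. norm (R n l) \<le> C"
    "\<forall>\<^sub>F n in sequentially. \<forall>l\<in>steps n.
      Fa n (p n l) (xn n (p n l)) - Fa n (p n l) (x (p n l))
        - Ga n (p n l) (x (p n l)) \<bullet> \<delta> n l = (R n l *v \<delta> n l) \<bullet> \<delta> n l / 2"
    "\<And>u e. 0 < u \<Longrightarrow> u \<le> T \<Longrightarrow> e > 0 \<Longrightarrow> \<exists>d>0. \<forall>\<^sub>F n in sequentially. \<forall>l\<in>steps n.
      u - d < p n l \<and> p n (Suc l) < u \<longrightarrow> norm (R n l - Hess u) < e"
    by (rule second_order_tags) (rule that)
  have entry: "\<bar>A $ i $ j\<bar> \<le> norm A" for A :: "real ^ 'd ^ 'd" and i j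
    by (rule order_trans[OF component_le_norm_cart Finite_Cartesian_Product.norm_nth_le])
  \<comment> \<open>The factor \<open>c\<close> is 1 for integrability and 1/2 for the
    limit.\<close>
  have bnd: "\<forall>\<^sub>F n in sequentially. \<forall>l\<in>steps n. \<bar>c * R n l $ i $ j\<bar> \<le> \<bar>c\<bar> * C" for i j c
    using R(1) by eventually_elim (auto simp: abs_mult intro!: mult_left_mono order_trans[OF entry])
  have left: "\<exists>d>0. \<forall>\<^sub>F n in sequentially. \<forall>l\<in>steps n. u - d < p n l \<and> p n (Suc l) < u \<longrightarrow>
      \<bar>c * R n l $ i $ j - c * Hess u $ i $ j\<bar> < e" if u: "0 < u" "u \<le> T" "e > 0" for i j u e and c :: real
  proof -
    have "e / (\<bar>c\<bar> + 1) > 0" using u by simp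
    then obtain d where d: "d > 0" "\<forall>\<^sub>F n in sequentially. \<forall>l\<in>steps n.
      u - d < p n l \<and> p n (Suc l) < u \<longrightarrow> norm (R n l - Hess u) < e / (\<bar>c\<bar> + 1)" using R(3)[OF u(1,2)] by blast
    have "\<forall>\<^sub>F n in sequentially. \<forall>l\<in>steps n. u - d < p n l \<and> p n (Suc l) < u \<longrightarrow>
      \<bar>c * R n l $ i $ j - c * Hess u $ i $ j\<bar> < e"
      using d(2)
    proof eventually_elim
      case (elim n)
      show ?case
      proof (intro ballI impI)
        fix l assume "l \<in> steps n" "u - d < p n l \<and> p n (Suc l) < u"
        then have n: "norm (R n l - Hess u) < e / (\<bar>c\<bar> + 1)" using elim by auto
        have "\<bar>c * R n l $ i $ j - c * Hess u $ i $ j\<bar> = \<bar>c\<bar> * \<bar>(R n l - Hess u) $ i $ j\<bar>"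
          by (simp add: abs_mult[symmetric] right_diff_distrib)
        also have "\<dots> \<le> (\<bar>c\<bar> + 1) * norm (R n l - Hess u)"
          by (intro mult_mono entry) auto
        also have "\<dots> < (\<bar>c\<bar> + 1) * (e / (\<bar>c\<bar> + 1))" using n by (intro mult_strict_left_mono) auto
        also have "\<dots> = e" by simp
        finally show "\<bar>c * R n l $ i $ j - c * Hess u $ i $ j\<bar> < e" .
      qed
    qed
    then show ?thesis using d(1) by blast
  qed
  have bl2: "bounded_linear (\<lambda>y :: real ^ 'd. y $ i + y $ j)" for i j
    by (intro bounded_linear_add bounded_linear_vec_nth)
  have qv2: "has_qv_real T p k (\<lambda>t. x t $ i + x t $ j)" if "i \<noteq> j" for i j
    using has_qv that by (simp add: has_qv_def)
  note c1 = component_limit[OF bounded_linear_vec_nth has_qv_component bnd left]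
  note c2 = component_limit[OF bl2 qv2 bnd left]
  show "qv_cont_integrable T p k x i j (\<lambda>u. Hess u $ i $ j)"
  proof -
    have "set_integrable (dqv_cont T p k (\<lambda>t. x t $ l)) {0<..T} (\<lambda>u. 1 * Hess u $ i $ j)" for l
      by (rule c1(1))
    moreover have "set_integrable (dqv_cont T p k (\<lambda>t. x t $ i + x t $ j)) {0<..T} (\<lambda>u. 1 * Hess u $ i $ j)"
      if "i \<noteq> j" by (rule c2(1)[OF that])
    ultimately show ?thesis unfolding qv_cont_integrable_def by simp
  qed
  have ij: "(\<lambda>n. \<Sum>l\<in>steps n. (1 / 2) * R n l $ i $ j * (\<delta> n l $ i * \<delta> n l $ j))
    \<longlonglongrightarrow> qv_cont_integral T p k x i j (\<lambda>u. ((1 / 2) *\<^sub>R Hess u) $ i $ j)" for i j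
  proof (cases "i = j")
    case True
    have "(\<lambda>n. \<Sum>l\<in>steps n. (1 / 2) * R n l $ j $ j * (\<delta> n l $ j)\<^sup>2)
      \<longlonglongrightarrow> (LINT u:{0<..T}|dqv_cont T p k (\<lambda>t. x t $ j). (1 / 2) * Hess u $ j $ j)"
      by (rule c1(2))
    then show ?thesis using True by (simp add: qv_cont_integral_def power2_eq_square)
  next
    case False
    have polarisation: "((1 / 2) * r * (a + b)\<^sup>2 - (1 / 2) * r * a\<^sup>2 - (1 / 2) * r * b\<^sup>2) / 2 = (1 / 2) * r * (a * b)"
      for r a b :: real by (simp add: power2_eq_square field_simps)
    let ?I = "\<lambda>f. LINT u:{0<..T}|dqv_cont T p k f. (1 / 2) * Hess u $ i $ j"
    have "(\<lambda>n. ((\<Sum>l\<in>steps n. (1 / 2) * R n l $ i $ j * (\<delta> n l $ i + \<delta> n l $ j)\<^sup>2)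
        - (\<Sum>l\<in>steps n. (1 / 2) * R n l $ i $ j * (\<delta> n l $ i)\<^sup>2)
        - (\<Sum>l\<in>steps n. (1 / 2) * R n l $ i $ j * (\<delta> n l $ j)\<^sup>2)) / 2)
      \<longlonglongrightarrow> (?I (\<lambda>t. x t $ i + x t $ j) - ?I (\<lambda>t. x t $ i) - ?I (\<lambda>t. x t $ j)) / 2"
      by (rule tendsto_divide[OF tendsto_diff[OF tendsto_diff[OF c2(2)[OF False] c1(2)] c1(2)] tendsto_const])
        simp_all
    moreover have "((\<Sum>l\<in>steps n. (1 / 2) * R n l $ i $ j * (\<delta> n l $ i + \<delta> n l $ j)\<^sup>2)
        - (\<Sum>l\<in>steps n. (1 / 2) * R n l $ i $ j * (\<delta> n l $ i)\<^sup>2)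
        - (\<Sum>l\<in>steps n. (1 / 2) * R n l $ i $ j * (\<delta> n l $ j)\<^sup>2)) / 2
      = (\<Sum>l\<in>steps n. (1 / 2) * R n l $ i $ j * (\<delta> n l $ i * \<delta> n l $ j))" for n
      unfolding sum_subtractf[symmetric] sum_divide_distrib
      by (intro sum.cong refl polarisation)
    ultimately show ?thesis using False by (simp add: qv_cont_integral_def)
  qed
  have "(\<lambda>n. \<Sum>j\<in>UNIV. \<Sum>i\<in>UNIV. \<Sum>l\<in>steps n. (1 / 2) * R n l $ i $ j * (\<delta> n l $ i * \<delta> n l $ j))
    \<longlonglongrightarrow> trace_qv_cont_integral T p k x (\<lambda>u. (1 / 2) *\<^sub>R Hess u)"
    unfolding trace_qv_cont_integral_def by (intro tendsto_sum ij)
  moreover have "\<forall>\<^sub>F n in sequentially. (\<Sum>j\<in>UNIV. \<Sum>i\<in>UNIV. \<Sum>l\<in>steps n. (1 / 2) * R n l $ i $ j * (\<delta> n l $ i * \<delta> n l $ j))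
    = (\<Sum>l\<in>steps n. Fa n (p n l) (xn n (p n l)) - Fa n (p n l) (x (p n l))
      - Ga n (p n l) (x (p n l)) \<bullet> \<delta> n l)"
    using R(2)
  proof eventually_elim
    case (elim n)
    have quad: "(A *v y) \<bullet> y / 2 = (\<Sum>j\<in>UNIV. \<Sum>i\<in>UNIV. (1 / 2) * A $ i $ j * (y $ i * y $ j))"
      for A :: "real ^ 'd ^ 'd" and y
    proof -
      have "(A *v y) \<bullet> y / 2 = (\<Sum>i\<in>UNIV. \<Sum>j\<in>UNIV. (1 / 2) * A $ i $ j * (y $ i * y $ j))"
        by (simp add: inner_vec_def matrix_vector_mult_def sum_distrib_left sum_divide_distrib mult_ac)
      then show ?thesis by (subst sum.swap) simp
    qed
    have "(\<Sum>j\<in>UNIV. \<Sum>i\<in>UNIV. \<Sum>l\<in>steps n. (1 / 2) * R n l $ i $ j * (\<delta> n l $ i * \<delta> n l $ j))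
      = (\<Sum>l\<in>steps n. \<Sum>j\<in>UNIV. \<Sum>i\<in>UNIV. (1 / 2) * R n l $ i $ j * (\<delta> n l $ i * \<delta> n l $ j))"
      by (simp add: sum.swap[where B = "steps n"])
    also have "\<dots> = (\<Sum>l\<in>steps n. (R n l *v \<delta> n l) \<bullet> \<delta> n l / 2)" by (simp only: quad)
    also have "\<dots> = (\<Sum>l\<in>steps n. Fa n (p n l) (xn n (p n l)) - Fa n (p n l) (x (p n l))
      - Ga n (p n l) (x (p n l)) \<bullet> \<delta> n l)"
      using elim by (intro sum.cong) auto
    finally show ?case .
  qed
  ultimately show "(\<lambda>n. \<Sum>l\<in>steps n. Fa n (p n l) (xn n (p n l)) - Fa n (p n l) (x (p n l))
      - Ga n (p n l) (x (p n l)) \<bullet> \<delta> n l)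
    \<longlonglongrightarrow> trace_qv_cont_integral T p k x (\<lambda>u. (1 / 2) *\<^sub>R Hess u)"
    by (rule Lim_transform_eventually)
qed

end

section \<open>The jump part, the transport of the gradient and the final identity\<close>

context ito_setting
begin

abbreviation jump_term :: "real \<Rightarrow> real" where
  "jump_term u \<equiv> F u (restrict x {0..u}) (restrict v {0..u}) - F u (left_path x u) (left_path v u)
    - vgrad F u (left_path x u) (left_path v u) \<bullet> jump x u"

text \<open>Dominated convergence over the times in ]0,T]. Jumps of size at most \<eta> are
  dominated by \<open>C\<close> times their square through the Taylor expansion; the finitely many
  larger ones, whose segments may leave \<open>U\<close>, converge individually.\<close>

lemma jump_limit:
  defines "JT n u \<equiv> Fa n u (x u) - Fa n u (left_lim (xn n) u)
    - Ga n u (left_lim (xn n) u) \<bullet> jump x u"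
  shows "jump_term summable_on {0<..T}"
    "(\<lambda>n. \<Sum>i\<in>steps n. JT n (p n (Suc i))) \<longlonglongrightarrow> infsum jump_term {0<..T}"
proof -
  \<comment> \<open>A time that is not a right end at stage \<open>n\<close> contributes zero, and
    every jump time is a right end eventually.\<close>
  define f where "f n u = (if \<exists>i\<in>steps n. p n (Suc i) = u then JT n u else 0)" for n u
  have xu: "x u = left_lim x u" if "jump x u = 0" for u using that by (simp add: jump_def)
  have left_eq: "left_path x u = stop x u (left_lim x u)" "left_path v u = stop v u (left_lim v u)"
    "restrict x {0..u} = stop x u (x u)" "restrict v {0..u} = stop v u (v u)" for u
    by (rule left_path_eq_stop restrict_eq_stop)+
  have term_eq: "jump_term u = F u (stop x u (x u)) (stop v u (v u)) - F u (stop x u (left_lim x u)) (stop v u (v u))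
    - vgrad F u (stop x u (left_lim x u)) (stop v u (v u)) \<bullet> jump x u" if u: "u \<in> {0<..T}" for u
  proof -
    have u': "u \<in> {0..T}" "0 \<le> u" "u \<le> T" using u by auto
    have z: "stop x u (left_lim x u) \<in> cadlag u U" by (rule left_path_cadlag[OF x_cadlag u'(2,3)])
    show ?thesis
      unfolding left_eq
      by (simp only: v_predictable[OF predictable u'(1) z] v_predictable[OF predictable_vgrad[OF predictable open_U] u'(1) z])
  qed
  have term_0: "jump_term u = 0" if "u \<in> {0<..T}" "jump x u = 0" for u
    unfolding term_eq[OF that(1)] using xu[OF that(2)] that(2) by simp
  have f_0: "f n u = 0" if "u \<in> {0<..T}" "jump x u = 0" for n u
    using that left_lim_xn[of _ n] xu[OF that(2)] by (auto simp: f_def JT_def)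
  have JT_lim: "(\<lambda>n. JT n u) \<longlonglongrightarrow> jump_term u" if u: "u \<in> {0<..T}" for u
  proof -
    have u': "u \<in> {0..T}" using u by auto
    have b: "(\<lambda>n. left_lim (xn n) u) \<longlonglongrightarrow> left_lim x u"
    proof (rule LIMSEQ_I)
      fix r :: real assume r: "0 < r"
      have "\<forall>\<^sub>F n in sequentially. norm (left_lim (xn n) u - left_lim x u) < r"
        using uniform_approximation[OF half_gt_zero[OF r]]
      proof eventually_elim
        case (elim n)
        then have "norm (left_lim (xn n) u - left_lim x u) \<le> r / 2"
          using u' by (intro uniform_left_limits) auto
        then show ?case using r by linarith
      qed
      then show "\<exists>no. \<forall>n\<ge>no. norm (left_lim (xn n) u - left_lim x u) < r" by (simp add: eventually_sequentially)
    qed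
    have bU: "left_lim (xn n) u \<in> U" for n using cadlag_left_lim_in[OF xn_cadlag u'] .
    have cF: "continuous_fixed_times {0..T} U S F" and cG: "continuous_fixed_times {0..T} U S (vgrad F)"
      using lc_F lc_vgrad by (auto intro!: left_continuous_imp_fixed_times)
    show ?thesis
      unfolding JT_def term_eq[OF u]
      using fixed_time_limit[OF cF u' u' x_in[OF u'] x_in[OF u'] tendsto_const]
        fixed_time_limit[OF cF u' u' left_lim_x_in[OF u'] bU b] fixed_time_limit[OF cG u' u' left_lim_x_in[OF u'] bU b]
      by (intro tendsto_diff tendsto_inner tendsto_const)
  qed
  have f_lim: "(\<lambda>n. f n u) \<longlonglongrightarrow> jump_term u" if u: "u \<in> {0<..T}" for u
  proof (cases "jump x u = 0")
    case True
    then show ?thesis using f_0[OF u True] term_0[OF u True] by simp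
  next
    case False
    have "\<forall>\<^sub>F n in sequentially. \<exists>i\<in>steps n. p n (Suc i) = u"
      using u False by (intro jump_time_is_point) auto
    then have "\<forall>\<^sub>F n in sequentially. JT n u = f n u" by eventually_elim (simp add: f_def)
    with JT_lim[OF u] show ?thesis by (rule Lim_transform_eventually)
  qed
  obtain C \<eta> where C: "C > 0" "\<eta> > 0" "\<And>t a. t \<in> {0..T} \<Longrightarrow> norm (a - x t) \<le> \<eta> \<Longrightarrow> a \<in> U"
    and bnd: "\<forall>\<^sub>F n in sequentially. \<forall>t\<in>{0..T}. \<forall>a. norm (a - x t) \<le> \<eta> \<longrightarrow> norm (Ha n t a) \<le> C"
    by (rule near_bounds) (rule that)
  define J where "J = {u \<in> {0<..T}. \<eta>\<^sup>2 < (norm (jump x u))\<^sup>2}"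
  have J: "finite J" unfolding J_def using jump_squares_summable C by (intro finite_superlevel) auto
  have small_jumps: "\<bar>f n u\<bar> \<le> C * (norm (jump x u))\<^sup>2"
    if hess: "\<forall>t\<in>{0..T}. \<forall>a. norm (a - x t) \<le> \<eta> \<longrightarrow> norm (Ha n t a) \<le> C"
      and u: "u \<in> {0<..T}" "u \<notin> J" for n u
  proof (cases "\<exists>i\<in>steps n. p n (Suc i) = u")
    case True
    then obtain i where i: "i \<in> steps n" "p n (Suc i) = u" by auto
    have l: "left_lim (xn n) u = left_lim x u" using left_lim_xn[OF i(1)] i(2) by simp
    have u': "u \<in> {0..T}" using u by auto
    have small: "norm (jump x u) \<le> \<eta>"
    proof -
      have "(norm (jump x u))\<^sup>2 \<le> \<eta>\<^sup>2" using u by (auto simp: J_def)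
      then show ?thesis by (rule power2_le_imp_le) (use C(2) in simp)
    qed
    have near: "norm (left_lim x u + \<theta> *\<^sub>R jump x u - x u) \<le> \<eta>" if "\<theta> \<in> {0..1}" for \<theta> :: real
    proof -
      have "left_lim x u + \<theta> *\<^sub>R jump x u - x u = - (1 - \<theta>) *\<^sub>R jump x u"
        by (simp add: jump_def algebra_simps)
      then have "norm (left_lim x u + \<theta> *\<^sub>R jump x u - x u) = (1 - \<theta>) * norm (jump x u)"
        using that by simp
      also have "\<dots> \<le> 1 * \<eta>" using that small by (intro mult_mono) auto
      finally show ?thesis by simp
    qed
    have inU: "left_lim x u + \<theta> *\<^sub>R jump x u \<in> U" if "\<theta> \<in> {0..1}" for \<theta> :: real
      by (rule C(3)[OF u' near[OF that]])
    interpret vert_segment "{0..T}" U S F u "Xa n u (left_lim x u)" "V n u" "jump x u"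
      by unfold_locales (use twice_diff u' inU in \<open>auto intro!: V_cadlag Xa_cadlag left_lim_x_in\<close>)
    obtain \<theta> where \<theta>: "\<theta> \<in> {0..1}"
      "F u (vert (Xa n u (left_lim x u)) u (jump x u)) (V n u) = Fa n u (left_lim x u)
        + Ga n u (left_lim x u) \<bullet> jump x u
        + (vhess F u (vert (Xa n u (left_lim x u)) u (\<theta> *\<^sub>R jump x u)) (V n u) *v jump x u) \<bullet> jump x u / 2"
      by (rule taylor)
    let ?H = "Ha n u (left_lim x u + \<theta> *\<^sub>R jump x u)"
    have "f n u = (?H *v jump x u) \<bullet> jump x u / 2"
      using \<theta>(2) True l by (simp add: f_def JT_def jump_def)
    then have "\<bar>f n u\<bar> \<le> \<bar>(?H *v jump x u) \<bullet> jump x u\<bar>" by simp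
    also have "\<dots> \<le> norm ?H * norm (jump x u) * norm (jump x u)" by (rule abs_bilinear_le)
    also have "\<dots> \<le> C * norm (jump x u) * norm (jump x u)"
      using hess u' near[OF \<theta>(1)] by (intro mult_right_mono) auto
    finally show ?thesis by (simp add: power2_eq_square mult.assoc)
  next
    case False
    then show ?thesis using C by (simp add: f_def)
  qed
  \<comment> \<open>On the finite set of large jumps the absolute value of the limit plus 1
    dominates eventually; elsewhere the Taylor bound does.\<close>
  define g where "g u = C * (norm (jump x u))\<^sup>2 + (if u \<in> J then \<bar>jump_term u\<bar> + 1 else 0)" for u
  have "(\<lambda>u. if u \<in> J then \<bar>jump_term u\<bar> + 1 else 0) summable_on {0<..T}"
  proof -
    have "(\<lambda>u. \<bar>jump_term u\<bar> + 1) summable_on J" using J by simp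
    then show ?thesis
      by (rule summable_on_cong_neutral[THEN iffD1, rotated -1]) (auto simp: J_def)
  qed
  then have g: "g summable_on {0<..T}"
    unfolding g_def by (intro summable_on_add summable_on_cmult_right jump_squares_summable)
  have "\<forall>\<^sub>F n in sequentially. \<forall>u\<in>J. \<bar>f n u\<bar> \<le> \<bar>jump_term u\<bar> + 1"
  proof (rule eventually_ball_finite[OF J], rule ballI)
    fix u assume "u \<in> J"
    then have "(\<lambda>n. \<bar>f n u\<bar>) \<longlonglongrightarrow> \<bar>jump_term u\<bar>" using f_lim[of u] by (intro tendsto_rabs) (auto simp: J_def)
    from order_tendstoD(2)[OF this, of "\<bar>jump_term u\<bar> + 1"]
    show "\<forall>\<^sub>F n in sequentially. \<bar>f n u\<bar> \<le> \<bar>jump_term u\<bar> + 1"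
      by (auto elim!: eventually_mono)
  qed
  with bnd have dom: "\<forall>\<^sub>F n in sequentially. \<forall>u\<in>{0<..T}. \<bar>f n u\<bar> \<le> g u"
  proof eventually_elim
    case (elim n)
    show ?case
    proof
      fix u assume u: "u \<in> {0<..T}"
      show "\<bar>f n u\<bar> \<le> g u"
      proof (cases "u \<in> J")
        case True
        then have "\<bar>f n u\<bar> \<le> \<bar>jump_term u\<bar> + 1" using elim by blast
        moreover have "0 \<le> C * (norm (jump x u))\<^sup>2" using C by simp
        ultimately show ?thesis unfolding g_def using True by auto
      next
        case False
        then show ?thesis using small_jumps[OF elim(1) u False] by (simp add: g_def)
      qed
    qed
  qed
  show "jump_term summable_on {0<..T}"
    by (rule infsum_dominated_convergence(1)[OF g f_lim dom])
  have "(\<lambda>n. infsum (f n) {0<..T}) \<longlonglongrightarrow> infsum jump_term {0<..T}"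
    by (rule infsum_dominated_convergence(2)[OF g f_lim dom])
  moreover have "infsum (f n) {0<..T} = (\<Sum>i\<in>steps n. JT n (p n (Suc i)))" for n
    unfolding f_def by (rule sum_right_ends_as_infsum[symmetric])
  ultimately show "(\<lambda>n. \<Sum>i\<in>steps n. JT n (p n (Suc i))) \<longlonglongrightarrow> infsum jump_term {0<..T}" by simp
qed

text \<open>The horizontal Lipschitz property bounds the change of the gradient by a multiple of the
  step length. At the right end predictability exchanges the left limit of v^n for its
  value.\<close>

lemma gradient_horizontal_error:
  "(\<lambda>n. \<Sum>i\<in>steps n. (Ga n (p n (Suc i)) (left_lim x (p n (Suc i)))
      - Ga n (p n i) (xn n (p n i))) \<bullet> jump x (p n (Suc i))) \<longlonglongrightarrow> 0"
proof -
  obtain C where C: "\<forall>\<^sub>F n in sequentially. \<forall>t1 t2. 0 \<le> t1 \<longrightarrow> t1 < t2 \<longrightarrow> t2 \<le> T \<longrightarrow>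
      norm (vgrad F t2 (hext (Xa n t1 (xn n t1)) t1 (t2 - t1)) (hext (V n t1) t1 (t2 - t1))
        - Ga n t1 (xn n t1)) \<le> C * (t2 - t1)"
    by (rule near_bounds) (rule that)
  have "(\<lambda>n. C * (\<Sum>i\<in>steps n. (p n (Suc i) - p n i) * norm (jump x (p n (Suc i))))) \<longlonglongrightarrow> C * 0"
    by (intro tendsto_mult tendsto_const length_jump_products_vanish)
  then have "(\<lambda>n. C * (\<Sum>i\<in>steps n. (p n (Suc i) - p n i) * norm (jump x (p n (Suc i))))) \<longlonglongrightarrow> 0" by simp
  then show ?thesis
  proof (rule Lim_null_comparison[rotated])
    show "\<forall>\<^sub>F n in sequentially. norm (\<Sum>i\<in>steps n. (Ga n (p n (Suc i)) (left_lim x (p n (Suc i)))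
      - Ga n (p n i) (xn n (p n i))) \<bullet> jump x (p n (Suc i)))
      \<le> C * (\<Sum>i\<in>steps n. (p n (Suc i) - p n i) * norm (jump x (p n (Suc i))))"
      using C
    proof eventually_elim
      case (elim n)
      show ?case
        unfolding sum_distrib_left
      proof (rule sum_norm_le)
        fix i assume i: "i \<in> steps n"
        let ?t = "p n i" and ?t' = "p n (Suc i)"
        have z: "Xa n ?t' (left_lim x ?t') \<in> cadlag ?t' U"
          using pts(2)[OF i] by (intro Xa_cadlag left_lim_x_in) auto
        have "vgrad F ?t' (hext (Xa n ?t (xn n ?t)) ?t (?t' - ?t)) (hext (V n ?t) ?t (?t' - ?t))
          = vgrad F ?t' (Xa n ?t' (left_lim x ?t')) (stop (vn n) ?t' (left_lim (vn n) ?t'))"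
          using hext_X[OF i, of ?t "?t' - ?t"] stepsD[OF i] left_lim_vn[OF i] by simp
        also have "\<dots> = Ga n ?t' (left_lim x ?t')"
          by (rule V_predictable[OF predictable_vgrad[OF predictable open_U] pts(2)[OF i] z])
        finally have "norm (Ga n ?t' (left_lim x ?t') - Ga n ?t (xn n ?t))
          \<le> C * (?t' - ?t)" using elim stepsD[OF i] by metis
        then show "norm ((Ga n ?t' (left_lim x ?t')
            - Ga n ?t (xn n ?t)) \<bullet> jump x ?t')
          \<le> C * ((?t' - ?t) * norm (jump x ?t'))"
          unfolding mult.assoc[symmetric] real_norm_def
          by (rule order_trans[OF Cauchy_Schwarz_ineq2 mult_right_mono]) simp
      qed
    qed
  qed
qed

text \<open>By the mean value theorem and the bounded Hessian the change of the gradient is at most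
  a multiple of the gap, which leaves products of gaps and jumps.\<close>

lemma gradient_vertical_error:
  "(\<lambda>n. \<Sum>i\<in>steps n. (Ga n (p n i) (xn n (p n i))
      - Ga n (p n i) (x (p n i))) \<bullet> jump x (p n (Suc i))) \<longlonglongrightarrow> 0"
proof -
  obtain C \<eta> where C: "C > 0" "\<eta> > 0" "\<And>t a. t \<in> {0..T} \<Longrightarrow> norm (a - x t) \<le> \<eta> \<Longrightarrow> a \<in> U"
    and bnd: "\<forall>\<^sub>F n in sequentially. \<forall>t\<in>{0..T}. \<forall>a. norm (a - x t) \<le> \<eta> \<longrightarrow> norm (Ha n t a) \<le> C"
    by (rule near_bounds) (rule that)
  have "(\<lambda>n. C * (\<Sum>i\<in>steps n. norm (\<delta> n i) * norm (jump x (p n (Suc i))))) \<longlonglongrightarrow> C * 0"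
    by (intro tendsto_mult tendsto_const gap_jump_products_vanish)
  then have "(\<lambda>n. C * (\<Sum>i\<in>steps n. norm (\<delta> n i) * norm (jump x (p n (Suc i))))) \<longlonglongrightarrow> 0" by simp
  then show ?thesis
  proof (rule Lim_null_comparison[rotated])
    show "\<forall>\<^sub>F n in sequentially. norm (\<Sum>i\<in>steps n. (Ga n (p n i) (xn n (p n i))
      - Ga n (p n i) (x (p n i))) \<bullet> jump x (p n (Suc i)))
      \<le> C * (\<Sum>i\<in>steps n. norm (\<delta> n i) * norm (jump x (p n (Suc i))))"
      using left_gap_small[OF C(2)] bnd
    proof eventually_elim
      case (elim n)
      show ?case
        unfolding sum_distrib_left
      proof (rule sum_norm_le)
        fix i assume i: "i \<in> steps n"
        let ?t = "p n i" and ?D = "jump x (p n (Suc i))"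
        have t: "?t \<in> {0..T}" using pts[OF i] by simp
        have small: "norm (x ?t + \<theta> *\<^sub>R \<delta> n i - x ?t) \<le> \<eta>" if "\<theta> \<in> {0..1}" for \<theta> :: real
        proof -
          have "norm (\<theta> *\<^sub>R \<delta> n i) = \<theta> * norm (\<delta> n i)" using that by simp
          also have "\<dots> \<le> 1 * \<eta>" using that elim(1) i C by (intro mult_mono) auto
          finally show ?thesis by simp
        qed
        have inU: "x ?t + \<theta> *\<^sub>R \<delta> n i \<in> U" if "\<theta> \<in> {0..1}" for \<theta> :: real
          by (rule C(3)[OF t small[OF that]])
        interpret vert_segment "{0..T}" U S F ?t "Xa n ?t (x ?t)" "V n ?t" "\<delta> n i"
          by unfold_locales (use twice_diff t inU inU[of 0] in \<open>auto intro!: V_cadlag Xa_cadlag x_in\<close>)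
        obtain \<theta> where \<theta>: "\<theta> \<in> {0..1}"
          "(vgrad F ?t (vert (Xa n ?t (x ?t)) ?t (\<delta> n i)) (V n ?t) - Ga n ?t (x ?t)) \<bullet> ?D
            = (vhess F ?t (vert (Xa n ?t (x ?t)) ?t (\<theta> *\<^sub>R \<delta> n i)) (V n ?t) *v \<delta> n i) \<bullet> ?D"
          by (rule gradient_mvt)
        let ?H = "Ha n ?t (x ?t + \<theta> *\<^sub>R \<delta> n i)"
        have "norm ((Ga n ?t (xn n ?t) - Ga n ?t (x ?t)) \<bullet> ?D)
          = \<bar>(?H *v \<delta> n i) \<bullet> ?D\<bar>" using \<theta>(2) X_eq[OF i] by simp
        also have "\<dots> \<le> norm ?H * norm (\<delta> n i) * norm ?D" by (rule abs_bilinear_le)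
        also have "\<dots> \<le> C * norm (\<delta> n i) * norm ?D"
          using elim(2) t small[OF \<theta>(1)] by (intro mult_right_mono) auto
        finally show "norm ((Ga n ?t (xn n ?t) - Ga n ?t (x ?t)) \<bullet> ?D)
          \<le> C * (norm (\<delta> n i) * norm ?D)" by (simp only: mult.assoc)
      qed
    qed
  qed
qed

text \<open>At a positive subdivision point x^n and \<open>x\<close> have the same left limit, so
  adding the jump yields the value of \<open>x\<close>. At time 0 the initial value prescribed in
  \<open>left_path_from\<close> achieves this, since x^n(0) itself is a left limit of
  \<open>x\<close> at the end of a step.\<close>

lemma pathwise_sum_eq:
  "pathwise_sum T p k F x v n
    = (\<Sum>i\<in>steps n. Ga n (p n i) (x (p n i)) \<bullet> (x (p n (Suc i)) - x (p n i)))"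
proof -
  have "pathwise_sum T p k F x v n = (\<Sum>i\<in>steps n.
        vgrad F (p n i)
          (vert (left_path_from (x 0) (xn n) (p n i)) (p n i) (jump x (p n i)))
          (left_path_from (v 0) (vn n) (p n i)) \<bullet> (x (p n (Suc i)) - x (p n i)))"
    unfolding pathwise_sum_def by (rule sum_steps) simp
  also have "\<dots> = (\<Sum>i\<in>steps n. Ga n (p n i) (x (p n i)) \<bullet> (x (p n (Suc i)) - x (p n i)))"
  proof (rule sum.cong)
    fix i assume i: "i \<in> steps n"
    let ?t = "p n i"
    have t: "?t \<in> {0..T}" using pts[OF i] by simp
    have "(if ?t = 0 then x 0 else left_lim (xn n) ?t) + jump x ?t = x ?t"
    proof (cases "?t = 0")
      case False
      then have "0 < ?t" "?t \<in> p n ` {..k n}" using stepsD[OF i] by auto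
      then obtain j where "j \<in> steps n" "p n (Suc j) = ?t" using point_is_right_end by metis
      then have "left_lim (xn n) ?t = left_lim x ?t" using left_lim_xn by metis
      then show ?thesis using False by (simp add: jump_def)
    qed simp
    then have 1: "vert (left_path_from (x 0) (xn n) ?t) ?t (jump x ?t) = Xa n ?t (x ?t)"
      by (simp add: left_path_from_eq_stop)
    have 2: "left_path_from (v 0) (vn n) ?t = stop (vn n) ?t (left_lim (vn n) ?t)"
      by (simp add: left_path_from_eq_stop vn_0)
    have "vgrad F ?t (Xa n ?t (x ?t)) (stop (vn n) ?t (left_lim (vn n) ?t)) = Ga n ?t (x ?t)"
      by (rule V_predictable[OF predictable_vgrad[OF predictable open_U] t Xa_cadlag[OF t x_in[OF t]]])
    then show "vgrad F ?t (vert (left_path_from (x 0) (xn n) ?t) ?t (jump x ?t)) (left_path_from (v 0) (vn n) ?t)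
        \<bullet> (x (p n (Suc i)) - x ?t)
      = Ga n ?t (x ?t) \<bullet> (x (p n (Suc i)) - x ?t)"
      unfolding 1 2 by simp
  qed simp
  finally show ?thesis .
qed

text \<open>Existence of the limit is a consequence: in the telescoping identity all other terms
  converge.\<close>

lemma pathwise_sum_limit:
  "pathwise_sum T p k F x v \<longlonglongrightarrow>
    F T (restrict x {0..T}) (restrict v {0..T}) - F 0 (restrict x {0..0}) (restrict v {0..0})
    - (LINT u:{0<..T}|lborel. DF u) - trace_qv_cont_integral T p k x (\<lambda>u. (1 / 2) *\<^sub>R Hess u)
    - infsum jump_term {0<..T}"
proof -
  define G where "G n t = Fa n t (x t)" for n t
  define h1 where "h1 n = (\<Sum>i\<in>steps n. Fa n (p n (Suc i)) (left_lim x (p n (Suc i)))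
      - Fa n (p n i) (xn n (p n i)))" for n
  define h2 where "h2 n = (\<Sum>i\<in>steps n. Fa n (p n i) (xn n (p n i)) - Fa n (p n i) (x (p n i))
      - Ga n (p n i) (x (p n i)) \<bullet> \<delta> n i)" for n
  define h3 where "h3 n = (\<Sum>i\<in>steps n. Fa n (p n (Suc i)) (x (p n (Suc i)))
      - Fa n (p n (Suc i)) (left_lim (xn n) (p n (Suc i)))
      - Ga n (p n (Suc i)) (left_lim (xn n) (p n (Suc i))) \<bullet> jump x (p n (Suc i)))" for n
  define h4 where "h4 n = (\<Sum>i\<in>steps n. (Ga n (p n (Suc i)) (left_lim x (p n (Suc i)))
      - Ga n (p n i) (xn n (p n i))) \<bullet> jump x (p n (Suc i)))" for n
  define h5 where "h5 n = (\<Sum>i\<in>steps n. (Ga n (p n i) (xn n (p n i))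
      - Ga n (p n i) (x (p n i))) \<bullet> jump x (p n (Suc i)))" for n
  have tele: "(\<Sum>i\<in>steps n. G n (p n (Suc i)) - G n (p n i)) = G n T - G n 0" for n
  proof -
    have "(\<Sum>i\<in>steps n. G n (p n (Suc i)) - G n (p n i)) = (\<Sum>i<k n. G n (p n (Suc i)) - G n (p n i))"
      by (rule sum_steps[symmetric]) simp
    then show ?thesis by (simp add: sum_lessThan_telescope[of "\<lambda>i. G n (p n i)"])
  qed
  txt \<open>
    Over a step from \<open>t\<close> to \<open>t'\<close> the endpoint moves from \<open>x t\<close> to the left limit at \<open>t'\<close> (\<open>h2\<close>), time
    advances (\<open>h1\<close>), and the endpoint jumps to \<open>x t'\<close> (\<open>h3\<close>). Carrying the gradient at the jump back
    to the left end of the step costs \<open>h4\<close> and \<open>h5\<close>.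
  \<close>
  have split: "G n T - G n 0 = pathwise_sum T p k F x v n + h1 n + h2 n + h3 n + h4 n + h5 n" for n
    unfolding tele[symmetric] pathwise_sum_eq h1_def h2_def h3_def h4_def h5_def sum.distrib[symmetric]
  proof (rule sum.cong)
    fix i assume i: "i \<in> steps n"
    have incr: "x (p n (Suc i)) - x (p n i) = \<delta> n i + jump x (p n (Suc i))" by (simp add: jump_def)
    show "G n (p n (Suc i)) - G n (p n i)
      = Ga n (p n i) (x (p n i)) \<bullet> (x (p n (Suc i)) - x (p n i))
      + (Fa n (p n (Suc i)) (left_lim x (p n (Suc i)))
        - Fa n (p n i) (xn n (p n i)))
      + (Fa n (p n i) (xn n (p n i)) - Fa n (p n i) (x (p n i))
        - Ga n (p n i) (x (p n i)) \<bullet> \<delta> n i)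
      + (Fa n (p n (Suc i)) (x (p n (Suc i)))
        - Fa n (p n (Suc i)) (left_lim (xn n) (p n (Suc i)))
        - Ga n (p n (Suc i)) (left_lim (xn n) (p n (Suc i))) \<bullet> jump x (p n (Suc i)))
      + (Ga n (p n (Suc i)) (left_lim x (p n (Suc i)))
        - Ga n (p n i) (xn n (p n i))) \<bullet> jump x (p n (Suc i))
      + (Ga n (p n i) (xn n (p n i))
        - Ga n (p n i) (x (p n i))) \<bullet> jump x (p n (Suc i))"
      unfolding G_def left_lim_xn[OF i] incr inner_diff_left inner_add_right by linarith
  qed simp
  have T0: "T \<in> {0..T}" using T_pos by simp
  have cF: "continuous_fixed_times {0..T} U S F" using lc_F by (auto intro!: left_continuous_imp_fixed_times)
  have GT: "(\<lambda>n. G n T) \<longlonglongrightarrow> F T (restrict x {0..T}) (restrict v {0..T})"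
    unfolding G_def restrict_eq_stop by (rule fixed_time_limit[OF cF T0 T0 x_in[OF T0] x_in[OF T0] tendsto_const])
  \<comment> \<open>At time 0 the value is the same at every stage: the endpoint is x(0), and v^n(0)
    = v(0).\<close>
  have G0: "G n 0 = F 0 (restrict x {0..0}) (restrict v {0..0})" for n
  proof -
    have "Xa n 0 (x 0) = stop x 0 (x 0)" "V n 0 = stop v 0 (v 0)" by (auto simp: vn_0 intro: stop_cong)
    then show ?thesis unfolding G_def restrict_eq_stop by simp
  qed
  have "(\<lambda>n. G n T - F 0 (restrict x {0..0}) (restrict v {0..0}) - h1 n - h2 n - h3 n - h4 n - h5 n) \<longlonglongrightarrow>
    F T (restrict x {0..T}) (restrict v {0..T}) - F 0 (restrict x {0..0}) (restrict v {0..0})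
    - (LINT u:{0<..T}|lborel. DF u) - trace_qv_cont_integral T p k x (\<lambda>u. (1 / 2) *\<^sub>R Hess u)
    - infsum jump_term {0<..T} - 0 - 0"
    unfolding h1_def h2_def h3_def h4_def h5_def
    by (intro tendsto_diff GT tendsto_const horizontal_limit(2) second_order_limit(2) jump_limit(2)
        gradient_horizontal_error gradient_vertical_error)
  moreover have "pathwise_sum T p k F x v
      = (\<lambda>n. G n T - F 0 (restrict x {0..0}) (restrict v {0..0}) - h1 n - h2 n - h3 n - h4 n - h5 n)"
    using split by (simp add: G0 fun_eq_iff)
  ultimately show ?thesis by simp
qed

end

theorem theorem4:
  fixes T :: real
    and U :: "(real ^ 'd) set" and S :: "(real ^ 'm) set"
    and x :: "real \<Rightarrow> real ^ 'd" and v :: "real \<Rightarrow> real ^ 'm"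
    and p :: "nat \<Rightarrow> nat \<Rightarrow> real" and k :: "nat \<Rightarrow> nat"
    and F :: "('d, 'm, real) functional"
  assumes "T > 0" and "open U" and "S \<in> sets borel"
    and "x \<in> cadlag T U" and "v \<in> cadlag T S"
    and "subdivisions T p k"
    and "has_qv T p k x"
    and "(\<lambda>n. SUP t\<in>{0..T} - p n ` {..k n}. norm (jump x t) + norm (jump v t)) \<longlonglongrightarrow> 0"
    and "C12 T U S F"
    and "predictable_second T U S F"
    and "twice_vert_differentiable_on {0..T} U S F"
    and "locally_bounded_functional T {0..T} U S (vhess F)"
    and "locally_bounded_functional T {0..<T} U S (hderiv F)"
    and "left_continuous_functional {0..T} U S F"
    and "left_continuous_functional {0..T} U S (vgrad F)"
    and "left_continuous_functional {0..T} U S (vhess F)"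
    and "horizontally_locally_lipschitz T U S (vgrad F)"
  shows "convergent (pathwise_sum T p k F x v) \<and>
    set_integrable lborel {0<..T} (\<lambda>u. hderiv F u (left_path x u) (left_path v u)) \<and>
    (\<forall>i j. qv_cont_integrable T p k x i j
           (\<lambda>u. vhess F u (left_path x u) (left_path v u) $ i $ j)) \<and>
    (\<lambda>u. F u (restrict x {0..u}) (restrict v {0..u}) - F u (left_path x u) (left_path v u)
               - vgrad F u (left_path x u) (left_path v u) \<bullet> jump x u) summable_on {0<..T} \<and>
    F T (restrict x {0..T}) (restrict v {0..T}) - F 0 (restrict x {0..0}) (restrict v {0..0})
         = set_lebesgue_integral lborel {0<..T}
             (\<lambda>u. hderiv F u (left_path x u) (left_path v u))
         + trace_qv_cont_integral T p k x
             (\<lambda>u. (1 / 2) *\<^sub>R vhess F u (left_path x u) (left_path v u))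
         + pathwise_integral T p k F x v
         + (\<Sum>\<^sub>\<infinity>u\<in>{0<..T}.
              F u (restrict x {0..u}) (restrict v {0..u}) - F u (left_path x u) (left_path v u)
              - vgrad F u (left_path x u) (left_path v u) \<bullet> jump x u)"
proof -
  interpret ito_setting T p k U S x v F
    using assms by unfold_locales
  note lim = pathwise_sum_limit
  have "convergent (pathwise_sum T p k F x v)" using lim by (rule convergentI)
  moreover have "pathwise_integral T p k F x v = F T (restrict x {0..T}) (restrict v {0..T})
    - F 0 (restrict x {0..0}) (restrict v {0..0}) - (LINT u:{0<..T}|lborel. DF u)
    - trace_qv_cont_integral T p k x (\<lambda>u. (1 / 2) *\<^sub>R Hess u) - infsum jump_term {0<..T}"
    unfolding pathwise_integral_def using lim by (rule limI)
  ultimately show ?thesis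
    using horizontal_limit(1) second_order_limit(1) jump_limit(1) by auto
qed

end
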